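(* Let $X$ be a finite bikei. The number of $X$-labelings of a virtual marked vertex diagram is an invariant of virtual knotted surfaces; that is, if two virtual marked vertex diagrams $D$ and $D'$ are related by a finite sequence of Yoshikawa moves and detour moves, then $D$ and $D'$ have the same number of $X$-labelings.
   Context: Bikei. A bikei is a set $X$ with two binary operations $(x,y)\mapsto x^y$ and $(x,y)\mapsto x_y$ such that for all $x,y,z\in X$: (i) $x^x=x_x$; (ii) the maps $\alpha_y,\beta_y:X\to X$, $\alpha_y(x)=x_y$, $\beta_y(x)=x^y$, and $S:X\times X\to X\times X$, $S(x,y)=(y_x,x^y)$, are bijective; (iii) (exchange laws) $(x^y)^{(z^y)}=(x^z)^{(y_z)}$, $(x^y)_{(z^y)}=(x_z)^{(y_z)}$, $(x_y)_{(z_y)}=(x_z)_{(y^z)}$; (iv) $(x^y)^y=x=(x_y)_y$, $x^{(y_x)}=x^y$ and $y_{(x^y)}=y_x$. Diagrams. A virtual marked vertex diagram is a finite plane 4-valent graph (circle components without vertices are allowed), considered up to planar isotopy, each of whose vertices is a classical crossing (with over/under information), a saddle crossing (marked vertex), i.e. a vertex carrying a marker that says which of its two planar smoothings is used just below the level $x_3=0$ (the "$-$" smoothing), the other one being used just above (the "$+$" smoothing), or a virtual crossing (no additional information). The semiarcs are the portions of the diagram between classical or saddle crossing points; both the over- and the under-strand are divided at a classical crossing, and semiarcs are not divided at virtual crossings. A closed curve with no classical or saddle crossings is one semiarc. A virtual knotted surface is an equivalence class of virtual marked vertex diagrams under Yoshikawa moves and detour moves. Labelings. An $X$-labeling assigns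 an element of $X$ to each semiarc so that: (a) at each classical crossing, if $x$ is the label of either under-semiarc and $y$ the label of either over-semiarc, then the other under-semiarc has label $x^y$ and the other over-semiarc has label $y_x$; (b) at each saddle crossing all four incident semiarcs have the same label. Virtual crossings impose no condition. Detour move. Any portion of a strand having only virtual crossings may be replaced by any other strand with the same endpoints all of whose crossings with the rest of the diagram (and itself) are virtual. Yoshikawa moves. These are the following local moves (performed in disks containing no virtual crossings), together with their inverses and the versions obtained by reflecting the plane, by switching all the classical crossings involved, and by exchanging the $-$ and $+$ smoothings at all the saddle crossings involved. $\Gamma_1,\Gamma_2,\Gamma_3$: the unoriented Reidemeister moves I, II, III. $\Gamma_4$: a strand passing over (or under) two edges adjacent to a saddle crossing is moved across the saddle crossing so that it passes over (respectively under) the other two edges. $\Gamma_5$: for a saddle crossing with edges NW, NE, SW, SE, a classical crossing between the NE and SE edges is replaced by a classical crossing (half twist of the same handedness) between the NW and SW edges, the marker (horizontal or vertical) being unchanged. $\Gamma_6$: a saddle crossing, with either marker, two of whose adjacent edges are joined by a loop bounding an empty disk is replaced by a simple arc. $\Gamma_7$: in a disk with six boundary points $1,\dots,6$ in cyclic order, a pair of saddle crossings joined by an edge, one having remaining edges ending at $1,2,3$ and the other having remaining edges ending at $4,5,6$, is replaced by a pair of saddle crossings joined by an edge, with remaining edges ending at $2,3,4$ and $5,6,1$ respectively (all embedded without other crossings); on both sides the markers are such that the $-$ smoothings connect $1$–$2$, $3$–$4$, $5$–$6$ and the $+$ smoothings connect $2$–$3$, $4$–$5$, $6$–$1$. $\Gamma_8$: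 let $v_1$ be a saddle crossing with edges NW, NE, SW, SE whose $-$ smoothing connects NW–NE and SW–SE, and let $v_2$ be a saddle crossing in the region to the west of $v_1$, with two edges ending at the west boundary of the disk and with its other two edges being two parallel strands running to the east boundary, the $-$ smoothing of $v_2$ connecting the two west ends to each other and the two parallel strands to each other; the diagram in which the two parallel strands pass over the NW edge and then under the NE edge is replaced by the one in which they pass over the SW edge and then under the SE edge (each diagram has four classical crossings). *)

theory Defs
  imports "HOL-Analysis.Analysis"
begin

section \<open>Bikei\<close>

text \<open>\<open>up x y\<close> stands for $x^y$ and \<open>dn x y\<close> for $x_y$. Closure of \<open>X\<close> under the
  operations is part of the \<open>bij_betw\<close> assumptions.\<close>

locale bikei =
  fixes X :: "'a set" and up :: "'a \<Rightarrow> 'a \<Rightarrow> 'a" and dn :: "'a \<Rightarrow> 'a \<Rightarrow> 'a"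
  assumes diagonal: "x \<in> X \<Longrightarrow> up x x = dn x x"
    and alpha_bij: "y \<in> X \<Longrightarrow> bij_betw (\<lambda>x. dn x y) X X"
    and beta_bij: "y \<in> X \<Longrightarrow> bij_betw (\<lambda>x. up x y) X X"
    and S_bij: "bij_betw (\<lambda>(x, y). (dn y x, up x y)) (X \<times> X) (X \<times> X)"
    and exchange1: "\<lbrakk>x \<in> X; y \<in> X; z \<in> X\<rbrakk> \<Longrightarrow> up (up x y) (up z y) = up (up x z) (dn y z)"
    and exchange2: "\<lbrakk>x \<in> X; y \<in> X; z \<in> X\<rbrakk> \<Longrightarrow> dn (up x y) (up z y) = up (dn x z) (dn y z)"
    and exchange3: "\<lbrakk>x \<in> X; y \<in> X; z \<in> X\<rbrakk> \<Longrightarrow> dn (dn x y) (dn z y) = dn (dn x z) (up y z)"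
    and up_invol: "\<lbrakk>x \<in> X; y \<in> X\<rbrakk> \<Longrightarrow> up (up x y) y = x"
    and dn_invol: "\<lbrakk>x \<in> X; y \<in> X\<rbrakk> \<Longrightarrow> dn (dn x y) y = x"
    and up_dn: "\<lbrakk>x \<in> X; y \<in> X\<rbrakk> \<Longrightarrow> up x (dn y x) = up x y"
    and dn_up: "\<lbrakk>x \<in> X; y \<in> X\<rbrakk> \<Longrightarrow> dn y (up x y) = dn y x"


section \<open>Virtual marked vertex diagrams\<close>

text \<open>A diagram is an actual subset \<open>graph\<close> of the plane with three finite sets of vertices.
  The extra information at the vertices is stored in two sets of which only the germs matter:
  \<^item> near a classical crossing, \<open>over\<close> is the over-strand;
  \<^item> near a saddle crossing, \<open>minus_sectors\<close> consists of the two opposite open sectors of the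
    complement of the graph whose two bounding edges are connected by the $-$ smoothing.
    (So the $+$ smoothing connects the edges bounding each of the other two sectors.)\<close>

record diagram =
  graph :: "complex set"
  classical :: "complex set"
  saddle :: "complex set"
  virtual :: "complex set"
  over :: "complex set"
  minus_sectors :: "complex set"

definition vertices :: "diagram \<Rightarrow> complex set" where
  "vertices D = classical D \<union> saddle D \<union> virtual D"

definition edge_chart :: "diagram \<Rightarrow> (complex \<Rightarrow> complex) \<Rightarrow> bool" where
  "edge_chart D \<phi> \<longleftrightarrow> continuous_on (cball 0 1) \<phi> \<and> inj_on \<phi> (cball 0 1) \<and>
     graph D \<inter> \<phi> ` cball 0 1 = \<phi> ` {z \<in> cball 0 1. Im z = 0}"

definition crossing_chart :: "diagram \<Rightarrow> (complex \<Rightarrow> complex) \<Rightarrow> bool" where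
  "crossing_chart D \<phi> \<longleftrightarrow> continuous_on (cball 0 1) \<phi> \<and> inj_on \<phi> (cball 0 1) \<and>
     graph D \<inter> \<phi> ` cball 0 1 = \<phi> ` {z \<in> cball 0 1. Re z = 0 \<or> Im z = 0} \<and>
     vertices D \<inter> \<phi> ` cball 0 1 = {\<phi> 0}"

definition classical_chart :: "diagram \<Rightarrow> (complex \<Rightarrow> complex) \<Rightarrow> bool" where
  "classical_chart D \<phi> \<longleftrightarrow> crossing_chart D \<phi> \<and> \<phi> 0 \<in> classical D \<and>
     over D \<inter> \<phi> ` cball 0 1 = \<phi> ` {z \<in> cball 0 1. Im z = 0}"

definition saddle_chart :: "diagram \<Rightarrow> (complex \<Rightarrow> complex) \<Rightarrow> bool" where
  "saddle_chart D \<phi> \<longleftrightarrow> crossing_chart D \<phi> \<and> \<phi> 0 \<in> saddle D \<and>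
     minus_sectors D \<inter> \<phi> ` cball 0 1 = \<phi> ` {z \<in> cball 0 1. Re z * Im z > 0}"

definition virtual_chart :: "diagram \<Rightarrow> (complex \<Rightarrow> complex) \<Rightarrow> bool" where
  "virtual_chart D \<phi> \<longleftrightarrow> crossing_chart D \<phi> \<and> \<phi> 0 \<in> virtual D"

text \<open>A compact set which is locally an arc, except at finitely many points where it is locally
  a cross, is the same as a finite plane 4-valent graph, possibly with loops, multiple edges and
  circle components.\<close>

definition vmv_diagram :: "diagram \<Rightarrow> bool" where
  "vmv_diagram D \<longleftrightarrow>
     compact (graph D) \<and> finite (vertices D) \<and> vertices D \<subseteq> graph D \<and>
     classical D \<inter> saddle D = {} \<and> classical D \<inter> virtual D = {} \<and> saddle D \<inter> virtual D = {} \<and>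
     (\<forall>p \<in> graph D - vertices D. \<exists>\<phi>. edge_chart D \<phi> \<and> \<phi> 0 = p) \<and>
     (\<forall>v \<in> classical D. \<exists>\<phi>. classical_chart D \<phi> \<and> \<phi> 0 = v) \<and>
     (\<forall>v \<in> saddle D. \<exists>\<phi>. saddle_chart D \<phi> \<and> \<phi> 0 = v) \<and>
     (\<forall>v \<in> virtual D. \<exists>\<phi>. virtual_chart D \<phi> \<and> \<phi> 0 = v)"


section \<open>Semiarcs and labelings\<close>

text \<open>Two points lie on the same semiarc iff they are joined along edges of the graph, where one
  may go straight through virtual crossings. (Precomposing a chart with \<open>(*) \<i>\<close> interchanges the
  two axes, so both strands through the crossing are covered.) Semiarcs are represented without
  the virtual crossing points, which may belong to two of them.\<close>

inductive same_semiarc :: "diagram \<Rightarrow> complex \<Rightarrow> complex \<Rightarrow> bool" for D where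
  along: "connected_component (graph D - vertices D) p q \<Longrightarrow> same_semiarc D p q"
| across: "virtual_chart D \<phi> \<Longrightarrow> same_semiarc D (\<phi> 1) (\<phi> (-1))"
| trans: "same_semiarc D p q \<Longrightarrow> same_semiarc D q r \<Longrightarrow> same_semiarc D p r"

definition semiarc_of :: "diagram \<Rightarrow> complex \<Rightarrow> complex set" where
  "semiarc_of D p = {q. same_semiarc D p q}"

definition semiarcs :: "diagram \<Rightarrow> complex set set" where
  "semiarcs D = semiarc_of D ` (graph D - vertices D)"

text \<open>In a classical chart the over-semiarcs at the crossing are those of \<open>\<phi> 1\<close> and \<open>\<phi> (-1)\<close>,
  the under-semiarcs those of \<open>\<phi> \<i>\<close> and \<open>\<phi> (-\<i>)\<close>.\<close>

definition labelings ::
  "'a set \<Rightarrow> ('a \<Rightarrow> 'a \<Rightarrow> 'a) \<Rightarrow> ('a \<Rightarrow> 'a \<Rightarrow> 'a) \<Rightarrow> diagram \<Rightarrow> (complex set \<Rightarrow> 'a) set" where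
  "labelings X up dn D =
     {f \<in> semiarcs D \<rightarrow>\<^sub>E X.
        (\<forall>\<phi>. classical_chart D \<phi> \<longrightarrow>
           (\<forall>u \<in> {\<i>, -\<i>}. \<forall>w \<in> {1, -1}.
              let x = f (semiarc_of D (\<phi> u)); y = f (semiarc_of D (\<phi> w))
              in f (semiarc_of D (\<phi> (-u))) = up x y \<and> f (semiarc_of D (\<phi> (-w))) = dn y x)) \<and>
        (\<forall>\<phi>. saddle_chart D \<phi> \<longrightarrow>
           (\<forall>u \<in> {1, \<i>, -1, -\<i>}. f (semiarc_of D (\<phi> u)) = f (semiarc_of D (\<phi> 1))))}"


section \<open>Planar isotopy\<close>

definition transport :: "(complex \<Rightarrow> complex) \<Rightarrow> diagram \<Rightarrow> diagram" where
  "transport h D = \<lparr>graph = h ` graph D, classical = h ` classical D, saddle = h ` saddle D,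
     virtual = h ` virtual D, over = h ` over D, minus_sectors = h ` minus_sectors D\<rparr>"

definition same_diagram :: "diagram \<Rightarrow> diagram \<Rightarrow> bool" where
  "same_diagram D D' \<longleftrightarrow>
     graph D = graph D' \<and> classical D = classical D' \<and> saddle D = saddle D' \<and>
     virtual D = virtual D' \<and>
     (\<forall>v \<in> classical D. \<forall>\<^sub>F z in nhds v. z \<in> over D \<longleftrightarrow> z \<in> over D') \<and>
     (\<forall>v \<in> saddle D. \<forall>\<^sub>F z in nhds v. z \<in> minus_sectors D \<longleftrightarrow> z \<in> minus_sectors D')"

definition ambient_isotopy_end :: "(complex \<Rightarrow> complex) \<Rightarrow> bool" where
  "ambient_isotopy_end h \<longleftrightarrow>
     homotopic_with_canon (\<lambda>f. \<exists>g. homeomorphism UNIV UNIV f g) UNIV UNIV id h"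

definition planar_isotopic :: "diagram \<Rightarrow> diagram \<Rightarrow> bool" where
  "planar_isotopic D D' \<longleftrightarrow> (\<exists>h. ambient_isotopy_end h \<and> same_diagram (transport h D) D')"


section \<open>Detour move\<close>

text \<open>A portion of a strand whose only crossings are virtual: it follows the edges, goes straight
  through each virtual crossing it meets, and traverses every point at most once, apart from
  virtual crossings with itself.\<close>

definition virtual_strand :: "diagram \<Rightarrow> (real \<Rightarrow> complex) \<Rightarrow> bool" where
  "virtual_strand D \<gamma> \<longleftrightarrow>
     path \<gamma> \<and> path_image \<gamma> \<subseteq> graph D - (classical D \<union> saddle D) \<and>
     pathstart \<gamma> \<notin> virtual D \<and> pathfinish \<gamma> \<notin> virtual D \<and>
     (\<forall>s \<in> {0..1}. \<forall>t \<in> {0..1}. \<gamma> s = \<gamma> t \<longrightarrow> s = t \<or> \<gamma> s \<in> virtual D) \<and>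
     (\<forall>t \<in> {0<..<1}. \<gamma> t \<in> virtual D \<longrightarrow>
        (\<exists>\<phi> e. virtual_chart D \<phi> \<and> \<phi> 0 = \<gamma> t \<and> e > 0 \<and> inj_on \<gamma> {t-e..t+e} \<and>
           \<gamma> ` {t-e..t+e} \<subseteq> \<phi> ` {z \<in> cball 0 1. Im z = 0}))"

text \<open>The closure restores the endpoints of the strand, and the points where the strand crosses
  the rest of the diagram.\<close>

definition detour_move :: "diagram \<Rightarrow> diagram \<Rightarrow> bool" where
  "detour_move D D' \<longleftrightarrow> (\<exists>\<gamma> \<gamma>'. virtual_strand D \<gamma> \<and> virtual_strand D' \<gamma>' \<and>
     pathstart \<gamma>' = pathstart \<gamma> \<and> pathfinish \<gamma>' = pathfinish \<gamma> \<and>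
     closure (graph D - path_image \<gamma>) = closure (graph D' - path_image \<gamma>') \<and>
     virtual D - path_image \<gamma> = virtual D' - path_image \<gamma>' \<and>
     classical D = classical D' \<and> saddle D = saddle D' \<and>
     over D = over D' \<and> minus_sectors D = minus_sectors D')"


section \<open>Yoshikawa moves\<close>

text \<open>The local pictures live in the following disk. All other disks are obtained from it by planar isotopy.\<close>

definition disk :: "complex set" where
  "disk = cbox (Complex (-4) (-4)) (Complex 4 4)"

definition open_disk :: "complex set" where
  "open_disk = box (Complex (-4) (-4)) (Complex 4 4)"

definition restrict_to :: "complex set \<Rightarrow> diagram \<Rightarrow> diagram" where
  "restrict_to K D = \<lparr>graph = graph D \<inter> K, classical = classical D \<inter> K, saddle = saddle D \<inter> K,
     virtual = virtual D \<inter> K, over = over D \<inter> K, minus_sectors = minus_sectors D \<inter> K\<rparr>"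

definition pt :: "real \<times> real \<Rightarrow> complex" where
  "pt p = Complex (fst p) (snd p)"

fun polyline :: "(real \<times> real) list \<Rightarrow> complex set" where
  "polyline (p # q # ps) = closed_segment (pt p) (pt q) \<union> polyline (q # ps)"
| "polyline _ = {}"

definition sector :: "complex \<Rightarrow> complex \<Rightarrow> complex \<Rightarrow> complex set" where
  "sector v a b = {v + s *\<^sub>R a + t *\<^sub>R b | s t. 0 < s \<and> s < 1 \<and> 0 < t \<and> t < 1}"

text \<open>\<open>tangle ls cs ss\<close> is the picture with strands \<open>ls\<close>, classical crossings at the points \<open>p\<close>
  with over-strand in direction \<open>\<plusminus>a\<close> for \<open>(p, a)\<close> in \<open>cs\<close>, and saddle crossings at the points \<open>p\<close>
  with edges leaving in the directions \<open>a, b, -a, -b\<close> and $-$ smoothing connecting \<open>a\<close> with \<open>b\<close>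
  and \<open>-a\<close> with \<open>-b\<close>, for \<open>(p, a, b)\<close> in \<open>ss\<close>. The strands are drawn straight through saddles.\<close>

definition tangle ::
  "(real \<times> real) list list \<Rightarrow> ((real \<times> real) \<times> (real \<times> real)) list \<Rightarrow>
   ((real \<times> real) \<times> (real \<times> real) \<times> (real \<times> real)) list \<Rightarrow> diagram" where
  "tangle ls cs ss =
     \<lparr>graph = (\<Union>l \<in> set ls. polyline l),
      classical = {pt p | p a. (p, a) \<in> set cs},
      saddle = {pt p | p a b. (p, a, b) \<in> set ss},
      virtual = {},
      over = (\<Union>(p, a) \<in> set cs. closed_segment (pt p - pt a) (pt p + pt a)),
      minus_sectors = (\<Union>(p, a, b) \<in> set ss.
         sector (pt p) (pt a) (pt b) \<union> sector (pt p) (- pt a) (- pt b))\<rparr>"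

definition switch_crossings :: "diagram \<Rightarrow> diagram" where
  "switch_crossings L = L\<lparr>over := (graph L - over L) \<union> classical L\<rparr>"

definition exchange_smoothings :: "diagram \<Rightarrow> diagram" where
  "exchange_smoothings L = L\<lparr>minus_sectors := disk - (graph L \<union> minus_sectors L)\<rparr>"

inductive yoshikawa :: "diagram \<Rightarrow> diagram \<Rightarrow> bool" where
  Gamma1: "yoshikawa
     (tangle [[(-4,-2), (-2,-2), (2,2), (2,-2), (-2,2), (-4,2)]] [((0,0), (1,1))] [])
     (tangle [[(-4,-2), (-2,-2), (-2,2), (-4,2)]] [] [])"
| Gamma2: "yoshikawa
     (tangle [[(-4,-2), (-3,-2), (0,1), (3,-2), (4,-2)],
              [(-4,2), (-3,2), (0,-1), (3,2), (4,2)]]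
        [((-1,0), (1/2,1/2)), ((1,0), (1/2,-1/2))] [])
     (tangle [[(-4,-2), (4,-2)], [(-4,2), (4,2)]] [] [])"
| Gamma3: "yoshikawa
     (tangle [[(-4,-3), (-3,-3), (3,3), (4,3)], [(-4,3), (-3,3), (3,-3), (4,-3)],
              [(-4,0), (-3,1), (3,1), (4,0)]]
        [((0,0), (1/2,1/2)), ((-1,1), (1/2,0)), ((1,1), (1/2,0))] [])
     (tangle [[(-4,-3), (-3,-3), (3,3), (4,3)], [(-4,3), (-3,3), (3,-3), (4,-3)],
              [(-4,0), (-3,-1), (3,-1), (4,0)]]
        [((0,0), (1/2,1/2)), ((-1,-1), (1/2,0)), ((1,-1), (1/2,0))] [])"
| Gamma4: "yoshikawa
     (tangle [[(-4,-3), (-3,-3), (3,3), (4,3)], [(-4,3), (-3,3), (3,-3), (4,-3)],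
              [(-4,0), (-3,1), (3,1), (4,0)]]
        [((-1,1), (1/2,0)), ((1,1), (1/2,0))] [((0,0), (1/2,1/2), (-1/2,1/2))])
     (tangle [[(-4,-3), (-3,-3), (3,3), (4,3)], [(-4,3), (-3,3), (3,-3), (4,-3)],
              [(-4,0), (-3,-1), (3,-1), (4,0)]]
        [((-1,-1), (1/2,0)), ((1,-1), (1/2,0))] [((0,0), (1/2,1/2), (-1/2,1/2))])"
| Gamma5: "yoshikawa
     (tangle [[(-4,2), (-2,0), (0,-2), (4,2)], [(-4,-2), (-2,0), (0,2), (4,-2)]]
        [((2,0), (1/2,1/2))] [((-2,0), (1/2,1/2), (-1/2,1/2))])
     (tangle [[(-4,2), (0,-2), (2,0), (4,2)], [(-4,-2), (0,2), (2,0), (4,-2)]]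
        [((-2,0), (1/2,1/2))] [((2,0), (1/2,1/2), (-1/2,1/2))])"
| Gamma6: "yoshikawa
     (tangle [[(-4,-2), (-2,-2), (2,2), (2,-2), (-2,2), (-4,2)]] []
        [((0,0), (1/2,1/2), (-1/2,1/2))])
     (tangle [[(-4,-2), (-2,-2), (-2,2), (-4,2)]] [] [])"
  \<comment> \<open>The boundary points 1 to 6 are, in this order,
      \<open>(-2,4)\<close>, \<open>(-4,0)\<close>, \<open>(-2,-4)\<close>, \<open>(2,-4)\<close>, \<open>(4,0)\<close>, \<open>(2,4)\<close>.\<close>
| Gamma7: "yoshikawa
     (tangle [[(-2,4), (-2,-4)], [(2,-4), (2,4)], [(-4,0), (4,0)]] []
        [((-2,0), (0,1), (-1,0)), ((2,0), (1,0), (0,1))])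
     (tangle [[(-4,0), (2,-4)], [(4,0), (-2,4)], [(-2,-4), (2,4)]] []
        [((-1,-2), (-1/4,-1/2), (3/4,-1/2)), ((1,2), (3/4,-1/2), (1/4,1/2))])"
  \<comment> \<open>Here \<open>v\<^sub>1 = (0,0)\<close> and \<open>v\<^sub>2 = (-3,0)\<close>; the last two strands contain the parallel ones.\<close>
| Gamma8: "yoshikawa
     (tangle [[(-3,4), (-3,3), (3,-3), (3,-4)], [(3,4), (3,3), (-3,-3), (-3,-4)],
              [(-4,-1), (-3,0), (-5/2,1/2), (-5/2,2), (3,2), (4,1)],
              [(-4,1), (-3,0), (-5/2,-1/2), (-2,-1/2), (-2,1), (2,1), (2,-1), (4,-1)]]
        [((-2,2), (1/4,0)), ((-1,1), (1/4,0)), ((1,1), (1/4,1/4)), ((2,2), (1/4,1/4))]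
        [((0,0), (1/4,1/4), (-1/4,1/4)), ((-3,0), (1/4,1/4), (1/4,-1/4))])
     (tangle [[(-3,4), (-3,3), (3,-3), (3,-4)], [(3,4), (3,3), (-3,-3), (-3,-4)],
              [(-4,-1), (-3,0), (-5/2,1/2), (-2,1/2), (-2,-1), (2,-1), (2,1), (4,1)],
              [(-4,1), (-3,0), (-5/2,-1/2), (-5/2,-2), (3,-2), (4,-1)]]
        [((-2,-2), (1/4,0)), ((-1,-1), (1/4,0)), ((1,-1), (1/4,-1/4)), ((2,-2), (1/4,-1/4))]
        [((0,0), (1/4,1/4), (-1/4,1/4)), ((-3,0), (1/4,1/4), (1/4,-1/4))])"
| inverse_move: "yoshikawa L R \<Longrightarrow> yoshikawa R L"
| reflect: "yoshikawa L R \<Longrightarrow> yoshikawa (transport cnj L) (transport cnj R)"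
| switch: "yoshikawa L R \<Longrightarrow> yoshikawa (switch_crossings L) (switch_crossings R)"
| exchange: "yoshikawa L R \<Longrightarrow> yoshikawa (exchange_smoothings L) (exchange_smoothings R)"

definition yoshikawa_move :: "diagram \<Rightarrow> diagram \<Rightarrow> bool" where
  "yoshikawa_move D D' \<longleftrightarrow>
     yoshikawa (restrict_to disk D) (restrict_to disk D') \<and>
     restrict_to (- open_disk) D = restrict_to (- open_disk) D'"


section \<open>Virtual knotted surfaces\<close>

definition elementary_move :: "diagram \<Rightarrow> diagram \<Rightarrow> bool" where
  "elementary_move D D' \<longleftrightarrow> vmv_diagram D \<and> vmv_diagram D' \<and>
     (planar_isotopic D D' \<or> yoshikawa_move D D' \<or> detour_move D D')"

text \<open>Two diagrams represent the same virtual knotted surface iff they are related by a finite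
  sequence of these moves.\<close>

definition same_virtual_knotted_surface :: "diagram \<Rightarrow> diagram \<Rightarrow> bool" where
  "same_virtual_knotted_surface = equivclp elementary_move"

end

theory Submission
  imports Defs
begin

text \<open>
  A labeling assigns labels to semiarcs, which are global objects, whereas every move is local. The
  proof therefore replaces labelings of semiarcs by functions on the points of the diagram off its
  vertices which are locally constant and satisfy the rules at the vertices
  (\<open>card_labelings_eq_point_labelings\<close>). These functions form a sheaf: they can be restricted,
  transported and glued, and whether a rule holds depends on germs only (\<open>rules_at_local\<close>).
  Independence of the chart in which a rule is read off comes from a fact of plane topology: a
  homeomorphism between neighbourhoods of two crosses carries opposite rays to opposite rays
  (\<open>cross_embedding_opposite\<close>).

  For each elementary move the labelings of the two diagrams correspond uniquely.

  \<^item> A planar isotopy transports labelings.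

  \<^item> For a Yoshikawa move, a labeling of the first diagram is kept outside the disk, and what has to be
    shown is that every labeling of the first local picture determines exactly one labeling of
    the second picture with the same boundary values (\<open>labeling_preserving\<close>). This property passes to the
    inverse, reflected, switched and exchanged moves; for switching the reason is that the
    bikei axioms are symmetric in the two operations. For the eight basic moves each picture is cut
    into edges. Point labelings of the picture are then colorings of the finitely many edges by elements
    of the bikei, subject to one condition per vertex, and the correspondence
    becomes algebra: involutivity for the second Reidemeister move, the exchange laws for the third one,
    and for the eighth move the observation that two equally labeled parallel strands
    leave the label of an edge that they cross unchanged (\<open>parallel_over\<close>, \<open>parallel_under\<close>).

  \<^item> In a detour move the moved strand carries a single label, since it passes straight through virtual
    crossings (\<open>strand_label\<close>). The rest of the diagram does not see the strand: where the strand
    crosses it, the labels of the rest on both sides agree (\<open>rest_label\<close>). So the labels of the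
    rest and of the strand can be transferred to the other diagram (\<open>related_exists\<close>).
\<close>

section \<open>Locally constant functions and charts\<close>

definition locally_const_on :: "complex set \<Rightarrow> (complex \<Rightarrow> 'a) \<Rightarrow> bool" where
  "locally_const_on S g \<longleftrightarrow> (\<forall>p \<in> S. \<exists>U. open U \<and> p \<in> U \<and> (\<forall>q \<in> S \<inter> U. g q = g p))"

lemma locally_const_on_connected:
  assumes "locally_const_on S g" "connected C" "C \<subseteq> S" "p \<in> C" "q \<in> C"
  shows "g p = g q"
proof (rule connected_local_const[OF assms(2,4,5)], intro ballI)
  fix a assume "a \<in> C"
  with assms(1,3) obtain U where "open U" "a \<in> U" "\<forall>q \<in> S \<inter> U. g q = g a"
    unfolding locally_const_on_def by blast
  then show "\<forall>\<^sub>F b in at a within C. g a = g b"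
    using assms(3) unfolding eventually_at_topological by (metis IntI subset_eq)
qed

lemma locally_const_onI:
  assumes "\<And>p. p \<in> S \<Longrightarrow> \<exists>U. open U \<and> p \<in> U \<and> (\<forall>q \<in> S \<inter> U. g q = g p)"
  shows "locally_const_on S g"
  using assms by (simp add: locally_const_on_def)

lemma locally_const_onE:
  assumes "locally_const_on S g" "p \<in> S"
  obtains U where "open U" "p \<in> U" "\<And>q. q \<in> S \<Longrightarrow> q \<in> U \<Longrightarrow> g q = g p"
proof -
  obtain U where "open U \<and> p \<in> U \<and> (\<forall>q \<in> S \<inter> U. g q = g p)"
    using bspec[OF assms(1)[unfolded locally_const_on_def] assms(2)] by blast
  then show thesis by (intro that[of U]) auto
qed

lemma locally_const_on_cong:
  assumes g: "locally_const_on S g" and eq: "\<And>p. p \<in> T \<Longrightarrow> g' p = g p" and "T \<subseteq> S"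
  shows "locally_const_on T g'"
proof (rule locally_const_onI)
  fix p assume "p \<in> T"
  then obtain U where "open U" "p \<in> U" "\<And>q. q \<in> S \<Longrightarrow> q \<in> U \<Longrightarrow> g q = g p"
    using locally_const_onE[OF g] \<open>T \<subseteq> S\<close> by (metis subsetD)
  then show "\<exists>U. open U \<and> p \<in> U \<and> (\<forall>q \<in> T \<inter> U. g' q = g' p)"
    using eq \<open>p \<in> T\<close> \<open>T \<subseteq> S\<close> by (intro exI[of _ U]) auto
qed

definition axes :: "complex set" where
  "axes = {z. Re z = 0 \<or> Im z = 0}"

definition units :: "complex set" where
  "units = {1, \<i>, -1, -\<i>}"

lemma units_simps: "1 \<in> units" "\<i> \<in> units" "-1 \<in> units" "-\<i> \<in> units"
  by (auto simp: units_def)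

lemma units_uminus: "u \<in> units \<Longrightarrow> -u \<in> units"
  by (auto simp: units_def)

lemma units_norm: "u \<in> units \<Longrightarrow> norm u = 1"
  by (auto simp: units_def)

lemma units_mult_ii: "u \<in> units \<Longrightarrow> \<i> * u \<in> units"
  by (auto simp: units_def)

lemma units_axes: "u \<in> units \<Longrightarrow> s *\<^sub>R u \<in> axes"
  by (auto simp: units_def axes_def)

lemma axes_scaleR: "r \<noteq> 0 \<Longrightarrow> r *\<^sub>R z \<in> axes \<longleftrightarrow> z \<in> axes"
  by (auto simp: axes_def)

lemma axes_ii: "\<i> * z \<in> axes \<longleftrightarrow> z \<in> axes"
  by (auto simp: axes_def)

lemma sgn_axes: "z \<in> axes \<Longrightarrow> z \<noteq> 0 \<Longrightarrow> sgn z \<in> units"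
  unfolding axes_def units_def by (cases z) (auto simp: sgn_eq complex_eq_iff cmod_def divide_simps)

lemma units_ray_eq:
  assumes "u \<in> units" "w \<in> units" "s *\<^sub>R u = t *\<^sub>R w" "0 < s" "0 < t"
  shows "u = w" "s = t"
  using assms by (auto simp: units_def complex_eq_iff)

text \<open>The segment from a point of a ray to a point of the next ray misses the cross in between. If the
  two rays were carried to opposite ones, the image of this segment would pass from one side of a
  line through the origin to the other and hence meet an axis. So adjacent rays go to rays
  which are not opposite; as different rays have different images, adjacent rays go to adjacent ones, and
  opposite rays to opposite ones.\<close>

lemma cross_embedding_opposite:
  fixes \<kappa> :: "complex \<Rightarrow> complex"
  assumes cont: "continuous_on (cball 0 1) \<kappa>" and inj: "inj_on \<kappa> (cball 0 1)" and zero: "\<kappa> 0 = 0"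
    and ax: "\<And>z. z \<in> cball 0 1 \<Longrightarrow> \<kappa> z \<in> axes \<longleftrightarrow> z \<in> axes"
  shows "\<exists>\<sigma>. \<forall>u \<in> units. \<sigma> u \<in> units \<and> \<sigma> (-u) = - \<sigma> u \<and>
    (\<forall>s. 0 < s \<longrightarrow> s \<le> 1 \<longrightarrow> \<kappa> (s *\<^sub>R u) = norm (\<kappa> (s *\<^sub>R u)) *\<^sub>R \<sigma> u)"
proof -
  define \<sigma> where "\<sigma> u = sgn (\<kappa> u)" for u
  have nz: "\<kappa> z \<noteq> 0" if "z \<in> cball 0 1" "z \<noteq> 0" for z
    using inj_onD[OF inj, of z 0] that zero by auto
  have mem: "s *\<^sub>R u \<in> cball 0 1" "s *\<^sub>R u \<noteq> 0" if "u \<in> units" "0 < s" "s \<le> 1" for u s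
    using that units_norm[of u] by (auto simp: units_def)
  have sg: "sgn (\<kappa> (s *\<^sub>R u)) \<in> units" if "u \<in> units" "0 < s" "s \<le> 1" for u s
    using ax[OF mem(1)[OF that]] nz[OF mem[OF that]] units_axes[OF that(1)] sgn_axes by blast
  have const: "sgn (\<kappa> (s *\<^sub>R u)) = \<sigma> u" if u: "u \<in> units" and s: "0 < s" "s \<le> 1" for u s
  proof -
    have "continuous_on {0<..1::real} (\<lambda>s. \<kappa> (s *\<^sub>R u))"
      by (intro continuous_on_compose2[OF cont] continuous_intros) (use mem u in auto)
    then have c: "continuous_on {0<..1::real} (\<lambda>s. sgn (\<kappa> (s *\<^sub>R u)))"
      by (intro continuous_on_sgn) (use mem nz u in auto)
    have "(\<lambda>s. sgn (\<kappa> (s *\<^sub>R u))) ` {0<..1::real} \<subseteq> units"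
      using sg[OF u] by auto
    then have "finite ((\<lambda>s. sgn (\<kappa> (s *\<^sub>R u))) ` {0<..1::real})"
      by (rule finite_subset) (simp add: units_def)
    then have "(\<lambda>s. sgn (\<kappa> (s *\<^sub>R u))) constant_on {0<..1::real}"
      by (intro continuous_finite_range_constant c) auto
    then have "sgn (\<kappa> (s *\<^sub>R u)) = sgn (\<kappa> (1 *\<^sub>R u))"
      unfolding constant_on_def using s by (metis greaterThanAtMost_iff order_refl zero_less_one)
    then show ?thesis by (simp add: \<sigma>_def)
  qed
  have ray: "\<kappa> (s *\<^sub>R u) = norm (\<kappa> (s *\<^sub>R u)) *\<^sub>R \<sigma> u" if "u \<in> units" "0 < s" "s \<le> 1" for u s
    using const[OF that] nz[OF mem[OF that]] by (metis norm_sgn sgn_div_norm scaleR_scaleR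
        mult.commute norm_eq_zero right_inverse scaleR_one)
  have su: "\<sigma> u \<in> units" if "u \<in> units" for u
    using sg[of u 1] that by (simp add: \<sigma>_def)
  have adj: "\<sigma> (\<i> * u) \<noteq> - \<sigma> u" if u: "u \<in> units" for u
  proof
    assume opp: "\<sigma> (\<i> * u) = - \<sigma> u"
    \<comment> \<open>The component of the image along the direction of the image of \<open>u\<close> would change its sign.\<close>
    define f where "f t = \<kappa> ((1 - t) *\<^sub>R u + t *\<^sub>R (\<i> * u)) \<bullet> \<sigma> u" for t :: real
    have inb: "(1 - t) *\<^sub>R u + t *\<^sub>R (\<i> * u) \<in> cball 0 1" if "0 \<le> t" "t \<le> 1" for t
    proof -
      have "norm ((1 - t) *\<^sub>R u + t *\<^sub>R (\<i> * u)) \<le> (1 - t) * norm u + t * norm (\<i> * u)"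
        using that by (metis abs_of_nonneg diff_ge_0_iff_ge norm_scaleR norm_triangle_ineq)
      then show ?thesis using units_norm[OF u] by (simp add: norm_mult)
    qed
    have "continuous_on {0..1} f" unfolding f_def
      by (intro continuous_intros continuous_on_compose2[OF cont]) (use inb in auto)
    moreover have "f 0 > 0"
    proof -
      have "f 0 = norm (\<kappa> u) * (\<sigma> u \<bullet> \<sigma> u)"
        unfolding f_def using ray[OF u, of 1] by (simp, metis inner_scaleR_left)
      moreover have "\<kappa> u \<noteq> 0" using nz[OF mem[OF u, of 1]] by simp
      ultimately show ?thesis using units_norm[OF su[OF u]] by (simp add: dot_square_norm)
    qed
    moreover have "f 1 < 0"
    proof -
      have "f 1 = - (norm (\<kappa> (\<i> * u)) * (\<sigma> u \<bullet> \<sigma> u))"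
        unfolding f_def using ray[OF units_mult_ii[OF u], of 1] opp
        by (simp, metis inner_minus_left inner_scaleR_left scaleR_minus_right)
      moreover have "\<kappa> (\<i> * u) \<noteq> 0" using nz[OF mem[OF units_mult_ii[OF u], of 1]] by simp
      ultimately show ?thesis using units_norm[OF su[OF u]] by (simp add: dot_square_norm)
    qed
    ultimately obtain t where t: "0 \<le> t" "t \<le> 1" "f t = 0"
      using IVT2'[of f 1 0 0] by force
    then have "t \<noteq> 0" "t \<noteq> 1" using \<open>f 0 > 0\<close> \<open>f 1 < 0\<close> by auto
    then have "(1 - t) *\<^sub>R u + t *\<^sub>R (\<i> * u) \<notin> axes"
      using u by (auto simp: units_def axes_def)
    then have "\<kappa> ((1 - t) *\<^sub>R u + t *\<^sub>R (\<i> * u)) \<notin> axes"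
      using ax inb t by blast
    then show False
      using t(3) su[OF u] by (auto simp: f_def axes_def units_def inner_complex_def)
  qed
  have inj\<sigma>: "u = w" if u: "u \<in> units" and w: "w \<in> units" and eq: "\<sigma> u = \<sigma> w"
    and le: "norm (\<kappa> u) \<le> norm (\<kappa> w)" for u w
  proof -
    have "continuous_on {0..1::real} (\<lambda>s. norm (\<kappa> (s *\<^sub>R w)))"
      by (intro continuous_intros continuous_on_compose2[OF cont]) (use units_norm[OF w] in auto)
    then obtain t where t: "0 \<le> t" "t \<le> 1" "norm (\<kappa> (t *\<^sub>R w)) = norm (\<kappa> u)"
      using IVT'[of "\<lambda>s. norm (\<kappa> (s *\<^sub>R w))" 0 "norm (\<kappa> u)" 1] le zero by auto
    have "\<kappa> u \<noteq> 0" using nz[OF mem[OF u, of 1]] by simp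
    then have "t \<noteq> 0" using t zero by auto
    then have "\<kappa> (t *\<^sub>R w) = \<kappa> (1 *\<^sub>R u)"
      using ray[OF w, of t] ray[OF u, of 1] t eq by simp
    then have "t *\<^sub>R w = 1 *\<^sub>R u"
      using inj_onD[OF inj] mem[OF w, of t] mem[OF u, of 1] t \<open>t \<noteq> 0\<close> by auto
    then show ?thesis using units_ray_eq[OF w u, of t 1] t \<open>t \<noteq> 0\<close> by auto
  qed
  have inj\<sigma>': "u = w" if "u \<in> units" "w \<in> units" "\<sigma> u = \<sigma> w" for u w
    using inj\<sigma>[of u w] inj\<sigma>[of w u] that by force
  have opp: "\<sigma> (-u) = - \<sigma> u" if u: "u \<in> units" for u
  proof -
    have iu: "\<i> * u \<in> units" "-u \<in> units" "\<i> * (\<i> * u) = -u"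
      using u units_mult_ii units_uminus by auto
    have "\<sigma> (\<i> * u) \<noteq> \<sigma> u" "\<sigma> (-u) \<noteq> \<sigma> (\<i> * u)" "\<sigma> (-u) \<noteq> \<sigma> u"
      using inj\<sigma>'[OF iu(1) u] inj\<sigma>'[OF iu(2,1)] inj\<sigma>'[OF iu(2) u] u by (auto simp: units_def complex_eq_iff)
    moreover have "\<sigma> (\<i> * u) \<noteq> - \<sigma> u" "\<sigma> (-u) \<noteq> - \<sigma> (\<i> * u)"
      using adj[OF u] adj[OF iu(1)] iu(3) by auto
    ultimately show ?thesis
      using su[OF u] su[OF iu(1)] su[OF iu(2)] unfolding units_def by auto
  qed
  show ?thesis
    by (intro exI[of _ \<sigma>] ballI conjI allI impI) (simp_all add: su opp ray[symmetric])
qed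

lemma crossing_chartD:
  assumes "crossing_chart D \<phi>"
  shows "continuous_on (cball 0 1) \<phi>" "inj_on \<phi> (cball 0 1)"
    "\<And>z. z \<in> cball 0 1 \<Longrightarrow> \<phi> z \<in> graph D \<longleftrightarrow> z \<in> axes"
    "\<And>z. z \<in> cball 0 1 \<Longrightarrow> \<phi> z \<in> vertices D \<longleftrightarrow> z = 0"
proof -
  show c: "continuous_on (cball 0 1) \<phi>" and i: "inj_on \<phi> (cball 0 1)"
    using assms by (auto simp: crossing_chart_def)
  have g: "graph D \<inter> \<phi> ` cball 0 1 = \<phi> ` {z \<in> cball 0 1. Re z = 0 \<or> Im z = 0}"
    and v: "vertices D \<inter> \<phi> ` cball 0 1 = {\<phi> 0}"
    using assms by (auto simp: crossing_chart_def)
  fix z :: complex assume z: "z \<in> cball 0 1"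
  show "\<phi> z \<in> graph D \<longleftrightarrow> z \<in> axes"
  proof
    assume "\<phi> z \<in> graph D"
    then have "\<phi> z \<in> \<phi> ` {z \<in> cball 0 1. Re z = 0 \<or> Im z = 0}" using g z by blast
    then show "z \<in> axes" using inj_onD[OF i] z by (auto simp: axes_def)
  qed (use g z in \<open>auto simp: axes_def\<close>)
  show "\<phi> z \<in> vertices D \<longleftrightarrow> z = 0"
  proof
    assume "\<phi> z \<in> vertices D"
    then have "\<phi> z = \<phi> 0" using v z by blast
    then show "z = 0" using inj_onD[OF i] z by auto
  next
    assume "z = 0" then show "\<phi> z \<in> vertices D" using v by blast
  qed
qed

lemma crossing_chartI:
  assumes "continuous_on (cball 0 1) \<phi>" "inj_on \<phi> (cball 0 1)"
    "\<And>z. z \<in> cball 0 1 \<Longrightarrow> \<phi> z \<in> graph D \<longleftrightarrow> z \<in> axes"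
    "\<And>z. z \<in> cball 0 1 \<Longrightarrow> \<phi> z \<in> vertices D \<longleftrightarrow> z = 0"
  shows "crossing_chart D \<phi>"
proof -
  have "graph D \<inter> \<phi> ` cball 0 1 = \<phi> ` {z \<in> cball 0 1. Re z = 0 \<or> Im z = 0}"
    using assms(3) unfolding axes_def by blast
  moreover have "vertices D \<inter> \<phi> ` cball 0 1 = {\<phi> 0}"
  proof
    show "vertices D \<inter> \<phi> ` cball 0 1 \<subseteq> {\<phi> 0}" using assms(4) by blast
    have "0 \<in> cball (0::complex) 1" by simp
    then show "{\<phi> 0} \<subseteq> vertices D \<inter> \<phi> ` cball 0 1" using assms(4) by blast
  qed
  ultimately show ?thesis using assms(1,2) by (simp add: crossing_chart_def)
qed

lemma classical_chart_iff:
  "classical_chart D \<phi> \<longleftrightarrow> crossing_chart D \<phi> \<and> \<phi> 0 \<in> classical D \<and>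
     (\<forall>z \<in> cball 0 1. \<phi> z \<in> over D \<longleftrightarrow> Im z = 0)"
proof (cases "crossing_chart D \<phi>")
  case True
  note i = crossing_chartD(2)[OF True]
  have "over D \<inter> \<phi> ` cball 0 1 = \<phi> ` {z \<in> cball 0 1. Im z = 0} \<longleftrightarrow>
    (\<forall>z \<in> cball 0 1. \<phi> z \<in> over D \<longleftrightarrow> Im z = 0)" (is "?l \<longleftrightarrow> ?r")
  proof
    assume ?l
    show ?r
    proof
      fix z :: complex assume z: "z \<in> cball 0 1"
      then have "\<phi> z \<in> over D \<longleftrightarrow> \<phi> z \<in> \<phi> ` {z \<in> cball 0 1. Im z = 0}" using \<open>?l\<close> by blast
      also have "\<dots> \<longleftrightarrow> Im z = 0" using inj_onD[OF i] z by blast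
      finally show "\<phi> z \<in> over D \<longleftrightarrow> Im z = 0" .
    qed
  qed blast
  then show ?thesis by (simp add: classical_chart_def)
qed (simp add: classical_chart_def)

lemma crossing_chart_points:
  assumes "crossing_chart D \<phi>" "u \<in> units" "0 < s" "s \<le> 1"
  shows "\<phi> (s *\<^sub>R u) \<in> graph D - vertices D" "\<phi> u \<in> graph D - vertices D"
proof -
  have n: "norm u = 1" using assms units_norm by blast
  then have "u \<noteq> 0" by auto
  then show "\<phi> (s *\<^sub>R u) \<in> graph D - vertices D"
    using crossing_chartD(3,4)[OF assms(1), of "s *\<^sub>R u"] units_axes[OF assms(2)] assms n by auto
  show "\<phi> u \<in> graph D - vertices D"
    using crossing_chartD(3,4)[OF assms(1), of "u"] units_axes[OF assms(2), of 1] assms n \<open>u \<noteq> 0\<close>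
    by auto
qed

lemma crossing_chart_ray:
  assumes "crossing_chart D \<phi>" "locally_const_on (graph D - vertices D) g" "u \<in> units" "0 < s" "s \<le> 1"
  shows "g (\<phi> (s *\<^sub>R u)) = g (\<phi> u)"
proof (rule locally_const_on_connected[OF assms(2)])
  show "connected ((\<lambda>s. \<phi> (s *\<^sub>R u)) ` {0<..1::real})"
  proof (rule connected_continuous_image)
    show "continuous_on {0<..1::real} (\<lambda>s. \<phi> (s *\<^sub>R u))"
      by (intro continuous_on_compose2[OF crossing_chartD(1)[OF assms(1)]] continuous_intros)
        (use units_norm[OF assms(3)] in auto)
  qed simp
  show "(\<lambda>s. \<phi> (s *\<^sub>R u)) ` {0<..1::real} \<subseteq> graph D - vertices D"
    using crossing_chart_points[OF assms(1,3)] by auto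
  show "\<phi> (s *\<^sub>R u) \<in> (\<lambda>s. \<phi> (s *\<^sub>R u)) ` {0<..1::real}" using assms by auto
  show "\<phi> u \<in> (\<lambda>s. \<phi> (s *\<^sub>R u)) ` {0<..1::real}"
    by (rule image_eqI[of _ _ 1]) auto
qed

text \<open>All conditions on charts are stable under shrinking, which makes them conditions on germs.\<close>

lemma chart_small:
  fixes \<phi> :: "complex \<Rightarrow> complex"
  assumes "continuous_on (cball 0 1) \<phi>" "open U" "\<phi> 0 \<in> U"
  obtains r where "0 < r" "r \<le> 1" "\<And>z. norm z \<le> r \<Longrightarrow> \<phi> z \<in> U"
proof -
  obtain A where A: "open A" "A \<inter> cball 0 1 = \<phi> -` U \<inter> cball 0 1"
    using assms(1,2) continuous_on_open_invariant by metis
  have "0 \<in> A" using A(2) assms(3) by auto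
  then obtain e where e: "0 < e" "cball 0 e \<subseteq> A" using A(1) open_contains_cball by blast
  show thesis
  proof (rule that[of "min e 1"])
    fix z :: complex assume "norm z \<le> min e 1"
    then have "z \<in> A \<inter> cball 0 1" using e(2) by auto
    then show "\<phi> z \<in> U" using A(2) by auto
  qed (use e in auto)
qed

lemma scaleR_in_cball: "0 < r \<Longrightarrow> r \<le> 1 \<Longrightarrow> z \<in> cball 0 1 \<Longrightarrow> r *\<^sub>R z \<in> cball (0::complex) 1"
  using mult_mono[of r 1 "norm z" 1] by simp

lemma crossing_chart_shrink:
  assumes "crossing_chart D \<phi>" "0 < r" "r \<le> 1"
  shows "crossing_chart D (\<lambda>z. \<phi> (r *\<^sub>R z))"
proof (rule crossing_chartI)
  note c = crossing_chartD[OF assms(1)]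
  note m = scaleR_in_cball[OF assms(2,3)]
  show "continuous_on (cball 0 1) (\<lambda>z. \<phi> (r *\<^sub>R z))"
    by (intro continuous_on_compose2[OF c(1)] continuous_intros) (use m in blast)
  show "inj_on (\<lambda>z. \<phi> (r *\<^sub>R z)) (cball 0 1)"
  proof (rule inj_onI)
    fix x y :: complex assume *: "x \<in> cball 0 1" "y \<in> cball 0 1" "\<phi> (r *\<^sub>R x) = \<phi> (r *\<^sub>R y)"
    have "r *\<^sub>R x = r *\<^sub>R y" by (rule inj_onD[OF c(2) *(3) m[OF *(1)] m[OF *(2)]])
    then show "x = y" using assms(2) by simp
  qed
  show "\<phi> (r *\<^sub>R z) \<in> graph D \<longleftrightarrow> z \<in> axes" if "z \<in> cball 0 1" for z
    using c(3)[OF m[OF that]] axes_scaleR[of r z] assms(2) by simp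
  show "\<phi> (r *\<^sub>R z) \<in> vertices D \<longleftrightarrow> z = 0" if "z \<in> cball 0 1" for z
    using c(4)[OF m[OF that]] assms(2) by simp
qed

lemma classical_chart_shrink:
  assumes "classical_chart D \<phi>" "0 < r" "r \<le> 1"
  shows "classical_chart D (\<lambda>z. \<phi> (r *\<^sub>R z))"
proof -
  have "\<phi> (r *\<^sub>R z) \<in> over D \<longleftrightarrow> Im z = 0" if "z \<in> cball 0 1" for z
    using assms(1) scaleR_in_cball[OF assms(2,3) that] assms(2) unfolding classical_chart_iff by auto
  moreover have "crossing_chart D (\<lambda>z. \<phi> (r *\<^sub>R z))"
    using assms crossing_chart_shrink[of D \<phi> r] unfolding classical_chart_iff by blast
  ultimately show ?thesis using assms(1) unfolding classical_chart_iff by simp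
qed

lemma virtual_chart_shrink:
  assumes "virtual_chart D \<phi>" "0 < r" "r \<le> 1"
  shows "virtual_chart D (\<lambda>z. \<phi> (r *\<^sub>R z))"
  using assms crossing_chart_shrink[of D \<phi> r] unfolding virtual_chart_def by auto

lemma crossing_chart_rotate:
  assumes "crossing_chart D \<phi>"
  shows "crossing_chart D (\<lambda>z. \<phi> (\<i> * z))"
proof (rule crossing_chartI)
  note c = crossing_chartD[OF assms(1)]
  show "continuous_on (cball 0 1) (\<lambda>z. \<phi> (\<i> * z))"
    by (intro continuous_on_compose2[OF c(1)] continuous_intros) (auto simp: norm_mult)
  show "inj_on (\<lambda>z. \<phi> (\<i> * z)) (cball 0 1)"
  proof (rule inj_onI)
    fix x y :: complex assume *: "x \<in> cball 0 1" "y \<in> cball 0 1" "\<phi> (\<i> * x) = \<phi> (\<i> * y)"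
    have "\<i> * x = \<i> * y" by (rule inj_onD[OF c(2) *(3)]) (use * in \<open>auto simp: norm_mult\<close>)
    then show "x = y" by simp
  qed
  show "\<phi> (\<i> * z) \<in> graph D \<longleftrightarrow> z \<in> axes" if "z \<in> cball 0 1" for z
    using c(3)[of "\<i> * z"] that axes_ii by (auto simp: norm_mult)
  show "\<phi> (\<i> * z) \<in> vertices D \<longleftrightarrow> z = 0" if "z \<in> cball 0 1" for z
    using c(4)[of "\<i> * z"] that by (auto simp: norm_mult)
qed

lemma virtual_chart_rotate:
  "virtual_chart D \<phi> \<Longrightarrow> virtual_chart D (\<lambda>z. \<phi> (\<i> * z))"
  using crossing_chart_rotate unfolding virtual_chart_def by auto

lemma inv_into_embedding:
  fixes \<phi> :: "complex \<Rightarrow> complex"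
  assumes "continuous_on (cball 0 1) \<phi>" "inj_on \<phi> (cball 0 1)"
  shows "continuous_on (\<phi> ` cball 0 1) (inv_into (cball 0 1) \<phi>)"
  using assms by (intro continuous_on_inv) auto

lemma open_embedding_ball:
  fixes \<phi> :: "complex \<Rightarrow> complex"
  assumes "continuous_on (cball 0 1) \<phi>" "inj_on \<phi> (cball 0 1)" "r \<le> 1"
  shows "open (\<phi> ` ball 0 r)"
proof (rule invariance_of_domain)
  have "ball 0 r \<subseteq> cball (0::complex) 1" using assms(3) by auto
  then show "continuous_on (ball 0 r) \<phi>" "inj_on \<phi> (ball 0 r)"
    using assms continuous_on_subset inj_on_subset by blast+
qed simp

text \<open>The charts are compared by \<open>inv \<phi> \<circ> \<psi>\<close>, which is defined near \<open>0\<close> because the image of the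
  open disk under \<open>\<phi>\<close> is open by invariance of domain.\<close>

lemma crossing_charts_germ:
  assumes \<phi>: "crossing_chart D \<phi>" and \<psi>: "crossing_chart D \<psi>" and eq: "\<psi> 0 = \<phi> 0"
  shows "\<exists>\<sigma> r. 0 < r \<and> r \<le> 1 \<and> (\<forall>u \<in> units. \<sigma> u \<in> units \<and> \<sigma> (-u) = - \<sigma> u \<and>
    (\<forall>s. 0 < s \<longrightarrow> s \<le> r \<longrightarrow> (\<exists>t. 0 < t \<and> t \<le> 1 \<and> \<psi> (s *\<^sub>R u) = \<phi> (t *\<^sub>R \<sigma> u))))"
proof -
  note c = crossing_chartD[OF \<phi>] note d = crossing_chartD[OF \<psi>]
  have o: "open (\<phi> ` ball 0 1)" using open_embedding_ball[OF c(1,2)] by simp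
  have "\<psi> 0 \<in> \<phi> ` ball 0 1" unfolding eq by (rule imageI) simp
  then obtain r where r: "0 < r" "r \<le> 1" and rU: "\<And>z. norm z \<le> r \<Longrightarrow> \<psi> z \<in> \<phi> ` ball 0 1"
    using chart_small[OF d(1) o] by blast
  define \<kappa> where "\<kappa> z = inv_into (cball 0 1) \<phi> (\<psi> (r *\<^sub>R z))" for z
  have rz: "norm (r *\<^sub>R z) \<le> r" if "z \<in> cball 0 1" for z :: complex
    using that r by (auto intro: mult_left_le)
  have sub: "ball 0 1 \<subseteq> cball (0::complex) 1" by auto
  have \<psi>in: "\<psi> (r *\<^sub>R z) \<in> \<phi> ` cball 0 1" if "z \<in> cball 0 1" for z
    using rU[OF rz[OF that]] sub by blast
  have \<kappa>: "\<phi> (\<kappa> z) = \<psi> (r *\<^sub>R z)" "\<kappa> z \<in> cball 0 1" if "z \<in> cball 0 1" for z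
    unfolding \<kappa>_def using \<psi>in[OF that] f_inv_into_f inv_into_into by metis+
  have rc: "r *\<^sub>R z \<in> cball 0 1" if "z \<in> cball 0 1" for z :: complex
    using scaleR_in_cball[OF r that] .
  have "continuous_on (cball 0 1) \<kappa>" unfolding \<kappa>_def
    by (intro continuous_on_compose2[OF inv_into_embedding[OF c(1,2)]]
        continuous_on_compose2[OF d(1)] continuous_intros) (use \<psi>in rc in auto)
  moreover have "inj_on \<kappa> (cball 0 1)"
  proof (rule inj_onI)
    fix x y assume *: "x \<in> cball 0 1" "y \<in> cball 0 1" "\<kappa> x = \<kappa> y"
    then have "\<psi> (r *\<^sub>R x) = \<psi> (r *\<^sub>R y)" using \<kappa>(1) by metis
    then show "x = y" using inj_onD[OF d(2)] rc * r(1) by (metis less_irrefl scaleR_cancel_left)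
  qed
  moreover have "\<kappa> 0 = 0"
    unfolding \<kappa>_def using eq inv_into_f_f[OF c(2), of 0] by simp
  moreover have "\<kappa> z \<in> axes \<longleftrightarrow> z \<in> axes" if z: "z \<in> cball 0 1" for z
    using c(3)[OF \<kappa>(2)[OF z]] d(3)[OF rc[OF z]] \<kappa>(1)[OF z] axes_scaleR r(1) by (metis less_irrefl)
  ultimately obtain \<sigma> where \<sigma>: "\<forall>u \<in> units. \<sigma> u \<in> units \<and> \<sigma> (-u) = - \<sigma> u \<and>
    (\<forall>s. 0 < s \<longrightarrow> s \<le> 1 \<longrightarrow> \<kappa> (s *\<^sub>R u) = norm (\<kappa> (s *\<^sub>R u)) *\<^sub>R \<sigma> u)"
    using cross_embedding_opposite[of \<kappa>] by metis
  have "\<exists>t. 0 < t \<and> t \<le> 1 \<and> \<psi> (s *\<^sub>R u) = \<phi> (t *\<^sub>R \<sigma> u)" if u: "u \<in> units" and s: "0 < s" "s \<le> r" for u s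
  proof -
    have z: "(s/r) *\<^sub>R u \<in> cball 0 1" using units_norm[OF u] s r by simp
    have e: "\<psi> (s *\<^sub>R u) = \<phi> (\<kappa> ((s/r) *\<^sub>R u))" using \<kappa>(1)[OF z] r by simp
    have "\<kappa> ((s/r) *\<^sub>R u) = norm (\<kappa> ((s/r) *\<^sub>R u)) *\<^sub>R \<sigma> u" using \<sigma> u s r by (metis divide_le_eq_1_pos divide_pos_pos)
    moreover have "\<kappa> ((s/r) *\<^sub>R u) \<noteq> 0"
    proof
      assume "\<kappa> ((s/r) *\<^sub>R u) = 0"
      then have "\<psi> (s *\<^sub>R u) = \<psi> 0" using e eq by simp
      then have "s *\<^sub>R u = 0" by (rule inj_onD[OF d(2)]) (use units_norm[OF u] s r in auto)
      then show False using units_norm[OF u] s by auto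
    qed
    ultimately show ?thesis using e \<kappa>(2)[OF z] by (intro exI[of _ "norm (\<kappa> ((s/r) *\<^sub>R u))"]) auto
  qed
  then show ?thesis using \<sigma> r by (intro exI[of _ \<sigma>] exI[of _ r]) simp
qed

lemma crossing_charts_values:
  assumes \<phi>: "crossing_chart D \<phi>" and \<psi>: "crossing_chart D \<psi>" and eq: "\<psi> 0 = \<phi> 0"
    and g: "locally_const_on (graph D - vertices D) g"
  shows "\<exists>\<sigma>. \<forall>u \<in> units. \<sigma> u \<in> units \<and> \<sigma> (-u) = - \<sigma> u \<and> g (\<psi> u) = g (\<phi> (\<sigma> u)) \<and>
     (\<exists>s t. 0 < s \<and> s \<le> 1 \<and> 0 < t \<and> t \<le> 1 \<and> \<psi> (s *\<^sub>R u) = \<phi> (t *\<^sub>R \<sigma> u))"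
proof -
  obtain \<sigma> r where \<sigma>: "0 < r" "r \<le> 1" "\<forall>u \<in> units. \<sigma> u \<in> units \<and> \<sigma> (-u) = - \<sigma> u \<and>
    (\<forall>s. 0 < s \<longrightarrow> s \<le> r \<longrightarrow> (\<exists>t. 0 < t \<and> t \<le> 1 \<and> \<psi> (s *\<^sub>R u) = \<phi> (t *\<^sub>R \<sigma> u)))"
    using crossing_charts_germ[OF assms(1-3)] by metis
  show ?thesis
  proof (intro exI[of _ \<sigma>] ballI)
    fix u assume u: "u \<in> units"
    obtain t where t: "0 < t" "t \<le> 1" "\<psi> (r *\<^sub>R u) = \<phi> (t *\<^sub>R \<sigma> u)"
      using \<sigma> u by (meson order_refl)
    have \<sigma>u: "\<sigma> u \<in> units" "\<sigma> (-u) = - \<sigma> u" using \<sigma>(3) u by auto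
    have "g (\<psi> u) = g (\<psi> (r *\<^sub>R u))" using crossing_chart_ray[OF \<psi> g u \<sigma>(1,2)] by simp
    also have "\<dots> = g (\<phi> (\<sigma> u))" using crossing_chart_ray[OF \<phi> g \<sigma>u(1) t(1,2)] t(3) by simp
    finally have "g (\<psi> u) = g (\<phi> (\<sigma> u))" .
    moreover have "\<exists>s t. 0 < s \<and> s \<le> 1 \<and> 0 < t \<and> t \<le> 1 \<and> \<psi> (s *\<^sub>R u) = \<phi> (t *\<^sub>R \<sigma> u)"
      using t \<sigma>(1,2) by blast
    ultimately show "\<sigma> u \<in> units \<and> \<sigma> (-u) = - \<sigma> u \<and> g (\<psi> u) = g (\<phi> (\<sigma> u)) \<and>
     (\<exists>s t. 0 < s \<and> s \<le> 1 \<and> 0 < t \<and> t \<le> 1 \<and> \<psi> (s *\<^sub>R u) = \<phi> (t *\<^sub>R \<sigma> u))"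
      using \<sigma>u by blast
  qed
qed

section \<open>Labelings of points\<close>

text \<open>Here \<open>h u\<close> is the label of the edge leaving the crossing in direction \<open>u\<close>; the over-strand
  runs along the real axis of the chart.\<close>

definition crossing_rule :: "('a \<Rightarrow> 'a \<Rightarrow> 'a) \<Rightarrow> ('a \<Rightarrow> 'a \<Rightarrow> 'a) \<Rightarrow> (complex \<Rightarrow> 'a) \<Rightarrow> bool" where
  "crossing_rule up dn h \<longleftrightarrow> (\<forall>u \<in> {\<i>, -\<i>}. \<forall>w \<in> {1, -1}.
     h (-u) = up (h u) (h w) \<and> h (-w) = dn (h w) (h u))"

text \<open>At a saddle all crossing charts are admitted, also those whose first quadrant is a sector of the
  $+$ smoothing. The rule is symmetric in the four edges, and in this form it visibly does not change when
  the two smoothings are exchanged.\<close>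

definition rules_at where
  "rules_at up dn D g v \<longleftrightarrow> (\<forall>\<phi>. \<phi> 0 = v \<longrightarrow>
     (virtual_chart D \<phi> \<longrightarrow> g (\<phi> 1) = g (\<phi> (-1))) \<and>
     (classical_chart D \<phi> \<longrightarrow> crossing_rule up dn (\<lambda>u. g (\<phi> u))) \<and>
     (crossing_chart D \<phi> \<and> v \<in> saddle D \<longrightarrow> (\<forall>u \<in> units. g (\<phi> u) = g (\<phi> 1))))"

lemma rules_atI:
  assumes "\<And>\<phi>. \<phi> 0 = v \<Longrightarrow> virtual_chart D \<phi> \<Longrightarrow> g (\<phi> 1) = g (\<phi> (-1))"
    and "\<And>\<phi>. \<phi> 0 = v \<Longrightarrow> classical_chart D \<phi> \<Longrightarrow> crossing_rule up dn (\<lambda>u. g (\<phi> u))"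
    and "\<And>\<phi> u. \<phi> 0 = v \<Longrightarrow> crossing_chart D \<phi> \<Longrightarrow> v \<in> saddle D \<Longrightarrow> u \<in> units \<Longrightarrow> g (\<phi> u) = g (\<phi> 1)"
  shows "rules_at up dn D g v"
  unfolding rules_at_def by (intro allI impI conjI ballI; (elim conjE)?; rule assms; assumption)

lemma rules_atD:
  assumes "rules_at up dn D g v" "\<phi> 0 = v"
  shows "virtual_chart D \<phi> \<Longrightarrow> g (\<phi> 1) = g (\<phi> (-1))"
    and "classical_chart D \<phi> \<Longrightarrow> crossing_rule up dn (\<lambda>u. g (\<phi> u))"
    and "crossing_chart D \<phi> \<Longrightarrow> v \<in> saddle D \<Longrightarrow> u \<in> units \<Longrightarrow> g (\<phi> u) = g (\<phi> 1)"
proof -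
  note r = assms(1)[unfolded rules_at_def, THEN spec, of \<phi>, THEN mp, OF assms(2)]
  show "virtual_chart D \<phi> \<Longrightarrow> g (\<phi> 1) = g (\<phi> (-1))" by (rule mp[OF conjunct1[OF r]])
  show "classical_chart D \<phi> \<Longrightarrow> crossing_rule up dn (\<lambda>u. g (\<phi> u))" by (rule mp[OF conjunct1[OF conjunct2[OF r]]])
  show "crossing_chart D \<phi> \<Longrightarrow> v \<in> saddle D \<Longrightarrow> u \<in> units \<Longrightarrow> g (\<phi> u) = g (\<phi> 1)"
    by (rule bspec[OF mp[OF conjunct2[OF conjunct2[OF r]] conjI]])
qed

lemma crossing_rule_cong:
  assumes "crossing_rule up dn h" "\<And>u. u \<in> units \<Longrightarrow> h' u = h u"
  shows "crossing_rule up dn h'"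
  unfolding crossing_rule_def
proof (intro ballI)
  fix u w :: complex assume u: "u \<in> {\<i>, -\<i>}" and w: "w \<in> {1, -1}"
  have m: "u \<in> units" "w \<in> units" "-u \<in> units" "-w \<in> units" using u w by (auto simp: units_def)
  have "h (-u) = up (h u) (h w) \<and> h (-w) = dn (h w) (h u)"
    by (rule bspec[OF bspec[OF assms(1)[unfolded crossing_rule_def] u] w])
  then show "h' (-u) = up (h' u) (h' w) \<and> h' (-w) = dn (h' w) (h' u)"
    by (simp only: assms(2)[OF m(1)] assms(2)[OF m(2)] assms(2)[OF m(3)] assms(2)[OF m(4)])
qed

lemma rules_at_cong:
  assumes r: "rules_at up dn D g v" and eq: "\<And>p. p \<in> graph D - vertices D \<Longrightarrow> g' p = g p"
  shows "rules_at up dn D g' v"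
proof -
  have e: "g' (\<phi> u) = g (\<phi> u)" if "crossing_chart D \<phi>" "u \<in> units" for \<phi> u
    using crossing_chart_points(2)[OF that, of 1] eq by simp
  show ?thesis
  proof (rule rules_atI)
    fix \<phi> :: "complex \<Rightarrow> complex" assume v: "\<phi> 0 = v"
    show "g' (\<phi> 1) = g' (\<phi> (-1))" if "virtual_chart D \<phi>"
      using rules_atD(1)[OF r v that] that e units_simps by (simp add: virtual_chart_def)
    show "crossing_rule up dn (\<lambda>u. g' (\<phi> u))" if c: "classical_chart D \<phi>"
      by (rule crossing_rule_cong[OF rules_atD(2)[OF r v c]]) (use e c in \<open>simp add: classical_chart_iff\<close>)
    show "g' (\<phi> u) = g' (\<phi> 1)" if "crossing_chart D \<phi>" "v \<in> saddle D" "u \<in> units" for u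
      using rules_atD(3)[OF r v that] e that units_simps by simp
  qed
qed

text \<open>Local constancy stands for being constant on each edge. Unlike the decomposition into semiarcs it
  is a local condition, so that these functions can be cut along a circle and glued.\<close>

definition point_labelings where
  "point_labelings X up dn D = {g \<in> (graph D - vertices D) \<rightarrow>\<^sub>E X.
     locally_const_on (graph D - vertices D) g \<and> (\<forall>v \<in> vertices D. rules_at up dn D g v)}"

lemma point_labelingsD:
  assumes "g \<in> point_labelings X up dn D"
  shows "\<And>p. p \<in> graph D \<Longrightarrow> p \<notin> vertices D \<Longrightarrow> g p \<in> X"
    "\<And>p. p \<notin> graph D - vertices D \<Longrightarrow> g p = undefined"
    "locally_const_on (graph D - vertices D) g"
    "\<And>v. v \<in> vertices D \<Longrightarrow> rules_at up dn D g v"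
  using assms unfolding point_labelings_def by (auto simp: PiE_iff extensional_def)

lemma point_labelingsI:
  assumes "\<And>p. p \<in> graph D \<Longrightarrow> p \<notin> vertices D \<Longrightarrow> g p \<in> X"
    "locally_const_on (graph D - vertices D) g"
    "\<And>v. v \<in> vertices D \<Longrightarrow> rules_at up dn D g v"
  shows "restrict g (graph D - vertices D) \<in> point_labelings X up dn D"
proof -
  have "rules_at up dn D (restrict g (graph D - vertices D)) v" if "v \<in> vertices D" for v
    by (rule rules_at_cong[OF assms(3)[OF that]]) simp
  moreover have "locally_const_on (graph D - vertices D) (restrict g (graph D - vertices D))"
    by (rule locally_const_on_cong[OF assms(2)]) auto
  ultimately show ?thesis using assms(1) by (simp add: point_labelings_def)
qed

lemma point_labelings_eqI:
  assumes "g \<in> point_labelings X up dn D" "h \<in> point_labelings X up dn D"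
    "\<And>p. p \<in> graph D - vertices D \<Longrightarrow> g p = h p"
  shows "g = h"
  using assms point_labelingsD(2)[OF assms(1)] point_labelingsD(2)[OF assms(2)] by (metis ext)

definition agree_on :: "complex set \<Rightarrow> diagram \<Rightarrow> diagram \<Rightarrow> bool" where
  "agree_on U D E \<longleftrightarrow> (\<forall>p \<in> U. (p \<in> graph D \<longleftrightarrow> p \<in> graph E) \<and> (p \<in> classical D \<longleftrightarrow> p \<in> classical E) \<and>
     (p \<in> saddle D \<longleftrightarrow> p \<in> saddle E) \<and> (p \<in> virtual D \<longleftrightarrow> p \<in> virtual E)) \<and>
     (\<forall>p \<in> U. p \<in> over D \<longleftrightarrow> p \<in> over E)"

lemma agree_on_vertices: "agree_on U D E \<Longrightarrow> p \<in> U \<Longrightarrow> p \<in> vertices D \<longleftrightarrow> p \<in> vertices E"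
  by (auto simp: agree_on_def vertices_def)

lemma agree_on_sym: "agree_on U D E \<Longrightarrow> agree_on U E D"
  by (simp add: agree_on_def)

lemma crossing_chart_agree:
  assumes "crossing_chart E \<phi>" "agree_on U D E" "\<And>z. z \<in> cball 0 1 \<Longrightarrow> \<phi> z \<in> U"
  shows "crossing_chart D \<phi>"
  using crossing_chartD[OF assms(1)] assms(2,3) agree_on_vertices[OF assms(2)]
  by (intro crossing_chartI) (auto simp: agree_on_def)

lemma classical_chart_agree:
  assumes "classical_chart E \<phi>" "agree_on U D E" "\<And>z. z \<in> cball 0 1 \<Longrightarrow> \<phi> z \<in> U"
  shows "classical_chart D \<phi>"
proof -
  have "crossing_chart D \<phi>" using assms crossing_chart_agree classical_chart_iff by metis
  moreover have "\<phi> 0 \<in> U" using assms(3)[of 0] by simp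
  ultimately show ?thesis using assms unfolding classical_chart_iff agree_on_def by simp
qed

lemma virtual_chart_agree:
  assumes "virtual_chart E \<phi>" "agree_on U D E" "\<And>z. z \<in> cball 0 1 \<Longrightarrow> \<phi> z \<in> U"
  shows "virtual_chart D \<phi>"
proof -
  have "crossing_chart D \<phi>" using assms crossing_chart_agree virtual_chart_def by metis
  moreover have "\<phi> 0 \<in> U" using assms(3)[of 0] by simp
  ultimately show ?thesis using assms unfolding virtual_chart_def agree_on_def by simp
qed

text \<open>Both the diagram and the labeling enter only through their germs at the vertex, because charts
  may be shrunk and labels are constant along the rays of a chart.\<close>

lemma rules_at_local:
  assumes D: "rules_at up dn D g v" and U: "open U" "v \<in> U" and ag: "agree_on U D E"
    and g': "locally_const_on (graph E - vertices E) g'"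
    and eq: "\<And>p. p \<in> U \<Longrightarrow> p \<in> graph E - vertices E \<Longrightarrow> g' p = g p"
  shows "rules_at up dn E g' v"
proof (rule rules_atI)
  fix \<phi> :: "complex \<Rightarrow> complex" assume v: "\<phi> 0 = v"
  have key: "\<exists>r. 0 < r \<and> r \<le> 1 \<and> (\<forall>z \<in> cball 0 1. \<phi> (r *\<^sub>R z) \<in> U) \<and>
      (\<forall>u \<in> units. g' (\<phi> u) = g (\<phi> (r *\<^sub>R u)))" if c: "crossing_chart E \<phi>"
  proof -
    obtain r where r: "0 < r" "r \<le> 1" "\<And>z. norm z \<le> r \<Longrightarrow> \<phi> z \<in> U"
      using chart_small[OF crossing_chartD(1)[OF c] U(1)] U(2) v by metis
    have in_U: "\<phi> (r *\<^sub>R z) \<in> U" if "z \<in> cball 0 1" for z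
      using r that mult_left_mono[of "norm z" 1 r] by simp
    have "g' (\<phi> u) = g (\<phi> (r *\<^sub>R u))" if u: "u \<in> units" for u
      using crossing_chart_ray[OF c g' u r(1,2)] eq[OF in_U] crossing_chart_points(1)[OF c u r(1,2)]
        units_norm[OF u] by simp
    then show ?thesis using r in_U by blast
  qed
  show "g' (\<phi> 1) = g' (\<phi> (-1))" if vc: "virtual_chart E \<phi>"
  proof -
    obtain r where r: "0 < r" "r \<le> 1" "\<forall>z \<in> cball 0 1. \<phi> (r *\<^sub>R z) \<in> U"
      "\<forall>u \<in> units. g' (\<phi> u) = g (\<phi> (r *\<^sub>R u))" using key vc virtual_chart_def by blast
    have c: "virtual_chart D (\<lambda>z. \<phi> (r *\<^sub>R z))"
      by (rule virtual_chart_agree[OF virtual_chart_shrink[OF vc r(1,2)] ag]) (use r in auto)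
    have "g (\<phi> (r *\<^sub>R 1)) = g (\<phi> (r *\<^sub>R (-1)))"
      by (rule rules_atD(1)[OF D _ c]) (simp add: v)
    then show ?thesis using r(4) units_simps by simp
  qed
  show "crossing_rule up dn (\<lambda>u. g' (\<phi> u))" if cc: "classical_chart E \<phi>"
  proof -
    obtain r where r: "0 < r" "r \<le> 1" "\<forall>z \<in> cball 0 1. \<phi> (r *\<^sub>R z) \<in> U"
      "\<forall>u \<in> units. g' (\<phi> u) = g (\<phi> (r *\<^sub>R u))" using key cc classical_chart_iff by blast
    have c: "classical_chart D (\<lambda>z. \<phi> (r *\<^sub>R z))"
      by (rule classical_chart_agree[OF classical_chart_shrink[OF cc r(1,2)] ag]) (use r in auto)
    have "crossing_rule up dn (\<lambda>u. g (\<phi> (r *\<^sub>R u)))"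
      by (rule rules_atD(2)[OF D _ c]) (simp add: v)
    then show ?thesis by (rule crossing_rule_cong) (use r(4) in simp)
  qed
  show "g' (\<phi> u) = g' (\<phi> 1)" if cc: "crossing_chart E \<phi>" and s: "v \<in> saddle E" and u: "u \<in> units" for u
  proof -
    obtain r where r: "0 < r" "r \<le> 1" "\<forall>z \<in> cball 0 1. \<phi> (r *\<^sub>R z) \<in> U"
      "\<forall>u \<in> units. g' (\<phi> u) = g (\<phi> (r *\<^sub>R u))" using key cc by blast
    have c: "crossing_chart D (\<lambda>z. \<phi> (r *\<^sub>R z))"
      by (rule crossing_chart_agree[OF crossing_chart_shrink[OF cc r(1,2)] ag]) (use r in auto)
    have sD: "v \<in> saddle D" using ag U(2) s by (simp add: agree_on_def)
    have "g (\<phi> (r *\<^sub>R u)) = g (\<phi> (r *\<^sub>R 1))"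
      by (rule rules_atD(3)[OF D _ c sD u]) (simp add: v)
    then show ?thesis using r(4) units_simps u by simp
  qed
qed

text \<open>A rule read off in one chart at a vertex holds in every other chart there: the second chart
  permutes the four edges, preserving opposition and, at a classical crossing, the over-strand.\<close>

lemma saddle_rule_chart_independent:
  assumes \<phi>: "crossing_chart D \<phi>" and \<psi>: "crossing_chart D \<psi>" and eq: "\<psi> 0 = \<phi> 0"
    and g: "locally_const_on (graph D - vertices D) g"
    and "\<forall>u \<in> units. g (\<phi> u) = g (\<phi> 1)"
  shows "\<forall>u \<in> units. g (\<psi> u) = g (\<psi> 1)"
  using crossing_charts_values[OF assms(1-4)] assms(5) units_simps by metis

text \<open>The second chart may interchange the two strands, so both must be known to go straight.\<close>

lemma virtual_rule_chart_independent:
  assumes \<phi>: "crossing_chart D \<phi>" and \<psi>: "crossing_chart D \<psi>" and eq: "\<psi> 0 = \<phi> 0"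
    and g: "locally_const_on (graph D - vertices D) g"
    and "g (\<phi> 1) = g (\<phi> (-1))" "g (\<phi> \<i>) = g (\<phi> (-\<i>))"
  shows "g (\<psi> 1) = g (\<psi> (-1))"
proof -
  have opp: "g (\<phi> u) = g (\<phi> (-u))" if "u \<in> units" for u
    using that assms(5,6) by (auto simp: units_def)
  show ?thesis using crossing_charts_values[OF assms(1-4)] opp units_simps by metis
qed

lemma crossing_rule_chart_independent:
  assumes \<phi>: "classical_chart D \<phi>" and \<psi>: "classical_chart D \<psi>" and eq: "\<psi> 0 = \<phi> 0"
    and g: "locally_const_on (graph D - vertices D) g"
    and rule: "crossing_rule up dn (\<lambda>u. g (\<phi> u))"
  shows "crossing_rule up dn (\<lambda>u. g (\<psi> u))"
proof -
  have c: "crossing_chart D \<phi>" "crossing_chart D \<psi>" using \<phi> \<psi> by (auto simp: classical_chart_iff)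
  obtain \<sigma> where \<sigma>: "\<forall>u \<in> units. \<sigma> u \<in> units \<and> \<sigma> (-u) = - \<sigma> u \<and> g (\<psi> u) = g (\<phi> (\<sigma> u)) \<and>
     (\<exists>s t. 0 < s \<and> s \<le> 1 \<and> 0 < t \<and> t \<le> 1 \<and> \<psi> (s *\<^sub>R u) = \<phi> (t *\<^sub>R \<sigma> u))"
    using crossing_charts_values[OF c eq g] by blast
  have real: "Im u = 0 \<longleftrightarrow> Im (\<sigma> u) = 0" if u: "u \<in> units" for u
  proof -
    obtain s t where st: "0 < s" "s \<le> 1" "0 < t" "t \<le> 1" "\<psi> (s *\<^sub>R u) = \<phi> (t *\<^sub>R \<sigma> u)"
      using \<sigma> u by blast
    have "s *\<^sub>R u \<in> cball 0 1" "t *\<^sub>R \<sigma> u \<in> cball 0 1"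
      using st u \<sigma> units_norm[of u] units_norm[of "\<sigma> u"] by auto
    then have "Im (s *\<^sub>R u) = 0 \<longleftrightarrow> Im (t *\<^sub>R \<sigma> u) = 0"
      using \<phi> \<psi> st(5) unfolding classical_chart_iff by metis
    then show ?thesis using st by simp
  qed
  have s1: "\<sigma> u \<in> {\<i>, -\<i>}" if "u \<in> {\<i>, -\<i>}" for u
    using \<sigma>[rule_format, of u] real[of u] that by (auto simp: units_def)
  have s2: "\<sigma> u \<in> {1, -1}" if "u \<in> {1, -1}" for u
    using \<sigma>[rule_format, of u] real[of u] that by (auto simp: units_def)
  show ?thesis unfolding crossing_rule_def
  proof (intro ballI)
    fix u w :: complex assume u: "u \<in> {\<i>, -\<i>}" and w: "w \<in> {1, -1}"
    have m: "u \<in> units" "w \<in> units" "-u \<in> units" "-w \<in> units" using u w by (auto simp: units_def)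
    have "g (\<phi> (- \<sigma> u)) = up (g (\<phi> (\<sigma> u))) (g (\<phi> (\<sigma> w)))"
      "g (\<phi> (- \<sigma> w)) = dn (g (\<phi> (\<sigma> w))) (g (\<phi> (\<sigma> u)))"
      using bspec[OF bspec[OF rule[unfolded crossing_rule_def] s1[OF u]] s2[OF w]] by simp_all
    moreover have "g (\<psi> u) = g (\<phi> (\<sigma> u))" "g (\<psi> w) = g (\<phi> (\<sigma> w))"
      "g (\<psi> (-u)) = g (\<phi> (- \<sigma> u))" "g (\<psi> (-w)) = g (\<phi> (- \<sigma> w))"
      using bspec[OF \<sigma> m(1)] bspec[OF \<sigma> m(2)] bspec[OF \<sigma> m(3)] bspec[OF \<sigma> m(4)] by simp_all
    ultimately show "g (\<psi> (-u)) = up (g (\<psi> u)) (g (\<psi> w)) \<and> g (\<psi> (-w)) = dn (g (\<psi> w)) (g (\<psi> u))"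
      by simp
  qed
qed

lemma same_semiarc_sym:
  assumes "same_semiarc D p q" shows "same_semiarc D q p"
  using assms
proof induction
  case (along p q)
  then show ?case by (simp add: connected_component_sym same_semiarc.along)
next
  case (across \<phi>)
  have "virtual_chart D (\<lambda>z. \<phi> (\<i> * (\<i> * z)))" using virtual_chart_rotate[OF virtual_chart_rotate[OF across]] by simp
  then show ?case using same_semiarc.across[of D "\<lambda>z. \<phi> (\<i> * (\<i> * z))"] by simp
next
  case (trans p q r)
  then show ?case using same_semiarc.trans by blast
qed

lemma same_semiarc_refl: "p \<in> graph D - vertices D \<Longrightarrow> same_semiarc D p p"
  by (intro same_semiarc.along) (simp add: connected_component_refl)

lemma same_semiarc_mem:
  "same_semiarc D p q \<Longrightarrow> p \<in> graph D - vertices D \<and> q \<in> graph D - vertices D"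
proof (induction rule: same_semiarc.induct)
  case (along p q)
  then show ?case using connected_component_in by metis
next
  case (across \<phi>)
  then show ?case using crossing_chart_points(2)[of D \<phi> _ 1] units_simps unfolding virtual_chart_def by simp
qed auto

lemma semiarc_of_eq_iff:
  assumes "p \<in> graph D - vertices D" "q \<in> graph D - vertices D"
  shows "semiarc_of D p = semiarc_of D q \<longleftrightarrow> same_semiarc D p q"
  unfolding semiarc_of_def
  using same_semiarc_sym same_semiarc_refl[OF assms(2)] same_semiarc.trans by (metis (full_types) mem_Collect_eq Collect_cong)

lemma point_labeling_const_on_semiarc:
  assumes g: "g \<in> point_labelings X up dn D" and "same_semiarc D p q"
  shows "g p = g q"
  using assms(2)
proof induction
  case (along p q)
  then obtain T where "connected T" "T \<subseteq> graph D - vertices D" "p \<in> T" "q \<in> T"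
    unfolding connected_component_def by blast
  then show ?case using locally_const_on_connected[OF point_labelingsD(3)[OF g]] by blast
next
  case (across \<phi>)
  have "\<phi> 0 \<in> vertices D" using across by (simp add: virtual_chart_def vertices_def)
  then show ?case using rules_atD(1)[OF point_labelingsD(4)[OF g] refl across] by simp
qed auto

text \<open>Edge charts show that the graph is locally connected off its vertices.\<close>

lemma locally_const_semiarcs:
  assumes D: "vmv_diagram D"
  shows "locally_const_on (graph D - vertices D) (\<lambda>p. f (semiarc_of D p))"
proof (rule locally_const_onI)
  fix p assume p: "p \<in> graph D - vertices D"
  then obtain \<phi> where \<phi>: "edge_chart D \<phi>" "\<phi> 0 = p" using D unfolding vmv_diagram_def by blast
  then have c: "continuous_on (cball 0 1) \<phi>" "inj_on \<phi> (cball 0 1)"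
    and gr: "graph D \<inter> \<phi> ` cball 0 1 = \<phi> ` {z \<in> cball 0 1. Im z = 0}" by (auto simp: edge_chart_def)
  have "open (- vertices D)" using D finite_imp_closed unfolding vmv_diagram_def by auto
  then obtain r where r: "0 < r" "r \<le> 1" "\<And>z. norm z \<le> r \<Longrightarrow> \<phi> z \<in> - vertices D"
    using chart_small[OF c(1), of "- vertices D"] p \<phi>(2) by auto
  let ?C = "\<phi> ` {z \<in> ball 0 r. Im z = 0}"
  have "convex {z \<in> ball (0::complex) r. Im z = 0}"
  proof -
    have "{z \<in> ball (0::complex) r. Im z = 0} = ball 0 r \<inter> {z. Im z = 0}" by blast
    moreover have "convex {z. Im z = 0}" by (simp add: convex_def)
    ultimately show ?thesis by (simp add: convex_Int)
  qed
  then have "connected ?C"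
    by (intro connected_continuous_image continuous_on_subset[OF c(1)] convex_connected) (use r in auto)
  moreover have sub: "?C \<subseteq> graph D - vertices D"
  proof
    fix q assume "q \<in> ?C"
    then obtain z where z: "q = \<phi> z" "norm z < r" "Im z = 0" by auto
    then have "q \<in> \<phi> ` {z \<in> cball 0 1. Im z = 0}" using r by auto
    then show "q \<in> graph D - vertices D" using gr r(3)[of z] z by auto
  qed
  moreover have "p \<in> ?C" using \<phi>(2) r by (intro image_eqI[of _ _ 0]) auto
  ultimately have same: "semiarc_of D q = semiarc_of D p" if "q \<in> ?C" for q
    using that semiarc_of_eq_iff[of q D p] p same_semiarc.along unfolding connected_component_def by blast
  have "q \<in> ?C" if q: "q \<in> (graph D - vertices D) \<inter> \<phi> ` ball 0 r" for q
  proof -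
    obtain z where z: "q = \<phi> z" "norm z < r" using q by auto
    then have "q \<in> \<phi> ` {z \<in> cball 0 1. Im z = 0}" using q gr r by auto
    then obtain z' where z': "q = \<phi> z'" "norm z' \<le> 1" "Im z' = 0" by auto
    have "z = z'" by (rule inj_onD[OF c(2)]) (use z z' r in auto)
    then show ?thesis using z z' by auto
  qed
  then show "\<exists>U. open U \<and> p \<in> U \<and> (\<forall>q \<in> (graph D - vertices D) \<inter> U. f (semiarc_of D q) = f (semiarc_of D p))"
    using same open_embedding_ball[OF c r(2)] \<phi>(2) r by (intro exI[of _ "\<phi> ` ball 0 r"]) auto
qed

text \<open>Composition with \<open>semiarc_of\<close> is a bijection. A point labeling descends to semiarcs since it is
  constant on connected sets and takes equal values on both sides of a virtual crossing.\<close>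

lemma card_labelings_eq_point_labelings:
  assumes D: "vmv_diagram D"
  shows "card (labelings X up dn D) = card (point_labelings X up dn D)"
proof (rule bij_betw_same_card)
  let ?E = "graph D - vertices D"
  let ?F = "\<lambda>f. restrict (\<lambda>p. f (semiarc_of D p)) ?E"
  define G where "G g = restrict (\<lambda>s. g (SOME p. p \<in> ?E \<and> semiarc_of D p = s)) (semiarcs D)" for g :: "complex \<Rightarrow> 'a"
  have Geq: "G g (semiarc_of D p) = g p" if g: "g \<in> point_labelings X up dn D" and p: "p \<in> ?E" for g p
  proof -
    let ?q = "SOME q. q \<in> ?E \<and> semiarc_of D q = semiarc_of D p"
    have q: "?q \<in> ?E \<and> semiarc_of D ?q = semiarc_of D p" by (rule someI[of _ p]) (use p in simp)
    then have "g ?q = g p"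
      using point_labeling_const_on_semiarc[OF g] semiarc_of_eq_iff[of ?q D p] p by blast
    moreover have "semiarc_of D p \<in> semiarcs D" using p by (simp add: semiarcs_def)
    ultimately show ?thesis by (simp add: G_def)
  qed
  show "bij_betw ?F (labelings X up dn D) (point_labelings X up dn D)"
  proof (rule bij_betw_byWitness[where f' = G])
    show "\<forall>f \<in> labelings X up dn D. G (?F f) = f"
    proof
      fix f assume f: "f \<in> labelings X up dn D"
      show "G (?F f) = f"
      proof
        fix s show "G (?F f) s = f s"
        proof (cases "s \<in> semiarcs D")
          case True
          then have "\<exists>p. p \<in> ?E \<and> semiarc_of D p = s" by (auto simp: semiarcs_def)
          from someI_ex[OF this] show ?thesis using True by (simp add: G_def)
        next
          case False
          then show ?thesis using f by (auto simp: G_def labelings_def PiE_def extensional_def)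
        qed
      qed
    qed
    show "\<forall>g \<in> point_labelings X up dn D. ?F (G g) = g"
    proof
      fix g assume g: "g \<in> point_labelings X up dn D"
      show "?F (G g) = g"
        using Geq[OF g] point_labelingsD(2)[OF g] by (intro ext) (simp add: restrict_def)
    qed
    show "?F ` labelings X up dn D \<subseteq> point_labelings X up dn D"
    proof (rule image_subsetI, rule point_labelingsI)
      fix f assume f: "f \<in> labelings X up dn D"
      show lc: "locally_const_on ?E (\<lambda>p. f (semiarc_of D p))" by (rule locally_const_semiarcs[OF D])
      show "f (semiarc_of D p) \<in> X" if "p \<in> graph D" "p \<notin> vertices D" for p
        using f that by (auto simp: labelings_def semiarcs_def)
      show "rules_at up dn D (\<lambda>p. f (semiarc_of D p)) v" if v: "v \<in> vertices D" for v
      proof (rule rules_atI)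
        fix \<phi> :: "complex \<Rightarrow> complex" assume \<phi>: "\<phi> 0 = v"
        show "f (semiarc_of D (\<phi> 1)) = f (semiarc_of D (\<phi> (-1)))" if vc: "virtual_chart D \<phi>"
          using same_semiarc.across[OF vc] semiarc_of_eq_iff same_semiarc_mem by metis
        show "crossing_rule up dn (\<lambda>u. f (semiarc_of D (\<phi> u)))" if "classical_chart D \<phi>"
          using f that unfolding labelings_def crossing_rule_def Let_def by blast
        show "f (semiarc_of D (\<phi> u)) = f (semiarc_of D (\<phi> 1))"
          if cc: "crossing_chart D \<phi>" "v \<in> saddle D" and u: "u \<in> units" for u
        proof -
          obtain \<psi> where \<psi>: "saddle_chart D \<psi>" "\<psi> 0 = v" using D cc unfolding vmv_diagram_def by blast
          have *: "\<forall>u \<in> units. f (semiarc_of D (\<psi> u)) = f (semiarc_of D (\<psi> 1))"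
            using f \<psi>(1) unfolding labelings_def units_def by blast
          have "\<forall>u \<in> units. f (semiarc_of D (\<phi> u)) = f (semiarc_of D (\<phi> 1))"
            by (rule saddle_rule_chart_independent[OF _ _ _ lc *])
              (use \<psi> \<phi> cc in \<open>auto simp: saddle_chart_def\<close>)
          then show ?thesis using u by blast
        qed
      qed
    qed
    show "G ` point_labelings X up dn D \<subseteq> labelings X up dn D"
    proof (rule image_subsetI)
      fix g assume g: "g \<in> point_labelings X up dn D"
      have "G g s \<in> X" if "s \<in> semiarcs D" for s
        using that Geq[OF g] point_labelingsD(1)[OF g] unfolding semiarcs_def by auto
      then have PiE: "G g \<in> semiarcs D \<rightarrow>\<^sub>E X" by (auto simp: G_def)
      have Gu: "G g (semiarc_of D (\<phi> u)) = g (\<phi> u)" if "crossing_chart D \<phi>" "u \<in> units" for \<phi> u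
        using Geq[OF g crossing_chart_points(2)[OF that, of 1]] by simp
      have cl: "crossing_rule up dn (\<lambda>u. G g (semiarc_of D (\<phi> u)))" if c: "classical_chart D \<phi>" for \<phi>
      proof -
        have v: "\<phi> 0 \<in> vertices D" "crossing_chart D \<phi>" using c by (auto simp: classical_chart_iff vertices_def)
        have "crossing_rule up dn (\<lambda>u. g (\<phi> u))"
          using rules_atD(2)[OF point_labelingsD(4)[OF g v(1)] refl c] .
        then show ?thesis by (rule crossing_rule_cong) (rule Gu[OF v(2)])
      qed
      have sa: "\<forall>u \<in> units. G g (semiarc_of D (\<phi> u)) = G g (semiarc_of D (\<phi> 1))" if c: "saddle_chart D \<phi>" for \<phi>
      proof -
        have v: "\<phi> 0 \<in> vertices D" "crossing_chart D \<phi>" "\<phi> 0 \<in> saddle D"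
          using c by (auto simp: saddle_chart_def vertices_def)
        have "\<forall>u \<in> units. g (\<phi> u) = g (\<phi> 1)"
          by (intro ballI rules_atD(3)[OF point_labelingsD(4)[OF g v(1)] refl v(2,3)])
        then show ?thesis using Gu[OF v(2)] Gu[OF v(2) units_simps(1)] by metis
      qed
      show "G g \<in> labelings X up dn D"
        unfolding labelings_def Let_def
        using PiE cl[unfolded crossing_rule_def] sa[unfolded units_def] by blast
    qed
  qed
qed

section \<open>Planar isotopy\<close>

lemma transport_mem:
  assumes "homeomorphism UNIV UNIV h k"
  shows "p \<in> graph (transport h D) \<longleftrightarrow> k p \<in> graph D"
    "p \<in> classical (transport h D) \<longleftrightarrow> k p \<in> classical D"
    "p \<in> saddle (transport h D) \<longleftrightarrow> k p \<in> saddle D"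
    "p \<in> virtual (transport h D) \<longleftrightarrow> k p \<in> virtual D"
    "p \<in> over (transport h D) \<longleftrightarrow> k p \<in> over D"
    "p \<in> vertices (transport h D) \<longleftrightarrow> k p \<in> vertices D"
proof -
  have *: "p \<in> h ` S \<longleftrightarrow> k p \<in> S" for S
    using homeomorphism_apply1[OF assms] homeomorphism_apply2[OF assms]
    by (metis UNIV_I image_iff)
  show "p \<in> graph (transport h D) \<longleftrightarrow> k p \<in> graph D"
    "p \<in> classical (transport h D) \<longleftrightarrow> k p \<in> classical D"
    "p \<in> saddle (transport h D) \<longleftrightarrow> k p \<in> saddle D"
    "p \<in> virtual (transport h D) \<longleftrightarrow> k p \<in> virtual D"
    "p \<in> over (transport h D) \<longleftrightarrow> k p \<in> over D"
    "p \<in> vertices (transport h D) \<longleftrightarrow> k p \<in> vertices D"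
    unfolding vertices_def by (simp_all add: transport_def *)
qed

lemma transport_inverse:
  assumes "homeomorphism UNIV UNIV h k"
  shows "transport k (transport h D) = D"
proof -
  have "k ` h ` S = S" for S
    using homeomorphism_apply1[OF assms] by (simp add: image_image)
  then show ?thesis by (cases D) (simp add: transport_def)
qed

lemma crossing_chart_transport:
  assumes h: "homeomorphism UNIV UNIV h k" and \<phi>: "crossing_chart (transport h D) \<phi>"
  shows "crossing_chart D (\<lambda>z. k (\<phi> z))"
proof (rule crossing_chartI)
  note c = crossing_chartD[OF \<phi>]
  show "continuous_on (cball 0 1) (\<lambda>z. k (\<phi> z))"
    by (rule continuous_on_compose2[OF homeomorphism_cont2[OF h] c(1)]) simp
  show "inj_on (\<lambda>z. k (\<phi> z)) (cball 0 1)"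
  proof (rule inj_onI)
    fix x y assume *: "x \<in> cball 0 1" "y \<in> cball 0 1" "k (\<phi> x) = k (\<phi> y)"
    then have "\<phi> x = \<phi> y" using homeomorphism_apply2[OF h] by (metis UNIV_I)
    then show "x = y" using inj_onD[OF c(2)] * by simp
  qed
qed (use crossing_chartD(3,4)[OF \<phi>] transport_mem[OF h] in simp_all)

text \<open>A chart of the image diagram, followed by the inverse homeomorphism, is a chart of the original
  diagram.\<close>

lemma point_labeling_transport:
  assumes h: "homeomorphism UNIV UNIV h k" and g: "g \<in> point_labelings X up dn D"
  shows "restrict (\<lambda>p. g (k p)) (graph (transport h D) - vertices (transport h D))
    \<in> point_labelings X up dn (transport h D)"
proof (rule point_labelingsI)
  note mem = transport_mem[OF h]
  let ?T = "transport h D"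
  show "g (k p) \<in> X" if "p \<in> graph ?T" "p \<notin> vertices ?T" for p
    using point_labelingsD(1)[OF g] that mem by simp
  show "locally_const_on (graph ?T - vertices ?T) (\<lambda>p. g (k p))"
  proof (rule locally_const_onI)
    fix p assume p: "p \<in> graph ?T - vertices ?T"
    then obtain U where U: "open U" "k p \<in> U"
      "\<And>q. q \<in> graph D - vertices D \<Longrightarrow> q \<in> U \<Longrightarrow> g q = g (k p)"
      using locally_const_onE[OF point_labelingsD(3)[OF g], of "k p"] mem by auto
    have "open (k -` U)"
      using homeomorphism_cont2[OF h] U(1) by (simp add: open_vimage)
    then show "\<exists>U. open U \<and> p \<in> U \<and> (\<forall>q \<in> (graph ?T - vertices ?T) \<inter> U. g (k q) = g (k p))"
      using U mem by (intro exI[of _ "k -` U"]) simp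
  qed
  show "rules_at up dn ?T (\<lambda>p. g (k p)) v" if v: "v \<in> vertices ?T" for v
  proof -
    have r: "rules_at up dn D g (k v)" using point_labelingsD(4)[OF g] v mem by simp
    show ?thesis
    proof (rule rules_atI)
      fix \<phi> :: "complex \<Rightarrow> complex" assume \<phi>: "\<phi> 0 = v"
      show "g (k (\<phi> 1)) = g (k (\<phi> (-1)))" if c: "virtual_chart ?T \<phi>"
      proof -
        have "virtual_chart D (\<lambda>z. k (\<phi> z))"
          using c crossing_chart_transport[OF h] mem(4) by (simp add: virtual_chart_def)
        from rules_atD(1)[OF r _ this] show ?thesis by (simp add: \<phi>)
      qed
      show "crossing_rule up dn (\<lambda>u. g (k (\<phi> u)))" if c: "classical_chart ?T \<phi>"
      proof -
        have "classical_chart D (\<lambda>z. k (\<phi> z))"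
          using c crossing_chart_transport[OF h] mem(2,5) by (simp add: classical_chart_iff)
        from rules_atD(2)[OF r _ this] show ?thesis by (simp add: \<phi>)
      qed
      show "g (k (\<phi> u)) = g (k (\<phi> 1))" if c: "crossing_chart ?T \<phi>" "v \<in> saddle ?T" "u \<in> units" for u
        using rules_atD(3)[OF r _ crossing_chart_transport[OF h c(1)]] c mem(3) \<phi> by simp
    qed
  qed
qed

lemma point_labeling_transport_back:
  assumes h: "homeomorphism UNIV UNIV h k" and g: "g \<in> point_labelings X up dn (transport h D)"
  shows "restrict (\<lambda>p. g (h p)) (graph D - vertices D) \<in> point_labelings X up dn D"
  using point_labeling_transport[OF homeomorphism_symD[OF h] g] transport_inverse[OF h, of D] by simp

lemma card_point_labelings_transport:
  assumes h: "homeomorphism UNIV UNIV h k"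
  shows "card (point_labelings X up dn D) = card (point_labelings X up dn (transport h D))"
proof (rule bij_betw_same_card)
  let ?T = "transport h D"
  let ?F = "\<lambda>g. restrict (\<lambda>p. g (k p)) (graph ?T - vertices ?T)"
  let ?G = "\<lambda>g. restrict (\<lambda>p. g (h p)) (graph D - vertices D)"
  note mem = transport_mem[OF h]
  have hk: "h (k p) = p" "k (h p) = p" for p
    using homeomorphism_apply1[OF h] homeomorphism_apply2[OF h] by auto
  show "bij_betw ?F (point_labelings X up dn D) (point_labelings X up dn ?T)"
  proof (rule bij_betw_byWitness[where f' = ?G])
    show "\<forall>g \<in> point_labelings X up dn D. ?G (?F g) = g"
      using point_labelingsD(2) hk mem by (fastforce simp: restrict_def)
    show "\<forall>g \<in> point_labelings X up dn ?T. ?F (?G g) = g"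
      using point_labelingsD(2) hk mem by (fastforce simp: restrict_def)
    show "?F ` point_labelings X up dn D \<subseteq> point_labelings X up dn ?T"
      using point_labeling_transport[OF h] by blast
    show "?G ` point_labelings X up dn ?T \<subseteq> point_labelings X up dn D"
      using point_labeling_transport_back[OF h] by blast
  qed
qed

text \<open>Over-strands that agree near each classical crossing give the same small charts.\<close>

lemma point_labelings_same_diagram_subset:
  assumes "same_diagram D E"
  shows "point_labelings X up dn D \<subseteq> point_labelings X up dn E"
proof
  fix g assume g: "g \<in> point_labelings X up dn D"
  have eq: "graph D = graph E" "classical D = classical E" "saddle D = saddle E" "virtual D = virtual E"
    and ov: "\<And>v. v \<in> classical D \<Longrightarrow> \<forall>\<^sub>F z in nhds v. z \<in> over D \<longleftrightarrow> z \<in> over E"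
    using assms by (auto simp: same_diagram_def)
  then have v: "vertices D = vertices E" by (simp add: vertices_def)
  have "rules_at up dn E g v" if "v \<in> vertices E" for v
  proof (rule rules_atI)
    note r = point_labelingsD(4)[OF g, of v, unfolded \<open>vertices D = vertices E\<close>, OF that]
    fix \<phi> :: "complex \<Rightarrow> complex" assume \<phi>: "\<phi> 0 = v"
    have cc: "crossing_chart E \<phi> = crossing_chart D \<phi>"
      unfolding crossing_chart_def eq v by (rule refl)
    show "g (\<phi> 1) = g (\<phi> (-1))" if "virtual_chart E \<phi>"
      by (rule rules_atD(1)[where \<phi> = \<phi>, OF r \<phi>]) (use that cc eq in \<open>simp add: virtual_chart_def\<close>)
    show "g (\<phi> u) = g (\<phi> 1)" if "crossing_chart E \<phi>" "v \<in> saddle E" "u \<in> units" for u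
      by (rule rules_atD(3)[where \<phi> = \<phi>, OF r \<phi>]) (use that cc eq in simp_all)
    show "crossing_rule up dn (\<lambda>u. g (\<phi> u))" if c: "classical_chart E \<phi>"
    proof -
      have "v \<in> classical D" using c \<phi> eq by (simp add: classical_chart_iff)
      then obtain U where U: "open U" "v \<in> U" "\<forall>z \<in> U. z \<in> over D \<longleftrightarrow> z \<in> over E"
        using ov unfolding eventually_nhds by metis
      have ag: "agree_on U D E" using U(3) eq by (simp add: agree_on_def)
      have lc: "locally_const_on (graph E - vertices E) g" using point_labelingsD(3)[OF g] eq v by simp
      have "rules_at up dn E g v" by (rule rules_at_local[OF r U(1,2) ag lc]) simp
      from rules_atD(2)[where \<phi> = \<phi>, OF this \<phi> c] show ?thesis .
    qed
  qed
  then show "g \<in> point_labelings X up dn E"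
    using g unfolding point_labelings_def by (simp add: eq v)
qed

lemma same_diagram_sym:
  assumes "same_diagram D E" shows "same_diagram E D"
proof -
  have "(\<forall>\<^sub>F z in nhds v. z \<in> over D \<longleftrightarrow> z \<in> over E) \<longleftrightarrow> (\<forall>\<^sub>F z in nhds v. z \<in> over E \<longleftrightarrow> z \<in> over D)" for v
    by (simp only: eq_commute)
  moreover have "(\<forall>\<^sub>F z in nhds v. z \<in> minus_sectors D \<longleftrightarrow> z \<in> minus_sectors E) \<longleftrightarrow>
    (\<forall>\<^sub>F z in nhds v. z \<in> minus_sectors E \<longleftrightarrow> z \<in> minus_sectors D)" for v
    by (simp only: eq_commute)
  ultimately show ?thesis using assms by (simp add: same_diagram_def)
qed

lemma card_point_labelings_planar_isotopic:
  assumes "planar_isotopic D D'"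
  shows "card (point_labelings X up dn D) = card (point_labelings X up dn D')"
proof -
  obtain h where h: "ambient_isotopy_end h" "same_diagram (transport h D) D'"
    using assms by (auto simp: planar_isotopic_def)
  obtain k where "homeomorphism UNIV UNIV h k"
    using homotopic_with_imp_property[OF h(1)[unfolded ambient_isotopy_end_def]] by blast
  moreover have "point_labelings X up dn (transport h D) = point_labelings X up dn D'"
    using point_labelings_same_diagram_subset[OF h(2)]
      point_labelings_same_diagram_subset[OF same_diagram_sym[OF h(2)]] by (rule equalityI)
  ultimately show ?thesis using card_point_labelings_transport by metis
qed

section \<open>Gluing along the boundary of the disk\<close>

text \<open>Labelings of the two sides of a move are matched by a relation (agreement away from the place
  where the move happens) which is functional in both directions.\<close>

lemma card_eq_by_relation:
  assumes "\<And>a. a \<in> A \<Longrightarrow> \<exists>!b. b \<in> B \<and> R a b" and "\<And>b. b \<in> B \<Longrightarrow> \<exists>!a. a \<in> A \<and> R a b"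
  shows "card A = card B"
proof (rule bij_betw_same_card)
  define F where "F a = (THE b. b \<in> B \<and> R a b)" for a
  define G where "G b = (THE a. a \<in> A \<and> R a b)" for b
  have F: "F a \<in> B" "R a (F a)" if "a \<in> A" for a
    using theI'[OF assms(1)[OF that]] by (auto simp: F_def)
  have G: "G b \<in> A" "R (G b) b" if "b \<in> B" for b
    using theI'[OF assms(2)[OF that]] by (auto simp: G_def)
  show "bij_betw F A B"
  proof (rule bij_betw_byWitness[where f' = G])
    show "\<forall>a\<in>A. G (F a) = a" using F G assms(2) by metis
    show "\<forall>b\<in>B. F (G b) = b" using F G assms(1) by metis
  qed (use F G in auto)
qed

text \<open>Common features of all pictures of local moves. That the over-strands are part of the graph and
  contain the crossings makes switching the crossings an involution.\<close>

definition local_diagram :: "diagram \<Rightarrow> bool" where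
  "local_diagram L \<longleftrightarrow> vertices L \<subseteq> open_disk \<and> virtual L = {} \<and> classical L \<subseteq> over L \<and> over L \<subseteq> graph L"

text \<open>The points of \<open>graph L - open_disk\<close> are the end points of the picture on the boundary of the
  disk.\<close>

definition extends_labelings where
  "extends_labelings X up dn L R \<longleftrightarrow> (\<forall>g \<in> point_labelings X up dn L.
     \<exists>!g'. g' \<in> point_labelings X up dn R \<and> (\<forall>p \<in> graph L - open_disk. g' p = g p))"

lemma open_open_disk: "open open_disk"
  by (simp add: open_disk_def open_box)

lemma closed_disk: "closed disk"
  by (simp add: disk_def closed_cbox)

lemma open_disk_subset: "open_disk \<subseteq> disk"
  by (simp add: open_disk_def disk_def box_subset_cbox)

lemma restrict_to_simps [simp]:
  "graph (restrict_to K D) = graph D \<inter> K" "vertices (restrict_to K D) = vertices D \<inter> K"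
  "classical (restrict_to K D) = classical D \<inter> K" "saddle (restrict_to K D) = saddle D \<inter> K"
  "virtual (restrict_to K D) = virtual D \<inter> K" "over (restrict_to K D) = over D \<inter> K"
  unfolding vertices_def by (auto simp: restrict_to_def)

lemma agree_on_restrict_to: "U \<subseteq> K \<Longrightarrow> agree_on U D (restrict_to K D)"
  by (auto simp: agree_on_def restrict_to_def)

lemma agree_on_outside:
  assumes "restrict_to K D = restrict_to K D'" "U \<subseteq> K"
  shows "agree_on U D D'"
proof -
  have "graph D \<inter> K = graph D' \<inter> K" "classical D \<inter> K = classical D' \<inter> K" "saddle D \<inter> K = saddle D' \<inter> K"
    "virtual D \<inter> K = virtual D' \<inter> K" "over D \<inter> K = over D' \<inter> K"
    using assms(1) by (simp_all add: restrict_to_def)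
  then show ?thesis using assms(2) unfolding agree_on_def by blast
qed

lemma restrict_point_labeling_to_disk:
  assumes g: "g \<in> point_labelings X up dn D" and v: "vertices D \<inter> disk \<subseteq> open_disk"
  shows "restrict g (graph D \<inter> disk - vertices D) \<in> point_labelings X up dn (restrict_to disk D)"
proof -
  let ?L = "restrict_to disk D"
  have lc: "locally_const_on (graph ?L - vertices ?L) g"
    by (rule locally_const_on_cong[OF point_labelingsD(3)[OF g]]) auto
  have "restrict g (graph ?L - vertices ?L) \<in> point_labelings X up dn ?L"
  proof (rule point_labelingsI)
    show "g p \<in> X" if "p \<in> graph ?L" "p \<notin> vertices ?L" for p
      using point_labelingsD(1)[OF g] that by simp
    show "locally_const_on (graph ?L - vertices ?L) g" by (rule lc)
    show "rules_at up dn ?L g p" if p: "p \<in> vertices ?L" for p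
      by (rule rules_at_local[OF point_labelingsD(4)[OF g] open_open_disk _
            agree_on_restrict_to[OF open_disk_subset] lc]) (use p v in auto)
  qed
  moreover have "graph ?L - vertices ?L = graph D \<inter> disk - vertices D" by auto
  ultimately show ?thesis by simp
qed

text \<open>A neighbourhood of a point on the boundary of the disk consists of a part in the disk and a
  part outside the open disk; the inner labeling is constant on the first, the outer one on the second, and
  both take the same value at the point itself.\<close>

lemma glue_point_labelings:
  assumes g: "g \<in> point_labelings X up dn D" and h: "h \<in> point_labelings X up dn (restrict_to disk D')"
    and out: "restrict_to (- open_disk) D = restrict_to (- open_disk) D'"
    and v: "vertices D' \<inter> disk \<subseteq> open_disk"
    and eq: "\<And>p. p \<in> graph D' \<inter> disk - open_disk \<Longrightarrow> h p = g p"
  shows "restrict (\<lambda>p. if p \<in> disk then h p else g p) (graph D' - vertices D') \<in> point_labelings X up dn D'"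
proof -
  let ?f = "\<lambda>p. if p \<in> disk then h p else g p"
  let ?R = "restrict_to disk D'"
  have ag: "agree_on (- open_disk) D D'" by (rule agree_on_outside[OF out order_refl])
  have agv: "p \<in> graph D \<longleftrightarrow> p \<in> graph D'" "p \<in> vertices D \<longleftrightarrow> p \<in> vertices D'" if "p \<notin> open_disk" for p
    using ag agree_on_vertices[OF ag, of p] that by (auto simp: agree_on_def)
  have od: "open (- disk)" using closed_disk by (rule open_Compl)
  have fout: "?f p = g p" if "p \<notin> open_disk" "p \<in> graph D'" for p
    using eq that by simp
  have lc: "locally_const_on (graph D' - vertices D') ?f"
  proof (rule locally_const_onI)
    fix p assume p: "p \<in> graph D' - vertices D'"
    show "\<exists>U. open U \<and> p \<in> U \<and> (\<forall>q \<in> (graph D' - vertices D') \<inter> U. ?f q = ?f p)"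
    proof (cases "p \<in> disk")
      case True
      then obtain U where U: "open U" "p \<in> U"
        "\<And>q. q \<in> graph ?R - vertices ?R \<Longrightarrow> q \<in> U \<Longrightarrow> h q = h p"
        using p locally_const_onE[OF point_labelingsD(3)[OF h], of p] by auto
      show ?thesis
      proof (cases "p \<in> open_disk")
        case True
        then show ?thesis using U open_open_disk open_disk_subset
          by (intro exI[of _ "U \<inter> open_disk"]) auto
      next
        case False
        then obtain W where W: "open W" "p \<in> W"
          "\<And>q. q \<in> graph D - vertices D \<Longrightarrow> q \<in> W \<Longrightarrow> g q = g p"
          using p agv locally_const_onE[OF point_labelingsD(3)[OF g], of p] by auto
        have "?f q = ?f p" if q: "q \<in> (graph D' - vertices D') \<inter> (U \<inter> W)" for q
        proof (cases "q \<in> disk")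
          case True
          then have "h q = h p" using U(3)[of q] q by simp
          then show ?thesis using True \<open>p \<in> disk\<close> by simp
        next
          case qd: False
          then have "q \<notin> open_disk" using open_disk_subset by blast
          then have "g q = g p" using W(3)[of q] q agv by simp
          then show ?thesis using qd fout[OF False] p by simp
        qed
        then show ?thesis using U W by (intro exI[of _ "U \<inter> W"]) auto
      qed
    next
      case False
      then have "p \<notin> open_disk" using open_disk_subset by blast
      then obtain W where W: "open W" "p \<in> W"
        "\<And>q. q \<in> graph D - vertices D \<Longrightarrow> q \<in> W \<Longrightarrow> g q = g p"
        using p agv locally_const_onE[OF point_labelingsD(3)[OF g], of p] by auto
      have "?f q = ?f p" if q: "q \<in> (graph D' - vertices D') \<inter> (W \<inter> - disk)" for q
      proof -
        have "q \<notin> open_disk" using q open_disk_subset by blast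
        then show ?thesis using W(3)[of q] q agv False by simp
      qed
      then show ?thesis using W od False by (intro exI[of _ "W \<inter> - disk"]) auto
    qed
  qed
  show ?thesis
  proof (rule point_labelingsI[OF _ lc])
    show "?f p \<in> X" if p: "p \<in> graph D'" "p \<notin> vertices D'" for p
    proof (cases "p \<in> disk")
      case True
      then show ?thesis using point_labelingsD(1)[OF h, of p] p by simp
    next
      case False
      then have "p \<notin> open_disk" using open_disk_subset by blast
      then show ?thesis using point_labelingsD(1)[OF g, of p] p agv False by simp
    qed
    show "rules_at up dn D' ?f p" if p: "p \<in> vertices D'" for p
    proof (cases "p \<in> disk")
      case True
      then have pv: "p \<in> vertices ?R" "p \<in> open_disk" using p v by auto
      show ?thesis
        by (rule rules_at_local[OF point_labelingsD(4)[OF h pv(1)] open_open_disk pv(2)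
              agree_on_sym[OF agree_on_restrict_to[OF open_disk_subset]] lc])
          (use open_disk_subset in auto)
    next
      case False
      then have no: "p \<notin> open_disk" using open_disk_subset by blast
      have ag': "agree_on (- disk) D D'"
        by (rule agree_on_outside[OF out]) (use open_disk_subset in blast)
      have "p \<in> vertices D" using agv(2)[OF no] p by simp
      from rules_at_local[OF point_labelingsD(4)[OF g this] od _ ag' lc]
      show ?thesis using False by simp
    qed
  qed
qed

text \<open>A labeling is restricted to the disk, replaced there by its unique counterpart, and glued with
  what is left outside.\<close>

lemma unique_extension_from_disk:
  assumes ext: "extends_labelings X up dn (restrict_to disk D) (restrict_to disk D')"
    and out: "restrict_to (- open_disk) D = restrict_to (- open_disk) D'"
    and v: "vertices D \<inter> disk \<subseteq> open_disk" and v': "vertices D' \<inter> disk \<subseteq> open_disk"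
    and g: "g \<in> point_labelings X up dn D"
  shows "\<exists>!g'. g' \<in> point_labelings X up dn D' \<and> (\<forall>p \<in> graph D - open_disk. g' p = g p)"
proof -
  let ?L = "restrict_to disk D" and ?R = "restrict_to disk D'"
  let ?gL = "restrict g (graph D \<inter> disk - vertices D)"
  have agv: "p \<in> graph D \<longleftrightarrow> p \<in> graph D'" "p \<in> vertices D \<longleftrightarrow> p \<in> vertices D'" if "p \<notin> open_disk" for p
    using agree_on_outside[OF out order_refl] agree_on_vertices[OF agree_on_outside[OF out order_refl], of p] that
    by (auto simp: agree_on_def)
  have gL: "?gL \<in> point_labelings X up dn ?L" by (rule restrict_point_labeling_to_disk[OF g v])
  have gLeq: "?gL p = g p" if "p \<in> graph D \<inter> disk - open_disk" for p
    using that v by auto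
  have ex1: "\<exists>!h. h \<in> point_labelings X up dn ?R \<and> (\<forall>p \<in> graph ?L - open_disk. h p = ?gL p)"
    using bspec[OF ext[unfolded extends_labelings_def] gL] .
  then obtain h where h: "h \<in> point_labelings X up dn ?R" "\<forall>p \<in> graph ?L - open_disk. h p = ?gL p"
    by blast
  let ?f = "restrict (\<lambda>p. if p \<in> disk then h p else g p) (graph D' - vertices D')"
  have heq: "h p = g p" if "p \<in> graph D' \<inter> disk - open_disk" for p
    using h(2) gLeq[of p] agv[of p] that by simp
  have f: "?f \<in> point_labelings X up dn D'"
    by (rule glue_point_labelings[OF g h(1) out v' heq])
  have feq: "?f p = g p" if p: "p \<in> graph D - open_disk" for p
  proof (cases "p \<in> vertices D'")
    case True
    then have "p \<in> vertices D" using agv p by simp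
    then show ?thesis using True point_labelingsD(2)[OF g] by simp
  next
    case False
    then show ?thesis using heq[of p] p agv[of p] by auto
  qed
  show ?thesis
  proof (rule ex1I[of _ ?f])
    show "?f \<in> point_labelings X up dn D' \<and> (\<forall>p \<in> graph D - open_disk. ?f p = g p)"
      using f feq by blast
    fix g' assume g': "g' \<in> point_labelings X up dn D' \<and> (\<forall>p \<in> graph D - open_disk. g' p = g p)"
    let ?gR = "restrict g' (graph D' \<inter> disk - vertices D')"
    have "?gR \<in> point_labelings X up dn ?R"
      by (rule restrict_point_labeling_to_disk[OF conjunct1[OF g'] v'])
    moreover have "\<forall>p \<in> graph ?L - open_disk. ?gR p = ?gL p"
    proof
      fix p assume p: "p \<in> graph ?L - open_disk"
      then have "p \<notin> vertices D'" "p \<in> graph D'" using agv[of p] v by auto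
      then have "?gR p = g' p" using p by simp
      also have "g' p = g p" using g' p by simp
      also have "g p = ?gL p" using gLeq[of p] p by simp
      finally show "?gR p = ?gL p" .
    qed
    ultimately have gR: "?gR = h" using ex1 h by blast
    show "g' = ?f"
    proof (rule point_labelings_eqI[OF conjunct1[OF g'] f])
      fix p assume p: "p \<in> graph D' - vertices D'"
      show "g' p = ?f p"
      proof (cases "p \<in> disk")
        case True
        then show ?thesis using fun_cong[OF gR, of p] p by simp
      next
        case False
        then have "p \<notin> open_disk" using open_disk_subset by blast
        then show ?thesis using g' agv p False by simp
      qed
    qed
  qed
qed

text \<open>This is the invariant of an induction over the generation of the local moves. It is symmetric
  because moves are inverted, and it quantifies over all bikei structures on \<open>X\<close> because switching the crossings
  amounts to interchanging the two operations.\<close>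

definition labeling_preserving :: "'a set \<Rightarrow> diagram \<Rightarrow> diagram \<Rightarrow> bool" where
  "labeling_preserving X L R \<longleftrightarrow> local_diagram L \<and> local_diagram R \<and>
     graph L - open_disk = graph R - open_disk \<and>
     (\<forall>up dn. bikei X up dn \<longrightarrow> extends_labelings X up dn L R \<and> extends_labelings X up dn R L)"

lemma labeling_preservingD:
  assumes "labeling_preserving X L R"
  shows "local_diagram L" "local_diagram R" "graph L - open_disk = graph R - open_disk"
    "bikei X up dn \<Longrightarrow> extends_labelings X up dn L R" "bikei X up dn \<Longrightarrow> extends_labelings X up dn R L"
proof -
  note a = assms[unfolded labeling_preserving_def]
  show "local_diagram L" by (rule conjunct1[OF a])
  show "local_diagram R" by (rule conjunct1[OF conjunct2[OF a]])
  show "graph L - open_disk = graph R - open_disk" by (rule conjunct1[OF conjunct2[OF conjunct2[OF a]]])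
  note b = conjunct2[OF conjunct2[OF conjunct2[OF a]]]
  show "bikei X up dn \<Longrightarrow> extends_labelings X up dn L R"
    by (rule conjunct1[OF mp[OF spec[OF spec[OF b]]]])
  show "bikei X up dn \<Longrightarrow> extends_labelings X up dn R L"
    by (rule conjunct2[OF mp[OF spec[OF spec[OF b]]]])
qed

lemma card_point_labelings_labeling_preserving:
  assumes lp: "labeling_preserving X (restrict_to disk D) (restrict_to disk D')" and b: "bikei X up dn"
    and out: "restrict_to (- open_disk) D = restrict_to (- open_disk) D'"
  shows "card (point_labelings X up dn D) = card (point_labelings X up dn D')"
proof (rule card_eq_by_relation[where R = "\<lambda>g g'. \<forall>p \<in> graph D - open_disk. g' p = g p"])
  have v: "vertices D \<inter> disk \<subseteq> open_disk" "vertices D' \<inter> disk \<subseteq> open_disk"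
    using labeling_preservingD(1,2)[OF lp] by (auto simp: local_diagram_def)
  show "\<exists>!g'. g' \<in> point_labelings X up dn D' \<and> (\<forall>p \<in> graph D - open_disk. g' p = g p)"
    if "g \<in> point_labelings X up dn D" for g
    by (rule unique_extension_from_disk[OF labeling_preservingD(4)[OF lp b] out v that])
  have gr: "graph D - open_disk = graph D' - open_disk"
    using agree_on_outside[OF out order_refl] unfolding agree_on_def by blast
  show "\<exists>!g. g \<in> point_labelings X up dn D \<and> (\<forall>p \<in> graph D - open_disk. g' p = g p)"
    if "g' \<in> point_labelings X up dn D'" for g'
    using unique_extension_from_disk[OF labeling_preservingD(5)[OF lp b] out[symmetric] v(2,1) that]
    unfolding gr by (simp only: eq_commute)
qed

lemma labeling_preservingI:
  assumes "local_diagram L" "local_diagram R" "graph L - open_disk = graph R - open_disk"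
    "\<And>up dn. bikei X up dn \<Longrightarrow> extends_labelings X up dn L R"
    "\<And>up dn. bikei X up dn \<Longrightarrow> extends_labelings X up dn R L"
  shows "labeling_preserving X L R"
  unfolding labeling_preserving_def
  by (intro conjI allI impI assms; assumption)

lemma labeling_preserving_sym:
  assumes "labeling_preserving X L R" shows "labeling_preserving X R L"
  by (rule labeling_preservingI) (fact labeling_preservingD[OF assms] labeling_preservingD(3)[OF assms, symmetric])+

lemma homeomorphism_cnj: "homeomorphism UNIV UNIV cnj cnj"
  by (rule homeomorphismI) (auto intro: continuous_intros)

lemma cnj_open_disk: "cnj p \<in> open_disk \<longleftrightarrow> p \<in> open_disk"
  by (auto simp: open_disk_def in_box_complex_iff)

lemma local_diagram_cnj:
  assumes "local_diagram L" shows "local_diagram (transport cnj L)"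
  using assms transport_mem[OF homeomorphism_cnj, of _ L] cnj_open_disk
  unfolding local_diagram_def subset_iff set_eq_iff by (metis empty_iff)

lemma extends_labelings_cnj:
  assumes ext: "extends_labelings X up dn L R" and gr: "graph L - open_disk = graph R - open_disk"
    and L: "local_diagram L" and R: "local_diagram R"
  shows "extends_labelings X up dn (transport cnj L) (transport cnj R)"
  unfolding extends_labelings_def
proof
  let ?L = "transport cnj L" and ?R = "transport cnj R"
  note mem = transport_mem[OF homeomorphism_cnj]
  have vo: "p \<notin> vertices L" "p \<notin> vertices R" if "p \<notin> open_disk" for p
    using L R that by (auto simp: local_diagram_def)
  have gro: "p \<in> graph L \<longleftrightarrow> p \<in> graph R" if "p \<notin> open_disk" for p using gr that by blast
  fix g assume g: "g \<in> point_labelings X up dn ?L"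
  let ?gL = "restrict (\<lambda>p. g (cnj p)) (graph L - vertices L)"
  have gL: "?gL \<in> point_labelings X up dn L" by (rule point_labeling_transport_back[OF homeomorphism_cnj g])
  have ex1: "\<exists>!h. h \<in> point_labelings X up dn R \<and> (\<forall>p \<in> graph L - open_disk. h p = ?gL p)"
    using bspec[OF ext[unfolded extends_labelings_def] gL] .
  then obtain h where h: "h \<in> point_labelings X up dn R" "\<forall>p \<in> graph L - open_disk. h p = ?gL p"
    by blast
  let ?f = "restrict (\<lambda>p. h (cnj p)) (graph ?R - vertices ?R)"
  show "\<exists>!g'. g' \<in> point_labelings X up dn ?R \<and> (\<forall>p \<in> graph ?L - open_disk. g' p = g p)"
  proof (rule ex1I[of _ ?f], intro conjI ballI)
    show "?f \<in> point_labelings X up dn ?R" by (rule point_labeling_transport[OF homeomorphism_cnj h(1)])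
    show "?f p = g p" if p: "p \<in> graph ?L - open_disk" for p
    proof -
      have "cnj p \<notin> open_disk" "cnj p \<in> graph L" using p mem cnj_open_disk by auto
      then show ?thesis using h(2) vo[of "cnj p"] gro[of "cnj p"] mem by simp
    qed
    fix g' assume g': "g' \<in> point_labelings X up dn ?R \<and> (\<forall>p \<in> graph ?L - open_disk. g' p = g p)"
    let ?gR = "restrict (\<lambda>p. g' (cnj p)) (graph R - vertices R)"
    have "?gR \<in> point_labelings X up dn R"
      by (rule point_labeling_transport_back[OF homeomorphism_cnj conjunct1[OF g']])
    moreover have "\<forall>p \<in> graph L - open_disk. ?gR p = ?gL p"
    proof
      fix p assume p: "p \<in> graph L - open_disk"
      then have "g' (cnj p) = g (cnj p)" using g' mem cnj_open_disk by simp
      then show "?gR p = ?gL p" using p vo[of p] gro[of p] by simp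
    qed
    ultimately have "?gR = h" using ex1 h by blast
    then have e: "h q = ?gR q" for q by simp
    show "g' = ?f"
    proof (rule point_labelings_eqI[OF conjunct1[OF g'] point_labeling_transport[OF homeomorphism_cnj h(1)]])
      fix p assume "p \<in> graph ?R - vertices ?R"
      then show "g' p = ?f p" using e[of "cnj p"] mem by simp
    qed
  qed
qed

lemma labeling_preserving_cnj:
  assumes lp: "labeling_preserving X L R"
  shows "labeling_preserving X (transport cnj L) (transport cnj R)"
proof -
  note l = labeling_preservingD[OF lp]
  have "graph (transport cnj L) - open_disk = graph (transport cnj R) - open_disk"
    using l(3) transport_mem(1)[OF homeomorphism_cnj] cnj_open_disk
    unfolding set_eq_iff Diff_iff by metis
  then show ?thesis
    by (intro labeling_preservingI local_diagram_cnj[OF l(1)] local_diagram_cnj[OF l(2)]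
      extends_labelings_cnj[OF l(4) l(3) l(1,2)] extends_labelings_cnj[OF l(5) l(3)[symmetric] l(2,1)])
qed

text \<open>The first and third exchange laws are interchanged, and the second one is mapped to itself up to
  renaming variables.\<close>

lemma bikei_swap:
  assumes "bikei X up dn" shows "bikei X dn up"
proof -
  interpret b: bikei X up dn by (rule assms)
  have sw: "bij_betw prod.swap (X \<times> X) (X \<times> X)"
    by (rule bij_betwI[where g = prod.swap]) auto
  have "bij_betw (prod.swap \<circ> (\<lambda>(x, y). (dn y x, up x y)) \<circ> prod.swap) (X \<times> X) (X \<times> X)"
    using bij_betw_trans[OF bij_betw_trans[OF sw b.S_bij] sw] by (simp add: comp_assoc)
  moreover have "prod.swap \<circ> (\<lambda>(x, y). (dn y x, up x y)) \<circ> prod.swap = (\<lambda>(x, y). (up y x, dn x y))"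
    by auto
  ultimately have S: "bij_betw (\<lambda>(x, y). (up y x, dn x y)) (X \<times> X) (X \<times> X)" by simp
  show ?thesis
  proof unfold_locales
    show "bij_betw (\<lambda>(x, y). (up y x, dn x y)) (X \<times> X) (X \<times> X)" by (rule S)
  qed (use b.diagonal b.alpha_bij b.beta_bij b.exchange1 b.exchange2 b.exchange3 b.up_invol
        b.dn_invol b.up_dn b.dn_up in auto)
qed

lemma switch_simps [simp]:
  "graph (switch_crossings L) = graph L" "vertices (switch_crossings L) = vertices L"
  "classical (switch_crossings L) = classical L" "saddle (switch_crossings L) = saddle L"
  "virtual (switch_crossings L) = virtual L"
  "over (switch_crossings L) = (graph L - over L) \<union> classical L"
  by (auto simp: switch_crossings_def vertices_def)

lemma classical_in_graph: "local_diagram L \<Longrightarrow> classical L \<subseteq> graph L"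
  by (auto simp: local_diagram_def)

lemma switch_switch:
  assumes "local_diagram L" shows "switch_crossings (switch_crossings L) = L"
proof -
  have "(graph L - ((graph L - over L) \<union> classical L)) \<union> classical L = over L"
    using assms by (auto simp: local_diagram_def)
  then show ?thesis by (cases L) (simp add: switch_crossings_def)
qed

lemma local_diagram_switch: "local_diagram L \<Longrightarrow> local_diagram (switch_crossings L)"
  using classical_in_graph[of L] by (auto simp: local_diagram_def)

lemma crossing_chart_switch: "crossing_chart (switch_crossings L) \<phi> \<longleftrightarrow> crossing_chart L \<phi>"
  by (simp add: crossing_chart_def)

lemma virtual_chart_switch: "virtual_chart (switch_crossings L) \<phi> \<longleftrightarrow> virtual_chart L \<phi>"
  by (simp add: virtual_chart_def crossing_chart_switch)

text \<open>A quarter turn of the chart puts the new over-strand on the real axis.\<close>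

lemma classical_chart_switch:
  assumes L: "local_diagram L" and c: "classical_chart L \<phi>"
  shows "classical_chart (switch_crossings L) (\<lambda>z. \<phi> (\<i> * z))"
proof -
  have cc: "crossing_chart L \<phi>" "\<phi> 0 \<in> classical L" and ov: "\<And>z. z \<in> cball 0 1 \<Longrightarrow> \<phi> z \<in> over L \<longleftrightarrow> Im z = 0"
    using c by (auto simp: classical_chart_iff)
  have "\<phi> (\<i> * z) \<in> (graph L - over L) \<union> classical L \<longleftrightarrow> Im z = 0" if z: "z \<in> cball 0 1" for z
  proof -
    have z': "\<i> * z \<in> cball 0 1" using z by (simp add: norm_mult)
    have cl: "\<phi> (\<i> * z) \<in> classical L \<longleftrightarrow> z = 0"
      using crossing_chartD(4)[OF cc(1) z'] cc(2) by (auto simp: vertices_def)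
    show ?thesis
      using cl crossing_chartD(3)[OF cc(1) z'] ov[OF z'] by (auto simp: axes_def complex_eq_iff)
  qed
  then show ?thesis
    using cc crossing_chart_rotate[OF cc(1)] by (simp add: classical_chart_iff crossing_chart_switch)
qed

lemma point_labelings_switch_subset:
  assumes L: "local_diagram L"
  shows "point_labelings X up dn L \<subseteq> point_labelings X dn up (switch_crossings L)"
proof
  let ?S = "switch_crossings L"
  fix g assume g: "g \<in> point_labelings X up dn L"
  have "rules_at dn up ?S g v" if v: "v \<in> vertices L" for v
  proof (rule rules_atI)
    note r = point_labelingsD(4)[OF g v]
    fix \<phi> :: "complex \<Rightarrow> complex" assume \<phi>: "\<phi> 0 = v"
    show "g (\<phi> 1) = g (\<phi> (-1))" if "virtual_chart ?S \<phi>"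
      by (rule rules_atD(1)[where \<phi> = \<phi>, OF r \<phi>]) (use that virtual_chart_switch in simp)
    show "g (\<phi> u) = g (\<phi> 1)" if "crossing_chart ?S \<phi>" "v \<in> saddle ?S" "u \<in> units" for u
      by (rule rules_atD(3)[where \<phi> = \<phi>, OF r \<phi>]) (use that crossing_chart_switch in simp_all)
    show "crossing_rule dn up (\<lambda>u. g (\<phi> u))" if c: "classical_chart ?S \<phi>"
    proof -
      have c': "classical_chart L (\<lambda>z. \<phi> (\<i> * z))"
        using classical_chart_switch[OF local_diagram_switch[OF L] c] switch_switch[OF L] by simp
      have rule: "crossing_rule up dn (\<lambda>u. g (\<phi> (\<i> * u)))"
        by (rule rules_atD(2)[OF r _ c']) (simp add: \<phi>)
      show ?thesis unfolding crossing_rule_def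
      proof (intro ballI)
        fix u w :: complex assume u: "u \<in> {\<i>, -\<i>}" and w: "w \<in> {1, -1}"
        have m: "-(\<i> * w) \<in> {\<i>, -\<i>}" "-(\<i> * u) \<in> {1, -1}" using u w by auto
        have e: "\<i> * (- (\<i> * w)) = w" "\<i> * (- (\<i> * u)) = u" "\<i> * (- (- (\<i> * w))) = - w"
          "\<i> * (- (- (\<i> * u))) = - u" by simp_all
        show "g (\<phi> (-u)) = dn (g (\<phi> u)) (g (\<phi> w)) \<and> g (\<phi> (-w)) = up (g (\<phi> w)) (g (\<phi> u))"
          using bspec[OF bspec[OF rule[unfolded crossing_rule_def] m(1)] m(2)]
          unfolding e by (rule conj_commute[THEN iffD1])
      qed
    qed
  qed
  then show "g \<in> point_labelings X dn up ?S"
    using g unfolding point_labelings_def by simp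
qed

lemma point_labelings_switch:
  assumes L: "local_diagram L"
  shows "point_labelings X up dn (switch_crossings L) = point_labelings X dn up L"
  using point_labelings_switch_subset[OF L, of X dn up]
    point_labelings_switch_subset[OF local_diagram_switch[OF L], of X up dn] switch_switch[OF L] by simp

lemma labeling_preserving_switch:
  assumes lp: "labeling_preserving X L R"
  shows "labeling_preserving X (switch_crossings L) (switch_crossings R)"
proof -
  note l = labeling_preservingD[OF lp]
  have sw: "extends_labelings X up dn (switch_crossings L) (switch_crossings R) = extends_labelings X dn up L R"
    "extends_labelings X up dn (switch_crossings R) (switch_crossings L) = extends_labelings X dn up R L" for up dn
    unfolding extends_labelings_def switch_simps
      point_labelings_switch[OF l(1)] point_labelings_switch[OF l(2)] by (rule refl)+
  show ?thesis
  proof (rule labeling_preservingI)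
    fix up dn assume b: "bikei X up dn"
    show "extends_labelings X up dn (switch_crossings L) (switch_crossings R)"
      unfolding sw by (rule l(4)[OF bikei_swap[OF b]])
    show "extends_labelings X up dn (switch_crossings R) (switch_crossings L)"
      unfolding sw by (rule l(5)[OF bikei_swap[OF b]])
  qed (use local_diagram_switch[OF l(1)] local_diagram_switch[OF l(2)] l(3) in simp_all)
qed

lemma exchange_simps [simp]:
  "graph (exchange_smoothings L) = graph L" "vertices (exchange_smoothings L) = vertices L"
  "classical (exchange_smoothings L) = classical L" "saddle (exchange_smoothings L) = saddle L"
  "virtual (exchange_smoothings L) = virtual L" "over (exchange_smoothings L) = over L"
  by (auto simp: exchange_smoothings_def vertices_def)

lemma point_labelings_exchange: "point_labelings X up dn (exchange_smoothings L) = point_labelings X up dn L"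
  by (simp add: point_labelings_def rules_at_def classical_chart_def virtual_chart_def crossing_chart_def)

lemma labeling_preserving_exchange:
  assumes lp: "labeling_preserving X L R"
  shows "labeling_preserving X (exchange_smoothings L) (exchange_smoothings R)"
proof -
  note l = labeling_preservingD[OF lp]
  have e: "extends_labelings X up dn (exchange_smoothings A) (exchange_smoothings B) = extends_labelings X up dn A B"
    for up dn A B
    unfolding extends_labelings_def exchange_simps point_labelings_exchange by (rule refl)
  have "local_diagram (exchange_smoothings A) = local_diagram A" for A
    by (simp add: local_diagram_def)
  then show ?thesis using l(1-3) by (intro labeling_preservingI) (simp_all add: e l(4,5))
qed

section \<open>Segments and polygonal lines with integer corners\<close>

type_synonym ipoint = "int \<times> int"
type_synonym vertex_data = "ipoint \<times> ipoint \<times> ipoint \<times> nat \<times> nat \<times> nat \<times> nat"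

text \<open>All corners, vertices and directions in the pictures have coordinates in multiples of one
  quarter. In units of one quarter they are integers, and the position of segments relative to each other becomes a
  matter of signs of integer determinants and scalar products, which can be computed.\<close>

definition quarter :: "ipoint \<Rightarrow> real \<times> real" where
  "quarter p = (real_of_int (fst p) / 4, real_of_int (snd p) / 4)"

definition cpt :: "ipoint \<Rightarrow> complex" where
  "cpt p = pt (quarter p)"

lemma cpt_simps: "Re (cpt p) = real_of_int (fst p) / 4" "Im (cpt p) = real_of_int (snd p) / 4"
  by (simp_all add: cpt_def pt_def quarter_def)

definition iadd :: "ipoint \<Rightarrow> ipoint \<Rightarrow> ipoint" where "iadd p q = (fst p + fst q, snd p + snd q)"
definition isub :: "ipoint \<Rightarrow> ipoint \<Rightarrow> ipoint" where "isub p q = (fst p - fst q, snd p - snd q)"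
definition ineg :: "ipoint \<Rightarrow> ipoint" where "ineg p = (- fst p, - snd p)"
definition icross :: "ipoint \<Rightarrow> ipoint \<Rightarrow> int" where "icross p q = fst p * snd q - snd p * fst q"
definition idot :: "ipoint \<Rightarrow> ipoint \<Rightarrow> int" where "idot p q = fst p * fst q + snd p * snd q"

lemma cpt_arith: "cpt (iadd p q) = cpt p + cpt q" "cpt (isub p q) = cpt p - cpt q" "cpt (ineg p) = - cpt p"
  by (auto simp: complex_eq_iff cpt_simps iadd_def isub_def ineg_def field_simps)

lemma cpt_inj: "cpt p = cpt q \<longleftrightarrow> p = q"
  by (auto simp: complex_eq_iff cpt_simps prod_eq_iff)

lemma cross_dot_cpt:
  "real_of_int (icross p q) = 16 * (Re (cpt p) * Im (cpt q) - Im (cpt p) * Re (cpt q))"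
  "real_of_int (idot p q) = 16 * (Re (cpt p) * Re (cpt q) + Im (cpt p) * Im (cpt q))"
  by (simp_all add: icross_def idot_def cpt_simps)

abbreviation iseg :: "ipoint \<times> ipoint \<Rightarrow> complex set" where
  "iseg s \<equiv> closed_segment (cpt (fst s)) (cpt (snd s))"

definition separates :: "ipoint \<Rightarrow> ipoint \<times> ipoint \<Rightarrow> ipoint \<times> ipoint \<Rightarrow> bool" where
  "separates n s t \<longleftrightarrow> idot n (fst s) < idot n (fst t) \<and> idot n (fst s) < idot n (snd t) \<and>
     idot n (snd s) < idot n (fst t) \<and> idot n (snd s) < idot n (snd t)"

definition normal :: "ipoint \<times> ipoint \<Rightarrow> ipoint" where
  "normal s = (snd (fst s) - snd (snd s), fst (snd s) - fst (fst s))"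

text \<open>Disjoint segments are separated by a line parallel to one of them, or else their bounding boxes
  are disjoint; the eight functionals test for both.\<close>

definition apart :: "ipoint \<times> ipoint \<Rightarrow> ipoint \<times> ipoint \<Rightarrow> bool" where
  "apart s t \<longleftrightarrow> list_ex (\<lambda>n. separates n s t) [(1,0), (-1,0), (0,1), (0,-1), normal s, ineg (normal s),
     normal t, ineg (normal t)]"

lemma separates_disjoint:
  assumes "separates n s t" shows "iseg s \<inter> iseg t = {}"
proof -
  define f where "f z = Re (cpt n) * Re z + Im (cpt n) * Im z" for z
  have f: "real_of_int (idot n p) = 16 * f (cpt p)" for p by (simp add: f_def cross_dot_cpt)
  define c where "c = max (f (cpt (fst s))) (f (cpt (snd s)))"
  have lin: "f ((1 - u) *\<^sub>R x + u *\<^sub>R y) = (1 - u) * f x + u * f y" for u x y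
    by (simp add: f_def algebra_simps)
  have le: "f z \<le> c" if z: "z \<in> iseg s" for z
  proof -
    obtain u where u: "0 \<le> u" "u \<le> 1" "z = (1 - u) *\<^sub>R cpt (fst s) + u *\<^sub>R cpt (snd s)"
      using z by (auto simp: closed_segment_def)
    have "(1 - u) * f (cpt (fst s)) + u * f (cpt (snd s)) \<le> (1 - u) * c + u * c"
      by (intro add_mono mult_left_mono) (use u in \<open>auto simp: c_def\<close>)
    also have "\<dots> = c" by (simp add: algebra_simps)
    finally show ?thesis by (simp only: u(3) lin)
  qed
  have "real_of_int (idot n (fst s)) < real_of_int (idot n (fst t))" "real_of_int (idot n (fst s)) < real_of_int (idot n (snd t))"
    "real_of_int (idot n (snd s)) < real_of_int (idot n (fst t))" "real_of_int (idot n (snd s)) < real_of_int (idot n (snd t))"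
    using assms by (simp_all add: separates_def)
  then have ct: "c < f (cpt (fst t))" "c < f (cpt (snd t))" by (simp_all add: f c_def)
  have gt: "c < f z" if z: "z \<in> iseg t" for z
  proof -
    obtain u where u: "0 \<le> u" "u \<le> 1" "z = (1 - u) *\<^sub>R cpt (fst t) + u *\<^sub>R cpt (snd t)"
      using z by (auto simp: closed_segment_def)
    define m where "m = min (f (cpt (fst t))) (f (cpt (snd t)))"
    have "(1 - u) * m + u * m \<le> (1 - u) * f (cpt (fst t)) + u * f (cpt (snd t))"
      by (intro add_mono mult_left_mono) (use u in \<open>auto simp: m_def\<close>)
    moreover have "(1 - u) * m + u * m = m" by (simp add: algebra_simps)
    ultimately have "m \<le> f z" by (simp only: u(3) lin)
    moreover have "c < m" using ct by (simp add: m_def)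
    ultimately show ?thesis by simp
  qed
  show ?thesis using le gt by force
qed

lemma apart_disjoint: "apart s t \<Longrightarrow> iseg s \<inter> iseg t = {}"
  using separates_disjoint unfolding apart_def list_ex_iff by blast

text \<open>The rays spanned by the two vectors meet in the origin only.\<close>

definition distinct_rays :: "ipoint \<Rightarrow> ipoint \<Rightarrow> bool" where
  "distinct_rays a b \<longleftrightarrow> icross a b \<noteq> 0 \<or> idot a b < 0"

lemma distinct_rays_segments:
  assumes "distinct_rays (isub q p) (isub s p)"
  shows "iseg (p, q) \<inter> iseg (p, s) \<subseteq> {cpt p}"
proof
  fix x assume "x \<in> iseg (p, q) \<inter> iseg (p, s)"
  then obtain u w where u: "0 \<le> u" "x = (1 - u) *\<^sub>R cpt p + u *\<^sub>R cpt q"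
    and w: "0 \<le> w" "x = (1 - w) *\<^sub>R cpt p + w *\<^sub>R cpt s"
    by (auto simp: closed_segment_def)
  define a where "a = cpt q - cpt p" define b where "b = cpt s - cpt p"
  have xa: "x = cpt p + u *\<^sub>R a" using u(2) by (simp add: a_def algebra_simps)
  have xb: "x = cpt p + w *\<^sub>R b" using w(2) by (simp add: b_def algebra_simps)
  from xa xb have "u *\<^sub>R a = w *\<^sub>R b" by simp
  then have re: "u * Re a = w * Re b" and im: "u * Im a = w * Im b" by (auto simp: complex_eq_iff)
  have "u = 0"
  proof -
    consider "icross (isub q p) (isub s p) \<noteq> 0" | "idot (isub q p) (isub s p) < 0"
      using assms by (auto simp: distinct_rays_def)
    then show ?thesis
    proof cases
      case 1
      then have "Re a * Im b - Im a * Re b \<noteq> 0"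
        using cross_dot_cpt(1)[of "isub q p" "isub s p"] by (auto simp: cpt_arith a_def b_def)
      moreover have "u * (Re a * Im b - Im a * Re b) = 0"
        using re im by algebra
      ultimately show ?thesis by simp
    next
      case 2
      then have neg: "Re a * Re b + Im a * Im b < 0"
      proof -
        have "real_of_int (idot (isub q p) (isub s p)) < 0" using 2 by simp
        then show ?thesis by (simp add: cross_dot_cpt cpt_arith a_def b_def)
      qed
      have e: "u * (Re a * Re a + Im a * Im a) = w * (Re a * Re b + Im a * Im b)"
        using re im by algebra
      have "w * (Re a * Re b + Im a * Im b) \<le> 0" using w(1) neg by (simp add: mult_nonneg_nonpos)
      moreover have "Re a * Re a + Im a * Im a > 0"
        using neg unfolding sum_squares_gt_zero_iff by auto
      ultimately have "u \<le> 0" using e by (metis mult_pos_pos not_le)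
      then show ?thesis using u(1) by simp
    qed
  qed
  then show "x \<in> {cpt p}" using xa by simp
qed

definition segs :: "ipoint list \<Rightarrow> (ipoint \<times> ipoint) list" where
  "segs e = zip e (tl e)"

definition ipoly :: "ipoint list \<Rightarrow> complex set" where
  "ipoly e = polyline (map quarter e)"

lemma segs_simps [simp]: "segs (p # q # ps) = (p, q) # segs (q # ps)" "segs [p] = []" "segs [] = []"
  by (auto simp: segs_def)

lemma ipoly_simps [simp]: "ipoly (p # q # ps) = iseg (p, q) \<union> ipoly (q # ps)" "ipoly [p] = {}" "ipoly [] = {}"
  by (auto simp: ipoly_def cpt_def)

lemma ipoly_segs: "ipoly e = (\<Union>s \<in> set (segs e). iseg s)"
proof (induction e)
  case (Cons p e)
  then show ?case by (cases e) auto
qed simp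

text \<open>The second list traces the same polygonal line as the first one, with extra points inserted.
  Cutting a strand at its vertices requires such points, since strands are drawn straight through vertices.\<close>

fun subdivides :: "ipoint list \<Rightarrow> ipoint list \<Rightarrow> bool" where
  "subdivides (p # q # ps) (p' # r # rs) \<longleftrightarrow> p = p' \<and> (if r = q then subdivides (q # ps) (r # rs)
     else icross (isub r p) (isub q p) = 0 \<and> idot (isub r p) (isub q r) \<ge> 0 \<and> subdivides (r # q # ps) (r # rs))"
| "subdivides [p] [p'] \<longleftrightarrow> p = p'"
| "subdivides _ _ \<longleftrightarrow> False"

text \<open>A point of a line lies between two others if it sees them in opposite directions.\<close>

lemma between_cpt:
  assumes "icross (isub r p) (isub q p) = 0" "idot (isub r p) (isub q r) \<ge> 0" "p \<noteq> q"
  shows "cpt r \<in> closed_segment (cpt p) (cpt q)"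
proof -
  define a where "a = cpt r - cpt p" define d where "d = cpt q - cpt p"
  have cr: "Re a * Im d = Im a * Re d"
    using assms(1) cross_dot_cpt(1)[of "isub r p" "isub q p"] by (simp add: cpt_arith a_def d_def)
  have dt: "Re a * (Re d - Re a) + Im a * (Im d - Im a) \<ge> 0"
  proof -
    have "real_of_int (idot (isub r p) (isub q r)) \<ge> 0" using assms(2) by simp
    then show ?thesis by (simp add: cross_dot_cpt cpt_arith a_def d_def)
  qed
  define N where "N = Re d * Re d + Im d * Im d"
  have "d \<noteq> 0" using assms(3) cpt_inj[of q p] by (simp add: d_def)
  then have N: "N > 0" unfolding N_def sum_squares_gt_zero_iff by (auto simp: complex_eq_iff)
  define u where "u = (Re a * Re d + Im a * Im d) / N"
  have "u * N = Re a * Re d + Im a * Im d" using N by (simp add: u_def)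
  then have "(u * Re d - Re a) * N = 0" "(u * Im d - Im a) * N = 0"
    unfolding N_def using cr by algebra+
  then have ua: "Re a = u * Re d" "Im a = u * Im d" using N by auto
  have "(u * (1 - u)) * N = Re a * (Re d - Re a) + Im a * (Im d - Im a)"
    unfolding ua N_def by (simp add: algebra_simps)
  then have "0 \<le> u * (1 - u)" using dt N by (metis mult_less_0_iff not_le)
  then have "0 \<le> u" "u \<le> 1" by (auto simp: zero_le_mult_iff)
  moreover have "cpt r = (1 - u) *\<^sub>R cpt p + u *\<^sub>R cpt q"
    using ua by (auto simp: complex_eq_iff a_def d_def algebra_simps)
  ultimately show ?thesis unfolding closed_segment_def by blast
qed

lemma subdivides_ipoly: "subdivides l m \<Longrightarrow> ipoly m = ipoly l"
proof (induction l m rule: subdivides.induct)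
  case (1 p q ps p' r rs)
  have pp: "p' = p" using "1.prems" by simp
  show ?case
  proof (cases "r = q")
    case True
    then show ?thesis using 1 by simp
  next
    case False
    then have c: "icross (isub r p) (isub q p) = 0" "idot (isub r p) (isub q r) \<ge> 0" "subdivides (r # q # ps) (r # rs)"
      using "1.prems" unfolding subdivides.simps(1) by (auto simp only: if_False False)
    have rest: "ipoly (r # rs) = iseg (r, q) \<union> ipoly (q # ps)" using "1.IH"(2)[OF False c(3)] by simp
    have "iseg (p, q) = iseg (p, r) \<union> iseg (r, q)"
    proof (cases "p = q")
      case True
      then have "idot (isub r p) (isub r p) \<le> 0" using c(2) by (simp add: idot_def isub_def algebra_simps)
      then have "r = p" by (simp add: idot_def isub_def prod_eq_iff sum_squares_le_zero_iff)
      then show ?thesis using True by simp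
    next
      case False
      show ?thesis using Un_closed_segment[OF between_cpt[OF c(1,2) False]] by simp
    qed
    then show ?thesis using rest pp by auto
  qed
qed auto

fun joined :: "ipoint list list \<Rightarrow> ipoint list" where
  "joined [] = []"
| "joined [e] = e"
| "joined (e # e' # es) = butlast e @ joined (e' # es)"

fun joinable :: "ipoint list list \<Rightarrow> bool" where
  "joinable (e # e' # es) \<longleftrightarrow> e \<noteq> [] \<and> e' \<noteq> [] \<and> last e = hd e' \<and> tl e' \<noteq> [] \<and> joinable (e' # es)"
| "joinable _ \<longleftrightarrow> True"

lemma ipoly_append:
  "e \<noteq> [] \<Longrightarrow> m \<noteq> [] \<Longrightarrow> last e = hd m \<Longrightarrow> ipoly (butlast e @ m) = ipoly e \<union> ipoly m"
proof (induction e)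
  case (Cons p e)
  show ?case
  proof (cases e)
    case Nil
    then show ?thesis using Cons.prems by simp
  next
    case (Cons q e')
    then have IH: "ipoly (butlast e @ m) = ipoly e \<union> ipoly m" using Cons.IH Cons.prems by simp
    show ?thesis
    proof (cases e')
      case Nil
      then show ?thesis using Cons Cons.prems IH by (cases m) auto
    next
      case c': (Cons r e'')
      then show ?thesis using Cons IH by auto
    qed
  qed
qed simp

lemma joined_hd: "joinable (e # es) \<Longrightarrow> e \<noteq> [] \<Longrightarrow> (es \<noteq> [] \<longrightarrow> tl e \<noteq> []) \<Longrightarrow> joined (e # es) \<noteq> [] \<and> hd (joined (e # es)) = hd e"
  by (cases es; cases e; cases "tl e") auto

lemma ipoly_joined: "joinable es \<Longrightarrow> ipoly (joined es) = (\<Union>e \<in> set es. ipoly e)"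
proof (induction es rule: joinable.induct)
  case (1 e e' es)
  then have j: "joinable (e' # es)" "e \<noteq> []" "e' \<noteq> []" "tl e' \<noteq> []" "last e = hd e'" by auto
  have "joined (e' # es) \<noteq> [] \<and> hd (joined (e' # es)) = hd e'" using joined_hd[OF j(1,3)] j(4) by simp
  then show ?case using "1.IH"[OF j(1)] ipoly_append[of e "joined (e' # es)"] j by simp
qed auto

text \<open>Each segment of the edge, deprived of the vertices among its end points, is connected, and consecutive
  segments share a point which is not a vertex.\<close>

lemma locally_const_on_edge:
  assumes g: "locally_const_on (G - V) g"
  shows "ipoly e \<subseteq> G \<Longrightarrow> \<forall>s \<in> set (segs e). V \<inter> iseg s \<subseteq> {cpt (fst s), cpt (snd s)} \<Longrightarrow>
    \<forall>p \<in> set (butlast (tl e)). cpt p \<notin> V \<Longrightarrow> \<exists>c. \<forall>x \<in> ipoly e - V. g x = c"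
proof (induction e)
  case (Cons p e)
  show ?case
  proof (cases e)
    case Nil
    then show ?thesis by simp
  next
    case (Cons q e')
    have sub: "iseg (p, q) \<subseteq> G" "ipoly e \<subseteq> G" using Cons.prems(1) Cons by auto
    have Vs: "V \<inter> iseg (p, q) \<subseteq> {cpt p, cpt q}" using Cons.prems(2) Cons by simp
    have con: "connected (iseg (p, q) - V)"
    proof (cases "p = q")
      case True
      then have "iseg (p, q) - V = {} \<or> iseg (p, q) - V = {cpt p}" by auto
      then show ?thesis by (metis connected_empty connected_sing)
    next
      case False
      then have "cpt p \<noteq> cpt q" by (simp add: cpt_inj)
      then have "closure (open_segment (cpt p) (cpt q)) = iseg (p, q)" by (simp add: closure_open_segment)
      moreover have "open_segment (cpt p) (cpt q) \<subseteq> iseg (p, q) - V"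
        using Vs by (auto simp: open_segment_def)
      ultimately show ?thesis
        using connected_intermediate_closure[of "open_segment (cpt p) (cpt q)" "iseg (p, q) - V"]
        by (simp add: convex_connected convex_open_segment)
    qed
    have seg: "g x = g y" if "x \<in> iseg (p, q) - V" "y \<in> iseg (p, q) - V" for x y
      by (rule locally_const_on_connected[OF g con _ that]) (use sub in blast)
    show ?thesis
    proof (cases e')
      case Nil
      then have "ipoly (p # e) = iseg (p, q)" using Cons by simp
      then show ?thesis using seg by (metis (no_types))
    next
      case c': (Cons r e'')
      have "\<forall>s \<in> set (segs e). V \<inter> iseg s \<subseteq> {cpt (fst s), cpt (snd s)}" "\<forall>p \<in> set (butlast (tl e)). cpt p \<notin> V"
        using Cons.prems(2,3) Cons c' by (auto split: if_splits)
      then obtain c where c: "\<forall>x \<in> ipoly e - V. g x = c" using Cons.IH[OF sub(2)] by blast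
      have qV: "cpt q \<notin> V" using Cons.prems(3) Cons c' by simp
      have "cpt q \<in> ipoly e" using Cons c' by simp
      then have gq: "g (cpt q) = c" using c qV by simp
      have "g x = c" if x: "x \<in> ipoly (p # e) - V" for x
      proof (cases "x \<in> ipoly e")
        case False
        then have "x \<in> iseg (p, q) - V" using x Cons by simp
        then show ?thesis using seg[of x "cpt q"] qV gq by simp
      qed (use c x in simp)
      then show ?thesis by blast
    qed
  qed
qed simp

section \<open>Pictures presented by their edges\<close>

definition in_open_disk :: "ipoint \<Rightarrow> bool" where
  "in_open_disk p \<longleftrightarrow> -16 < fst p \<and> fst p < 16 \<and> -16 < snd p \<and> snd p < 16"

definition in_disk :: "ipoint \<Rightarrow> bool" where
  "in_disk p \<longleftrightarrow> -16 \<le> fst p \<and> fst p \<le> 16 \<and> -16 \<le> snd p \<and> snd p \<le> 16"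

text \<open>A datum \<open>(p, a, b, j1, j2, j3, j4)\<close> describes a vertex \<open>p\<close> whose edges leave in the directions
  \<open>a, b, -a, -b\<close> and are the edges number \<open>j1, j2, j3, j4\<close> of the picture. At a classical crossing
  \<open>\<plusminus>a\<close> is the direction of the over-strand.\<close>

definition picture :: "ipoint list list \<Rightarrow> vertex_data list \<Rightarrow> vertex_data list \<Rightarrow> diagram" where
  "picture ls cs ss = tangle (map (map quarter) ls)
     (map (\<lambda>(p, a, b, js). (quarter p, quarter a)) cs)
     (map (\<lambda>(p, a, b, js). (quarter p, quarter a, quarter b)) ss)"

definition meets_at :: "ipoint list \<Rightarrow> ipoint \<times> ipoint \<Rightarrow> ipoint \<times> ipoint \<Rightarrow> bool" where
  "meets_at V s t \<longleftrightarrow>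
     fst s = fst t \<and> fst s \<in> set V \<and> distinct_rays (isub (snd s) (fst s)) (isub (snd t) (fst s)) \<or>
     fst s = snd t \<and> fst s \<in> set V \<and> distinct_rays (isub (snd s) (fst s)) (isub (fst t) (fst s)) \<or>
     snd s = fst t \<and> snd s \<in> set V \<and> distinct_rays (isub (fst s) (snd s)) (isub (snd t) (snd s)) \<or>
     snd s = snd t \<and> snd s \<in> set V \<and> distinct_rays (isub (fst s) (snd s)) (isub (fst t) (snd s))"

definition disjoint_edges :: "ipoint list \<Rightarrow> ipoint list \<Rightarrow> ipoint list \<Rightarrow> bool" where
  "disjoint_edges V e f \<longleftrightarrow> list_all (\<lambda>s. list_all (\<lambda>t. apart s t \<or> meets_at V s t) (segs f)) (segs e)"

definition edge_ok :: "ipoint list \<Rightarrow> ipoint list \<Rightarrow> bool" where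
  "edge_ok V e \<longleftrightarrow> segs e \<noteq> [] \<and>
     list_all (\<lambda>s. fst s \<noteq> snd s \<and> in_disk (fst s) \<and> in_disk (snd s) \<and> (in_open_disk (fst s) \<or> in_open_disk (snd s)) \<and>
       list_all (\<lambda>v. v = fst s \<or> v = snd s \<or> apart s (v, v)) V) (segs e) \<and>
     list_all (\<lambda>p. p \<notin> set V) (butlast (tl e))"

text \<open>The vector \<open>w\<close> is a multiple of \<open>d\<close> by a factor of at least one, so that a segment from \<open>p\<close> to
  \<open>p + w\<close> contains \<open>p + d\<close>.\<close>

definition along_dir :: "ipoint \<Rightarrow> ipoint \<Rightarrow> bool" where
  "along_dir w d \<longleftrightarrow> icross w d = 0 \<and> idot d d \<le> idot w d"

fun dirs :: "vertex_data \<Rightarrow> (ipoint \<times> nat) list" where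
  "dirs (p, a, b, j1, j2, j3, j4) = [(a, j1), (b, j2), (ineg a, j3), (ineg b, j4)]"

definition leaves :: "ipoint \<Rightarrow> ipoint \<Rightarrow> ipoint \<times> ipoint \<Rightarrow> bool" where
  "leaves p d s \<longleftrightarrow> fst s = p \<and> along_dir (isub (snd s) p) d \<or> snd s = p \<and> along_dir (isub (fst s) p) d"

text \<open>This is what makes a neighbourhood of the vertex a cross whose four arms lie on the edges announced
  in the vertex datum: the first list condition excludes further arms, the second one provides the four.\<close>

definition vertex_ok :: "ipoint list list \<Rightarrow> vertex_data \<Rightarrow> bool" where
  "vertex_ok es v \<longleftrightarrow> in_open_disk (fst v) \<and> icross (fst (snd v)) (fst (snd (snd v))) \<noteq> 0 \<and>
     list_all (\<lambda>e. list_all (\<lambda>s. fst s = fst v \<or> snd s = fst v \<longrightarrow>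
       list_ex (\<lambda>d. leaves (fst v) (fst d) s) (dirs v)) (segs e)) es \<and>
     list_all (\<lambda>d. snd d < length es \<and> list_ex (leaves (fst v) (fst d)) (segs (es ! snd d))) (dirs v)"

definition over_seg :: "vertex_data \<Rightarrow> ipoint \<times> ipoint" where
  "over_seg v = (isub (fst v) (fst (snd v)), iadd (fst v) (fst (snd v)))"

definition over_ok :: "vertex_data \<Rightarrow> vertex_data \<Rightarrow> bool" where
  "over_ok v w \<longleftrightarrow> apart (over_seg v) (fst w, fst w) \<and> apart (over_seg w) (fst v, fst v)"

text \<open>The edges \<open>concat ess\<close>, grouped by strands, are the pieces into which the strands \<open>ls\<close> are cut by the
  vertices; they meet in vertices only, and at each vertex they form a cross as the datum says.\<close>

definition valid_presentation where
  "valid_presentation ls ess cs ss \<longleftrightarrow> (let es = concat ess; V = map fst (cs @ ss) in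
     list_all2 (\<lambda>l es. joinable es \<and> subdivides l (joined es)) ls ess \<and>
     sorted_wrt (disjoint_edges V) es \<and> list_all (edge_ok V) es \<and> list_all (vertex_ok es) (cs @ ss) \<and>
     sorted_wrt over_ok cs \<and> distinct V)"

text \<open>One over-edge and one under-edge determine the other two edges at a classical crossing, so
  two equations per crossing suffice; the remaining ones follow in a bikei.\<close>

fun crossing_colored where
  "crossing_colored up dn lab (p, a, b, j1, j2, j3, j4) \<longleftrightarrow>
     lab j4 = up (lab j2) (lab j1) \<and> lab j3 = dn (lab j1) (lab j2)"

fun saddle_colored where
  "saddle_colored lab (p, a, b, j1, j2, j3, j4) \<longleftrightarrow> lab j2 = lab j1 \<and> lab j3 = lab j1 \<and> lab j4 = lab j1"

text \<open>The rule demands eight equations, one for each under-edge and each over-edge and each of the two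
  operations. By the bikei axioms a crossing may be read in all directions.\<close>

lemma (in bikei) crossing_rule_of_colored:
  assumes X: "h 1 \<in> X" "h \<i> \<in> X" and "h (-\<i>) = up (h \<i>) (h 1)" "h (-1) = dn (h 1) (h \<i>)"
  shows "crossing_rule up dn h"
proof -
  have 1: "up (h \<i>) (h (-1)) = h (-\<i>)" using up_dn[OF X(2,1)] assms by simp
  have 2: "up (h (-\<i>)) (h 1) = h \<i>" using up_invol[OF X(2,1)] assms by simp
  have 3: "dn (h 1) (h (-\<i>)) = h (-1)" using dn_up[OF X(2,1)] assms by simp
  have 4: "dn (h (-1)) (h \<i>) = h 1" using dn_invol[OF X] assms by simp
  have X': "h (-\<i>) \<in> X" "h (-1) \<in> X"
    using assms beta_bij[OF X(1)] alpha_bij[OF X(2)] X unfolding bij_betw_def by auto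
  have 5: "up (h (-\<i>)) (h (-1)) = h \<i>" using up_dn[OF X'(1) X(1)] 2 3 by simp
  have 6: "dn (h (-1)) (h (-\<i>)) = h 1" using dn_up[OF X(2) X'(2)] 1 4 by simp
  show ?thesis unfolding crossing_rule_def using assms(3,4) 1 2 3 4 5 6
    by (intro ballI) (elim insertE emptyE; simp only: minus_minus)
qed

lemma crossing_ruleD:
  assumes "crossing_rule up dn h"
  shows "h (-\<i>) = up (h \<i>) (h 1)" "h (-1) = dn (h 1) (h \<i>)"
  using bspec[OF bspec[OF assms[unfolded crossing_rule_def], of \<i>], of 1] by simp_all

lemma cpt_in_open_disk: "in_open_disk p \<longleftrightarrow> cpt p \<in> open_disk"
  by (auto simp: in_open_disk_def open_disk_def in_box_complex_iff cpt_simps)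

lemma cpt_in_disk: "in_disk p \<longleftrightarrow> cpt p \<in> disk"
  by (auto simp: in_disk_def disk_def in_cbox_complex_iff cpt_simps)

lemma along_dir_cpt:
  assumes "along_dir w d" "d \<noteq> (0, 0)"
  obtains c where "1 \<le> c" "cpt w = c *\<^sub>R cpt d"
proof -
  define N where "N = Re (cpt d) * Re (cpt d) + Im (cpt d) * Im (cpt d)"
  have N: "N > 0" unfolding N_def sum_squares_gt_zero_iff using assms(2) by (auto simp: cpt_simps prod_eq_iff)
  have "real_of_int (icross w d) = 0" "real_of_int (idot d d) \<le> real_of_int (idot w d)"
    using assms(1) by (simp_all add: along_dir_def)
  then have cr: "Re (cpt w) * Im (cpt d) = Im (cpt w) * Re (cpt d)"
    and dt: "N \<le> Re (cpt w) * Re (cpt d) + Im (cpt w) * Im (cpt d)"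
    by (simp_all add: cross_dot_cpt N_def)
  define c where "c = (Re (cpt w) * Re (cpt d) + Im (cpt w) * Im (cpt d)) / N"
  have cN: "c * N = Re (cpt w) * Re (cpt d) + Im (cpt w) * Im (cpt d)" using N by (simp add: c_def)
  then have "(c * Re (cpt d) - Re (cpt w)) * N = 0" "(c * Im (cpt d) - Im (cpt w)) * N = 0"
    unfolding N_def using cr by algebra+
  then have "cpt w = c *\<^sub>R cpt d" using N by (auto simp: complex_eq_iff)
  moreover have "1 \<le> c" using dt N by (simp add: c_def)
  ultimately show thesis using that by blast
qed

lemma leaves_cpt:
  assumes "leaves p d s" "d \<noteq> (0, 0)"
  obtains c where "1 \<le> c" "iseg s = closed_segment (cpt p) (cpt p + c *\<^sub>R cpt d)"
proof -
  obtain q where q: "along_dir (isub q p) d" "iseg s = closed_segment (cpt p) (cpt q)"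
    using assms(1) unfolding leaves_def by (metis closed_segment_commute)
  obtain c where c: "1 \<le> c" "cpt (isub q p) = c *\<^sub>R cpt d" by (rule along_dir_cpt[OF q(1) assms(2)])
  then have "cpt q = cpt p + c *\<^sub>R cpt d" by (simp add: cpt_arith algebra_simps)
  then show thesis using that[of c] c(1) q(2) by simp
qed

lemma segment_from:
  fixes v d :: complex
  assumes "1 \<le> c"
  shows "\<And>t. 0 \<le> t \<Longrightarrow> t \<le> 1 \<Longrightarrow> v + t *\<^sub>R d \<in> closed_segment v (v + c *\<^sub>R d)"
    "\<And>x. x \<in> closed_segment v (v + c *\<^sub>R d) \<Longrightarrow> \<exists>t\<ge>0. x = v + t *\<^sub>R d"
proof -
  show "v + t *\<^sub>R d \<in> closed_segment v (v + c *\<^sub>R d)" if "0 \<le> t" "t \<le> 1" for t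
    unfolding closed_segment_def using that assms
    by (intro CollectI exI[of _ "t / c"]) (auto simp: complex_eq_iff field_simps)
  show "\<exists>t\<ge>0. x = v + t *\<^sub>R d" if x: "x \<in> closed_segment v (v + c *\<^sub>R d)" for x
  proof -
    obtain u where "0 \<le> u" "x = (1 - u) *\<^sub>R v + u *\<^sub>R (v + c *\<^sub>R d)"
      using x by (auto simp: closed_segment_def)
    then show ?thesis using assms by (intro exI[of _ "u * c"]) (auto simp: algebra_simps)
  qed
qed

lemma Collect_fst_image: "{f p | p a. (p, a) \<in> F} = (\<lambda>z. f (fst z)) ` F"
proof (intro subset_antisym subsetI)
  fix x assume "x \<in> (\<lambda>z. f (fst z)) ` F"
  then obtain p a where "(p, a) \<in> F" "x = f p" by auto
  then show "x \<in> {f p | p a. (p, a) \<in> F}" by blast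
next
  fix x assume "x \<in> {f p | p a. (p, a) \<in> F}"
  then obtain p a where "(p, a) \<in> F" "x = f p" by blast
  then show "x \<in> (\<lambda>z. f (fst z)) ` F" by (intro image_eqI[of _ _ "(p, a)"]) simp_all
qed

lemma Collect_fst_image3: "{f p | p a b. (p, a, b) \<in> F} = (\<lambda>z. f (fst z)) ` F"
proof -
  have "{f p | p a b. (p, a, b) \<in> F} = {f p | p c. (p, c) \<in> F}" by (rule set_eqI) simp
  then show ?thesis by (simp only: Collect_fst_image)
qed

locale presentation =
  fixes ls :: "ipoint list list" and ess :: "ipoint list list list" and cs ss :: "vertex_data list"
  assumes valid: "valid_presentation ls ess cs ss"
begin

definition "es = concat ess"
definition "V = map fst (cs @ ss)"
definition "L = picture ls cs ss"

lemma
  shows refs: "list_all2 (\<lambda>l es. joinable es \<and> subdivides l (joined es)) ls ess"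
    and disj: "sorted_wrt (disjoint_edges V) es" and eok: "\<And>e. e \<in> set es \<Longrightarrow> edge_ok V e"
    and vok: "\<And>v. v \<in> set (cs @ ss) \<Longrightarrow> vertex_ok es v"
    and ook: "sorted_wrt over_ok cs" and dist: "distinct V"
  using valid unfolding valid_presentation_def Let_def es_def[symmetric] V_def[symmetric]
  by (auto simp: list_all_iff)

lemma graph_L: "graph L = (\<Union>e \<in> set es. ipoly e)"
proof -
  have "graph L = (\<Union>l \<in> set ls. ipoly l)"
    by (simp add: L_def picture_def tangle_def ipoly_def)
  also have "\<dots> = (\<Union>es \<in> set ess. \<Union>e \<in> set es. ipoly e)"
    using refs
  proof (induction rule: list_all2_induct)
    case (Cons l ls es ess)
    then have "ipoly l = (\<Union>e \<in> set es. ipoly e)"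
      using subdivides_ipoly[of l "joined es"] ipoly_joined[of es] by simp
    then show ?case using Cons by simp
  qed simp
  finally show ?thesis by (simp add: es_def)
qed

lemma vertices_L: "vertices L = cpt ` set V" "classical L = cpt ` fst ` set cs" "saddle L = cpt ` fst ` set ss"
  "virtual L = {}"
proof -
  have "classical L = {pt p | p a. (p, a) \<in> (\<lambda>(p, a, b, js). (quarter p, quarter a)) ` set cs}"
    by (simp add: L_def picture_def tangle_def)
  also have "\<dots> = (\<lambda>z. pt (fst z)) ` (\<lambda>(p, a, b, js). (quarter p, quarter a)) ` set cs"
    by (rule Collect_fst_image)
  also have "\<dots> = cpt ` fst ` set cs" by (simp add: image_image case_prod_beta cpt_def)
  finally show c: "classical L = cpt ` fst ` set cs" .
  have "saddle L = {pt p | p a b. (p, a, b) \<in> (\<lambda>(p, a, b, js). (quarter p, quarter a, quarter b)) ` set ss}"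
    by (simp add: L_def picture_def tangle_def)
  also have "\<dots> = (\<lambda>z. pt (fst z)) ` (\<lambda>(p, a, b, js). (quarter p, quarter a, quarter b)) ` set ss"
    by (rule Collect_fst_image3)
  also have "\<dots> = cpt ` fst ` set ss" by (simp add: image_image case_prod_beta cpt_def)
  finally show s: "saddle L = cpt ` fst ` set ss" .
  show v: "virtual L = {}" by (simp add: L_def picture_def tangle_def)
  show "vertices L = cpt ` set V" unfolding vertices_def c s v V_def by auto
qed

lemma over_L: "over L = (\<Union>v \<in> set cs. iseg (over_seg v))"
  unfolding L_def picture_def tangle_def over_seg_def
  by (auto simp: cpt_arith cpt_def[symmetric] split: prod.splits)

lemma edge_of_point:
  assumes "p \<in> graph L" obtains j where "j < length es" "p \<in> ipoly (es ! j)"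
  using assms unfolding graph_L by (auto simp: in_set_conv_nth)

lemma ipoly_in_graph: "j < length es \<Longrightarrow> ipoly (es ! j) \<subseteq> graph L"
  unfolding graph_L using nth_mem by blast

lemma meets_at_inter:
  assumes "meets_at V s t" "x \<in> iseg s" "x \<in> iseg t"
  shows "x \<in> vertices L"
proof -
  obtain p q r where *: "p \<in> set V" "distinct_rays (isub q p) (isub r p)" "iseg s = iseg (p, q)" "iseg t = iseg (p, r)"
  proof -
    consider "fst s = fst t" "fst s \<in> set V" "distinct_rays (isub (snd s) (fst s)) (isub (snd t) (fst s))"
      | "fst s = snd t" "fst s \<in> set V" "distinct_rays (isub (snd s) (fst s)) (isub (fst t) (fst s))"
      | "snd s = fst t" "snd s \<in> set V" "distinct_rays (isub (fst s) (snd s)) (isub (snd t) (snd s))"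
      | "snd s = snd t" "snd s \<in> set V" "distinct_rays (isub (fst s) (snd s)) (isub (fst t) (snd s))"
      using assms(1) unfolding meets_at_def by blast
    then show thesis
    proof cases
      case 1
      then show ?thesis using that[of "fst s" "snd s" "snd t"] by simp
    next
      case 2
      then show ?thesis using that[of "fst s" "snd s" "fst t"] by (simp add: closed_segment_commute)
    next
      case 3
      then show ?thesis using that[of "snd s" "fst s" "snd t"] by (simp add: closed_segment_commute)
    next
      case 4
      then show ?thesis using that[of "snd s" "fst s" "fst t"] by (simp add: closed_segment_commute)
    qed
  qed
  then have "x = cpt p" using distinct_rays_segments[OF *(2)] assms(2,3) by blast
  then show ?thesis using *(1) vertices_L by simp
qed

lemma edges_disjoint_less:
  assumes "j < k" "k < length es" "x \<in> ipoly (es ! j)" "x \<in> ipoly (es ! k)"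
  shows "x \<in> vertices L"
proof -
  have d: "disjoint_edges V (es ! j) (es ! k)" using disj assms(1,2) sorted_wrt_nth_less by blast
  obtain s t where st: "s \<in> set (segs (es ! j))" "x \<in> iseg s" "t \<in> set (segs (es ! k))" "x \<in> iseg t"
    using assms(3,4) unfolding ipoly_segs by blast
  then have "apart s t \<or> meets_at V s t" using d unfolding disjoint_edges_def list_all_iff by blast
  then show ?thesis using apart_disjoint[of s t] meets_at_inter[of s t x] st by blast
qed

lemma edges_disjoint:
  assumes "j < length es" "k < length es" "x \<in> ipoly (es ! j)" "x \<in> ipoly (es ! k)" "x \<notin> vertices L"
  shows "j = k"
  using edges_disjoint_less[of j k x] edges_disjoint_less[of k j x] assms by (cases j k rule: linorder_cases) auto

lemma edge_vertices:
  assumes "e \<in> set es" "s \<in> set (segs e)"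
  shows "vertices L \<inter> iseg s \<subseteq> {cpt (fst s), cpt (snd s)}"
proof
  fix x assume x: "x \<in> vertices L \<inter> iseg s"
  then obtain v where v: "v \<in> set V" "x = cpt v" using vertices_L by auto
  have "v = fst s \<or> v = snd s \<or> apart s (v, v)"
    using eok[OF assms(1)] assms(2) v(1) unfolding edge_ok_def list_all_iff by blast
  then show "x \<in> {cpt (fst s), cpt (snd s)}" using apart_disjoint[of s "(v, v)"] x v by auto
qed

lemma labels_of_point_labeling:
  assumes g: "locally_const_on (graph L - vertices L) g"
  obtains lab where "\<And>j p. j < length es \<Longrightarrow> p \<in> ipoly (es ! j) - vertices L \<Longrightarrow> g p = lab j"
proof -
  have "\<exists>c. \<forall>x \<in> ipoly e - vertices L. g x = c" if e: "e \<in> set es" for e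
  proof (rule locally_const_on_edge[OF g])
    show "ipoly e \<subseteq> graph L" using e graph_L by blast
    show "\<forall>s \<in> set (segs e). vertices L \<inter> iseg s \<subseteq> {cpt (fst s), cpt (snd s)}"
      using edge_vertices[OF e] by blast
    show "\<forall>p \<in> set (butlast (tl e)). cpt p \<notin> vertices L"
      using eok[OF e] unfolding edge_ok_def list_all_iff vertices_L by (auto simp: cpt_inj)
  qed
  then have "\<forall>j. \<exists>c. j < length es \<longrightarrow> (\<forall>x \<in> ipoly (es ! j) - vertices L. g x = c)" using nth_mem by blast
  then obtain lab where "\<forall>j. j < length es \<longrightarrow> (\<forall>x \<in> ipoly (es ! j) - vertices L. g x = lab j)" by metis
  then show thesis using that by blast
qed

lemma edge_has_point:
  assumes "j < length es" obtains x where "x \<in> ipoly (es ! j)" "x \<notin> vertices L"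
proof -
  have e: "es ! j \<in> set es" using assms by simp
  then obtain s where s: "s \<in> set (segs (es ! j))" "fst s \<noteq> snd s"
    using eok[OF e] unfolding edge_ok_def list_all_iff by (metis list.set_intros(1) neq_Nil_conv)
  let ?m = "midpoint (cpt (fst s)) (cpt (snd s))"
  have "?m \<in> iseg s" by simp
  moreover have "?m \<noteq> cpt (fst s)" "?m \<noteq> cpt (snd s)" using s(2) by (simp_all add: midpoint_eq_endpoint cpt_inj)
  ultimately have "?m \<notin> vertices L" using edge_vertices[OF e s(1)] by blast
  moreover have "?m \<in> ipoly (es ! j)" using s(1) \<open>?m \<in> iseg s\<close> unfolding ipoly_segs by blast
  ultimately show thesis using that by blast
qed

text \<open>Near a vertex the picture is a linear image of the coordinate cross, since all segments not ending at the
  vertex and all other vertices keep a positive distance from it.\<close>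

lemma vertex_chart:
  assumes v: "v \<in> set (cs @ ss)" and v_def: "v = (p, a, b, j1, j2, j3, j4)"
  obtains \<phi> where "crossing_chart L \<phi>" "\<phi> 0 = cpt p"
    "\<phi> 1 \<in> ipoly (es ! j1)" "\<phi> \<i> \<in> ipoly (es ! j2)" "\<phi> (-1) \<in> ipoly (es ! j3)" "\<phi> (-\<i>) \<in> ipoly (es ! j4)"
    "v \<in> set cs \<longrightarrow> classical_chart L \<phi>"
    "j1 < length es" "j2 < length es" "j3 < length es" "j4 < length es"
proof -
  have fv: "fst v = p" "fst (snd v) = a" "fst (snd (snd v)) = b" by (simp_all add: v_def)
  have pV: "p \<in> set V" unfolding V_def set_map fv(1)[symmetric] by (rule imageI[OF v])
  note ok = vok[OF v, unfolded vertex_ok_def list_all_iff list_ex_iff fv]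
  note ok_through = conjunct1[OF conjunct2[OF conjunct2[OF ok]]]
  note ok_ends = conjunct2[OF conjunct2[OF conjunct2[OF ok]]]
  define P where "P = cpt p" define A where "A = cpt a" define B where "B = cpt b"
  define lin where "lin z = Re z *\<^sub>R A + Im z *\<^sub>R B" for z :: complex
  have lin_simps: "lin 1 = A" "lin \<i> = B" "lin (-1) = - A" "lin (-\<i>) = - B" "lin 0 = 0"
    "\<And>t z. lin (t *\<^sub>R z) = t *\<^sub>R lin z"
    by (simp_all add: lin_def algebra_simps)
  have "icross a b \<noteq> 0" using ok by simp
  then have det: "Re A * Im B - Im A * Re B \<noteq> 0"
    using cross_dot_cpt(1)[of a b] by (auto simp: A_def B_def)
  have lin_inj: "z = w" if "lin z = lin w" for z w
  proof -
    have "(Re z - Re w) * Re A + (Im z - Im w) * Re B = 0" "(Re z - Re w) * Im A + (Im z - Im w) * Im B = 0"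
      using that by (auto simp: lin_def complex_eq_iff algebra_simps)
    then have "(Re z - Re w) * (Re A * Im B - Im A * Re B) = 0" "(Im z - Im w) * (Re A * Im B - Im A * Re B) = 0"
      by algebra+
    then show ?thesis using det by (simp add: complex_eq_iff)
  qed
  have nz: "a \<noteq> (0,0)" "b \<noteq> (0,0)" "ineg a \<noteq> (0,0)" "ineg b \<noteq> (0,0)"
    using \<open>icross a b \<noteq> 0\<close> by (auto simp: icross_def ineg_def prod_eq_iff)
  have ray: "\<exists>u \<in> units. cpt (fst d) = lin u" "fst d \<noteq> (0,0)" if "d \<in> set (dirs v)" for d
  proof -
    have c: "cpt a = lin 1" "cpt b = lin \<i>" "cpt (ineg a) = lin (-1)" "cpt (ineg b) = lin (-\<i>)"
      by (simp_all add: cpt_arith lin_simps A_def B_def)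
    have d: "d \<in> {(a, j1), (b, j2), (ineg a, j3), (ineg b, j4)}" using that by (simp add: v_def)
    show "\<exists>u \<in> units. cpt (fst d) = lin u"
      using d by (elim insertE emptyE) (use c units_simps in \<open>auto simp only: fst_conv\<close>)
    show "fst d \<noteq> (0,0)" using d nz by auto
  qed
  have through: "\<exists>u \<in> units. \<exists>t\<ge>0. x = P + lin (t *\<^sub>R u)"
    if e: "e \<in> set es" and s: "s \<in> set (segs e)" and p: "fst s = p \<or> snd s = p" and x: "x \<in> iseg s" for e s x
  proof -
    obtain d where d: "d \<in> set (dirs v)" "leaves p (fst d) s"
      using mp[OF bspec[OF bspec[OF ok_through e] s] p] by blast
    obtain c where c: "1 \<le> c" "iseg s = closed_segment (cpt p) (cpt p + c *\<^sub>R cpt (fst d))"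
      by (rule leaves_cpt[OF d(2) ray(2)[OF d(1)]])
    obtain t where "t \<ge> 0" "x = cpt p + t *\<^sub>R cpt (fst d)" using segment_from(2)[OF c(1)] x c(2) by metis
    moreover obtain u where "u \<in> units" "cpt (fst d) = lin u" using ray(1)[OF d(1)] by blast
    ultimately show ?thesis by (auto simp: P_def lin_simps)
  qed
  have on: "P + t *\<^sub>R cpt d \<in> ipoly (es ! j)" "j < length es"
    if dj: "(d, j) \<in> set (dirs v)" and t: "0 \<le> t" "t \<le> 1" for d j t
  proof -
    obtain s where s: "s \<in> set (segs (es ! j))" "leaves p d s" and j: "j < length es"
      using bspec[OF ok_ends dj] by auto
    obtain c where c: "1 \<le> c" "iseg s = closed_segment (cpt p) (cpt p + c *\<^sub>R cpt d)"
      using leaves_cpt[OF s(2)] ray(2)[OF dj] by auto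
    show "P + t *\<^sub>R cpt d \<in> ipoly (es ! j)"
      using segment_from(1)[OF c(1) t, of "cpt p"] s(1) c(2) unfolding ipoly_segs P_def by blast
    show "j < length es" by (rule j)
  qed
  have on4: "P + lin (t *\<^sub>R 1) \<in> ipoly (es ! j1)" "P + lin (t *\<^sub>R \<i>) \<in> ipoly (es ! j2)"
    "P + lin (t *\<^sub>R (-1)) \<in> ipoly (es ! j3)" "P + lin (t *\<^sub>R (-\<i>)) \<in> ipoly (es ! j4)"
    if t: "0 \<le> t" "t \<le> 1" for t
    using on(1)[OF _ t, of a j1] on(1)[OF _ t, of b j2] on(1)[OF _ t, of "ineg a" j3] on(1)[OF _ t, of "ineg b" j4]
    unfolding lin_simps(6) lin_simps(1-4) v_def by (auto simp: A_def B_def cpt_arith)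
  have j: "j1 < length es" "j2 < length es" "j3 < length es" "j4 < length es"
    using on(2)[of a j1 0] on(2)[of b j2 0] on(2)[of "ineg a" j3 0] on(2)[of "ineg b" j4 0]
    unfolding v_def by simp_all
  \<comment> \<open>Everything that a small chart at \<open>p\<close> has to avoid; other over-strands matter at crossings only.\<close>
  define others where "others = (\<Union>e \<in> set es. \<Union>s \<in> {s \<in> set (segs e). fst s \<noteq> p \<and> snd s \<noteq> p}. iseg s) \<union>
    cpt ` (set V - {p}) \<union> (\<Union>w \<in> {w \<in> set cs. v \<in> set cs \<and> fst w \<noteq> p}. iseg (over_seg w))"
  have "closed others" unfolding others_def
    by (intro closed_Un closed_UN finite_imp_closed) auto
  moreover have "P \<notin> others"
  proof
    assume "P \<in> others"
    then consider e s where "e \<in> set es" "s \<in> set (segs e)" "fst s \<noteq> p" "snd s \<noteq> p" "P \<in> iseg s"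
      | q where "q \<in> set V" "q \<noteq> p" "P = cpt q" | w where "w \<in> set cs" "v \<in> set cs" "fst w \<noteq> p" "P \<in> iseg (over_seg w)"
      unfolding others_def by blast
    then show False
    proof cases
      case 1
      have "P \<in> vertices L" using pV vertices_L by (simp add: P_def)
      then show False using edge_vertices[OF 1(1,2)] 1 by (auto simp: P_def cpt_inj)
    next
      case 2
      then show False by (simp add: P_def cpt_inj)
    next
      case 3
      obtain i k where ik: "i < length cs" "k < length cs" "cs ! i = v" "cs ! k = w"
        using 3(1,2) by (auto simp: in_set_conv_nth)
      then have "i \<noteq> k" using 3(3) v_def by auto
      then have "over_ok v w \<or> over_ok w v"
        using ook ik sorted_wrt_nth_less by (metis linorder_neqE_nat)
      then have "apart (over_seg w) (p, p)" by (auto simp: over_ok_def v_def)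
      then show False using apart_disjoint[of "over_seg w" "(p, p)"] 3(4) by (auto simp: P_def)
    qed
  qed
  ultimately have oo: "open (- others)" "P \<in> - others" by (auto intro: open_Compl)
  have cont: "continuous_on (cball 0 1) (\<lambda>z. P + lin z)"
    unfolding lin_def by (intro continuous_intros)
  obtain r where r: "0 < r" "r \<le> 1" and avoid: "\<And>z. norm z \<le> r \<Longrightarrow> P + lin z \<in> - others"
    using chart_small[OF cont oo(1)] oo(2) lin_simps(5) by auto
  define \<phi> where "\<phi> z = P + lin (r *\<^sub>R z)" for z
  have rz: "norm (r *\<^sub>R z) \<le> r" if "z \<in> cball 0 1" for z :: complex
    using that r mult_left_mono[of "norm z" 1 r] by simp
  have av: "\<phi> z \<notin> others" if "z \<in> cball 0 1" for z
    using avoid[OF rz[OF that]] by (simp add: \<phi>_def)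
  have \<phi>inj: "z = w" if "\<phi> z = \<phi> w" for z w
    using lin_inj[of "r *\<^sub>R z" "r *\<^sub>R w"] that r by (simp add: \<phi>_def)
  have chart: "crossing_chart L \<phi>"
  proof (rule crossing_chartI)
    show "continuous_on (cball 0 1) \<phi>" unfolding \<phi>_def lin_def by (intro continuous_intros)
    show "inj_on \<phi> (cball 0 1)" using \<phi>inj by (auto intro: inj_onI)
    fix z :: complex assume z: "z \<in> cball 0 1"
    show "\<phi> z \<in> graph L \<longleftrightarrow> z \<in> axes"
    proof
      assume "\<phi> z \<in> graph L"
      then obtain e s where es: "e \<in> set es" "s \<in> set (segs e)" "\<phi> z \<in> iseg s"
        unfolding graph_L ipoly_segs by blast
      then have "fst s = p \<or> snd s = p" using av[OF z] unfolding others_def by blast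
      from through[OF es(1,2) this es(3)] obtain u t where "u \<in> units" "\<phi> z = P + lin (t *\<^sub>R u)" by blast
      then have "r *\<^sub>R z = t *\<^sub>R u" using lin_inj by (simp add: \<phi>_def)
      then have "r *\<^sub>R z \<in> axes" using units_axes[OF \<open>u \<in> units\<close>] by simp
      then show "z \<in> axes" using axes_scaleR[of r z] r by simp
    next
      assume ax: "z \<in> axes"
      define t where "t = r * norm z"
      have "norm (r *\<^sub>R z) = t" using r by (simp add: t_def)
      then have t: "0 \<le> t" "t \<le> 1" using rz[OF z] r norm_ge_zero[of "r *\<^sub>R z"] by linarith+
      obtain u where u: "u \<in> units" "r *\<^sub>R z = t *\<^sub>R u"
      proof (cases "z = 0")
        case True
        then show thesis using that[of 1] units_simps by (simp add: t_def)
      next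
        case False
        then have "r *\<^sub>R z = t *\<^sub>R sgn z" by (simp add: t_def sgn_div_norm)
        then show thesis using that[of "sgn z"] sgn_axes[OF ax False] by simp
      qed
      then have "\<phi> z = P + lin (t *\<^sub>R u)" by (simp add: \<phi>_def)
      then show "\<phi> z \<in> graph L"
        using on4[OF t] u(1) ipoly_in_graph[OF j(1)] ipoly_in_graph[OF j(2)] ipoly_in_graph[OF j(3)]
          ipoly_in_graph[OF j(4)] unfolding units_def by (elim insertE emptyE) (simp only: subset_iff)+
    qed
    show "\<phi> z \<in> vertices L \<longleftrightarrow> z = 0"
    proof
      assume "\<phi> z \<in> vertices L"
      then have "\<phi> z = cpt p" using av[OF z] unfolding others_def vertices_L by blast
      then have "\<phi> z = \<phi> 0" by (simp add: \<phi>_def lin_simps P_def)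
      then show "z = 0" by (rule \<phi>inj)
    next
      assume "z = 0"
      then show "\<phi> z \<in> vertices L"
        using pV vertices_L by (simp add: \<phi>_def lin_simps P_def)
    qed
  qed
  have "classical_chart L \<phi>" if vc: "v \<in> set cs"
  proof -
    have own: "iseg (over_seg v) = {P + t *\<^sub>R A | t. -1 \<le> t \<and> t \<le> 1}"
    proof -
      have "iseg (over_seg v) = closed_segment (P - A) (P + A)"
        by (simp add: over_seg_def v_def cpt_arith P_def A_def)
      also have "\<dots> = {P + t *\<^sub>R A | t. -1 \<le> t \<and> t \<le> 1}"
      proof (rule set_eqI, rule iffI)
        fix x assume "x \<in> closed_segment (P - A) (P + A)"
        then obtain u where u: "0 \<le> u" "u \<le> 1" "x = (1 - u) *\<^sub>R (P - A) + u *\<^sub>R (P + A)"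
          by (auto simp: closed_segment_def)
        then have "x = P + (2 * u - 1) *\<^sub>R A" by (simp add: complex_eq_iff algebra_simps)
        then show "x \<in> {P + t *\<^sub>R A | t. -1 \<le> t \<and> t \<le> 1}" using u(1,2) by (intro CollectI exI[of _ "2 * u - 1"]) simp
      next
        fix x assume "x \<in> {P + t *\<^sub>R A | t. -1 \<le> t \<and> t \<le> 1}"
        then obtain t where t: "-1 \<le> t" "t \<le> 1" "x = P + t *\<^sub>R A" by blast
        then show "x \<in> closed_segment (P - A) (P + A)" unfolding closed_segment_def
          by (intro CollectI exI[of _ "(t + 1) / 2"]) (auto simp: complex_eq_iff field_simps)
      qed
      finally show ?thesis .
    qed
    have uniq: "w = v" if "w \<in> set cs" "fst w = p" for w
    proof -
      have "distinct (map fst cs)" using dist by (simp add: V_def)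
      then show ?thesis using that vc v_def by (metis distinct_map fst_conv inj_onD)
    qed
    have "\<phi> z \<in> over L \<longleftrightarrow> Im z = 0" if z: "z \<in> cball 0 1" for z
    proof
      assume "\<phi> z \<in> over L"
      then obtain w where w: "w \<in> set cs" "\<phi> z \<in> iseg (over_seg w)" unfolding over_L by blast
      then have "fst w = p" using av[OF z] vc unfolding others_def by blast
      then have "\<phi> z \<in> iseg (over_seg v)" using uniq w by blast
      then obtain t where "\<phi> z = P + t *\<^sub>R A" unfolding own by blast
      then have "lin (r *\<^sub>R z) = t *\<^sub>R A" by (simp add: \<phi>_def)
      then have "lin (r *\<^sub>R z) = lin (t *\<^sub>R 1)" using lin_simps(6)[of t 1] lin_simps(1) by simp
      then have "r *\<^sub>R z = t *\<^sub>R 1" by (rule lin_inj)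
      then have "Im (r *\<^sub>R z) = Im (t *\<^sub>R 1)" by (rule arg_cong)
      then show "Im z = 0" using r by simp
    next
      assume "Im z = 0"
      then have "\<phi> z = P + (r * Re z) *\<^sub>R A" by (simp add: \<phi>_def lin_def)
      moreover have "\<bar>r * Re z\<bar> \<le> 1"
        using order_trans[OF abs_Re_le_cmod[of "r *\<^sub>R z"] rz[OF z]] r(2) by (simp only: scaleR_complex.simps complex.sel)
      ultimately have "\<phi> z \<in> iseg (over_seg v)" unfolding own by (auto simp: abs_le_iff)
      then show "\<phi> z \<in> over L" using vc over_L by blast
    qed
    moreover have "\<phi> 0 \<in> classical L"
      using vc v_def vertices_L(2) by (force simp: \<phi>_def lin_simps P_def)
    ultimately show ?thesis using chart by (simp add: classical_chart_iff)
  qed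
  then show thesis
    using that[OF chart _ _ _ _ _ _ j] on4[of r] r by (simp add: \<phi>_def lin_simps P_def del: scaleR_minus_right)
qed

end

section \<open>Labelings of a picture as colorings of its edges\<close>

definition boundary_edges :: "ipoint list list \<Rightarrow> (ipoint \<times> nat) list" where
  "boundary_edges es = concat (map (\<lambda>(j, e). map (\<lambda>b. (b, j)) (filter (\<lambda>b. \<not> in_open_disk b) e)) (List.enumerate 0 es))"

type_synonym presentation_data = "ipoint list list \<times> ipoint list list list \<times> vertex_data list \<times> vertex_data list"

type_synonym incidence = "nat \<times> nat \<times> nat \<times> nat"

definition valid_data :: "presentation_data \<Rightarrow> bool" where
  "valid_data = (\<lambda>(ls, ess, cs, ss). valid_presentation ls ess cs ss)"

definition picture_of :: "presentation_data \<Rightarrow> diagram" where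
  "picture_of = (\<lambda>(ls, ess, cs, ss). picture ls cs ss)"

text \<open>What a coloring sees of a picture once all positions are forgotten.\<close>

definition incidences :: "presentation_data \<Rightarrow> nat list \<times> (ipoint \<times> nat) list \<times> incidence list \<times> incidence list" where
  "incidences = (\<lambda>(ls, ess, cs, ss). ([0..<length (concat ess)], boundary_edges (concat ess),
     map (\<lambda>v. snd (snd (snd v))) cs, map (\<lambda>v. snd (snd (snd v))) ss))"

text \<open>Colorings in terms of incidences: for a concrete picture this unfolds to a finite list of
  equations.\<close>

fun colors where
  "colors X up dn (js, bd, cs, ss) lab \<longleftrightarrow> list_all (\<lambda>j. lab j \<in> X) js \<and>
     list_all (\<lambda>(j1, j2, j3, j4). lab j4 = up (lab j2) (lab j1) \<and> lab j3 = dn (lab j1) (lab j2)) cs \<and>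
     list_all (\<lambda>(j1, j2, j3, j4). lab j2 = lab j1 \<and> lab j3 = lab j1 \<and> lab j4 = lab j1) ss"

lemma colors_mem: "colors X up dn I lab \<Longrightarrow> j \<in> set (fst I) \<Longrightarrow> lab j \<in> X"
  by (cases I) (auto simp: list_all_iff)

text \<open>An explicit continuation \<open>W\<close>, listing the colors of the edges of the second picture in terms of those
  of the first one. In the proofs for the moves its entries are found by starting from boundary edges and passing
  through one crossing after the other.\<close>

definition continues where
  "continues X up dn I J W \<longleftrightarrow> (\<forall>lab. colors X up dn I lab \<longrightarrow> colors X up dn J ((!) (W lab)) \<and>
     list_all (\<lambda>(b, j). list_all (\<lambda>(b', k). b = b' \<longrightarrow> W lab ! k = lab j) (fst (snd J))) (fst (snd I)))"

text \<open>This makes continuations unique. It is a property of the second picture alone.\<close>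

definition determined where
  "determined X up dn I \<longleftrightarrow> (\<forall>lab lab'. colors X up dn I lab \<longrightarrow> colors X up dn I lab' \<longrightarrow>
     list_all (\<lambda>(b, j). lab j = lab' j) (fst (snd I)) \<longrightarrow> list_all (\<lambda>j. lab j = lab' j) (fst I))"

context presentation
begin

lemma colors_iff:
  "colors X up dn (incidences (ls, ess, cs, ss)) lab \<longleftrightarrow> (\<forall>j<length es. lab j \<in> X) \<and>
     (\<forall>v \<in> set cs. crossing_colored up dn lab v) \<and> (\<forall>v \<in> set ss. saddle_colored lab v)"
  by (simp add: incidences_def es_def list_all_iff split_beta) (auto split: prod.splits)

lemma vertexE:
  assumes "x \<in> vertices L" obtains v where "v \<in> set (cs @ ss)" "x = cpt (fst v)"
  using assms unfolding vertices_L(1) V_def set_map image_image by (rule imageE)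

lemma classicalE:
  assumes "x \<in> classical L" obtains v where "v \<in> set cs" "x = cpt (fst v)"
  using assms unfolding vertices_L(2) image_image by (rule imageE)

lemma saddleE:
  assumes "x \<in> saddle L" obtains v where "v \<in> set ss" "x = cpt (fst v)"
  using assms unfolding vertices_L(3) image_image by (rule imageE)

lemma local_diagram_L: "local_diagram L"
  unfolding local_diagram_def
proof (intro conjI)
  show "vertices L \<subseteq> open_disk"
  proof
    fix x assume "x \<in> vertices L"
    then obtain v where v: "v \<in> set (cs @ ss)" "x = cpt (fst v)" by (rule vertexE)
    have "in_open_disk (fst v)" using vok[OF v(1)] unfolding vertex_ok_def by (rule conjunct1)
    then show "x \<in> open_disk" using v(2) cpt_in_open_disk by simp
  qed
  show "virtual L = {}" by (rule vertices_L)
  show "classical L \<subseteq> over L"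
  proof
    fix x assume "x \<in> classical L"
    then obtain v where v: "v \<in> set cs" "x = cpt (fst v)" by (rule classicalE)
    obtain p a b j1 j2 j3 j4 where vd: "v = (p, a, b, j1, j2, j3, j4)" by (cases v)
    have "x \<in> iseg (over_seg v)"
      unfolding over_seg_def vd fst_conv snd_conv cpt_arith v(2)
      by (auto simp: closed_segment_def complex_eq_iff field_simps intro!: exI[of _ "1/2"])
    then show "x \<in> over L" using v(1) over_L by blast
  qed
  show "over L \<subseteq> graph L"
  proof
    fix x assume "x \<in> over L"
    then obtain v where v: "v \<in> set cs" "x \<in> iseg (over_seg v)" unfolding over_L by blast
    obtain p a b j1 j2 j3 j4 where vd: "v = (p, a, b, j1, j2, j3, j4)" by (cases v)
    have ok: "\<forall>d \<in> set (dirs v). snd d < length es \<and> (\<exists>s \<in> set (segs (es ! snd d)). leaves p (fst d) s)"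
      "icross a b \<noteq> 0"
      using vok[of v] v(1) unfolding vertex_ok_def list_all_iff list_ex_iff vd fst_conv snd_conv by simp_all
    have nz: "a \<noteq> (0,0)" "ineg a \<noteq> (0,0)" using ok(2) by (auto simp: icross_def ineg_def prod_eq_iff)
    have on: "cpt p + t *\<^sub>R cpt d \<in> graph L"
      if dj: "(d, j) \<in> set (dirs v)" and d: "d \<noteq> (0,0)" and t: "0 \<le> t" "t \<le> 1" for d j t
    proof -
      obtain s where s: "s \<in> set (segs (es ! j))" "leaves p d s" "j < length es"
        using bspec[OF ok(1) dj] by auto
      obtain c where c: "1 \<le> c" "iseg s = closed_segment (cpt p) (cpt p + c *\<^sub>R cpt d)"
        by (rule leaves_cpt[OF s(2) d])
      have "cpt p + t *\<^sub>R cpt d \<in> ipoly (es ! j)"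
        using segment_from(1)[OF c(1) t, of "cpt p"] s(1) c(2) unfolding ipoly_segs by blast
      then show ?thesis using ipoly_in_graph[OF s(3)] by blast
    qed
    obtain u where u: "0 \<le> u" "u \<le> 1" "x = (1 - u) *\<^sub>R (cpt p - cpt a) + u *\<^sub>R (cpt p + cpt a)"
      using v(2) unfolding over_seg_def vd fst_conv snd_conv cpt_arith by (auto simp: closed_segment_def)
    have x: "x = cpt p + (2 * u - 1) *\<^sub>R cpt a" "x = cpt p + (1 - 2 * u) *\<^sub>R cpt (ineg a)"
      unfolding u(3) by (simp_all add: complex_eq_iff cpt_arith algebra_simps)
    show "x \<in> graph L"
    proof (cases "1 \<le> 2 * u")
      case True
      then show ?thesis using on[of a j1 "2 * u - 1"] nz u x(1) by (simp add: vd)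
    next
      case False
      then show ?thesis using on[of "ineg a" j3 "1 - 2 * u"] nz u x(2) by (simp add: vd)
    qed
  qed
qed

text \<open>Together with the next lemma this identifies point labelings of the picture with colorings of
  its edges.\<close>

lemma edge_coloring_of_point_labeling:
  assumes g: "g \<in> point_labelings X up dn L"
  obtains lab where "colors X up dn (incidences (ls, ess, cs, ss)) lab"
    "\<forall>j < length es. \<forall>p \<in> ipoly (es ! j) - vertices L. g p = lab j"
proof -
  obtain lab where lab: "\<And>j p. j < length es \<Longrightarrow> p \<in> ipoly (es ! j) - vertices L \<Longrightarrow> g p = lab j"
    using labels_of_point_labeling[OF point_labelingsD(3)[OF g]] by blast
  have "lab j \<in> X" if j: "j < length es" for j
  proof -
    obtain x where x: "x \<in> ipoly (es ! j)" "x \<notin> vertices L" by (rule edge_has_point[OF j])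
    then have "g x \<in> X" using point_labelingsD(1)[OF g] ipoly_in_graph[OF j] by blast
    then show ?thesis using lab[OF j, of x] x by simp
  qed
  moreover have "crossing_colored up dn lab v" if v: "v \<in> set cs" for v
  proof -
    obtain p a b j1 j2 j3 j4 where vd: "v = (p, a, b, j1, j2, j3, j4)" by (cases v)
    have v': "v \<in> set (cs @ ss)" using v by simp
    obtain \<phi> where \<phi>: "crossing_chart L \<phi>" "\<phi> 0 = cpt p"
      "\<phi> 1 \<in> ipoly (es ! j1)" "\<phi> \<i> \<in> ipoly (es ! j2)" "\<phi> (-1) \<in> ipoly (es ! j3)" "\<phi> (-\<i>) \<in> ipoly (es ! j4)"
      "v \<in> set cs \<longrightarrow> classical_chart L \<phi>"
      and j: "j1 < length es" "j2 < length es" "j3 < length es" "j4 < length es"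
      by (rule vertex_chart[OF v' vd])
    have cc: "classical_chart L \<phi>" using \<phi>(7) v by (rule mp)
    have "\<phi> 0 \<in> vertices L" using cc by (auto simp: classical_chart_iff vertices_def)
    note rule = rules_atD(2)[OF point_labelingsD(4)[OF g this] refl cc]
    have "g (\<phi> 1) = lab j1" "g (\<phi> \<i>) = lab j2" "g (\<phi> (-1)) = lab j3" "g (\<phi> (-\<i>)) = lab j4"
      using crossing_chart_points(2)[OF \<phi>(1), of _ 1] units_simps \<phi>(3-6) lab j by simp_all
    then show ?thesis using crossing_ruleD[OF rule] by (simp add: vd)
  qed
  moreover have "saddle_colored lab v" if v: "v \<in> set ss" for v
  proof -
    obtain p a b j1 j2 j3 j4 where vd: "v = (p, a, b, j1, j2, j3, j4)" by (cases v)
    have v': "v \<in> set (cs @ ss)" using v by simp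
    obtain \<phi> where \<phi>: "crossing_chart L \<phi>" "\<phi> 0 = cpt p"
      "\<phi> 1 \<in> ipoly (es ! j1)" "\<phi> \<i> \<in> ipoly (es ! j2)" "\<phi> (-1) \<in> ipoly (es ! j3)" "\<phi> (-\<i>) \<in> ipoly (es ! j4)"
      "v \<in> set cs \<longrightarrow> classical_chart L \<phi>"
      and j: "j1 < length es" "j2 < length es" "j3 < length es" "j4 < length es"
      by (rule vertex_chart[OF v' vd])
    have sd: "\<phi> 0 \<in> saddle L" using imageI[OF v, of "\<lambda>v. cpt (fst v)"] unfolding vertices_L(3) image_image \<phi>(2) by (simp add: vd)
    then have "\<phi> 0 \<in> vertices L" by (simp add: vertices_def)
    note rule = rules_atD(3)[OF point_labelingsD(4)[OF g this] refl \<phi>(1) sd]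
    have "g (\<phi> 1) = lab j1" "g (\<phi> \<i>) = lab j2" "g (\<phi> (-1)) = lab j3" "g (\<phi> (-\<i>)) = lab j4"
      using crossing_chart_points(2)[OF \<phi>(1), of _ 1] units_simps \<phi>(3-6) lab j by simp_all
    then show ?thesis
      using rule[OF units_simps(2)] rule[OF units_simps(3)] rule[OF units_simps(4)] by (simp add: vd)
  qed
  ultimately have "colors X up dn (incidences (ls, ess, cs, ss)) lab" unfolding colors_iff by blast
  moreover have "\<forall>j < length es. \<forall>p \<in> ipoly (es ! j) - vertices L. g p = lab j" using lab by blast
  ultimately show thesis by (rule that)
qed

text \<open>Edges are closed and meet in vertices only, so every other point has a neighbourhood that meets
  only its own edge.\<close>

lemma point_labeling_of_edge_coloring:
  assumes b: "bikei X up dn" and colors: "colors X up dn (incidences (ls, ess, cs, ss)) lab"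
  obtains g where "g \<in> point_labelings X up dn L"
    "\<forall>j < length es. \<forall>p \<in> ipoly (es ! j) - vertices L. g p = lab j"
proof -
  note col = colors[unfolded colors_iff]
  define f where "f p = lab (SOME j. j < length es \<and> p \<in> ipoly (es ! j))" for p
  have f: "f p = lab j" if "j < length es" "p \<in> ipoly (es ! j)" "p \<notin> vertices L" for j p
  proof -
    have "(SOME j. j < length es \<and> p \<in> ipoly (es ! j)) < length es \<and> p \<in> ipoly (es ! (SOME j. j < length es \<and> p \<in> ipoly (es ! j)))"
      by (rule someI[of _ j]) (use that in simp)
    then show ?thesis unfolding f_def using edges_disjoint that by metis
  qed
  have fX: "f p \<in> X" if "p \<in> graph L" "p \<notin> vertices L" for p
    using edge_of_point[OF that(1)] f that(2) col by metis
  have closed_ipoly: "closed (ipoly e)" for e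
    unfolding ipoly_segs by (intro closed_UN finite_set) simp
  have lc: "locally_const_on (graph L - vertices L) f"
  proof (rule locally_const_onI)
    fix p assume p: "p \<in> graph L - vertices L"
    then obtain j where j: "j < length es" "p \<in> ipoly (es ! j)" using edge_of_point by blast
    let ?U = "- (\<Union>k \<in> {..<length es} - {j}. ipoly (es ! k))"
    have "open ?U" by (intro open_Compl closed_UN) (auto simp: closed_ipoly)
    moreover have "p \<in> ?U" using edges_disjoint[OF j(1) _ j(2)] p by auto
    moreover have "f q = f p" if q: "q \<in> (graph L - vertices L) \<inter> ?U" for q
    proof -
      obtain k where k: "k < length es" "q \<in> ipoly (es ! k)" using q edge_of_point by blast
      then have "k = j" using q by auto
      then show ?thesis using f[OF j] f[OF k] p q by simp
    qed
    ultimately show "\<exists>U. open U \<and> p \<in> U \<and> (\<forall>q \<in> (graph L - vertices L) \<inter> U. f q = f p)" by blast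
  qed
  have rules: "rules_at up dn L f x" if x: "x \<in> vertices L" for x
  proof -
    obtain v where v: "v \<in> set (cs @ ss)" "x = cpt (fst v)" by (rule vertexE[OF x])
    obtain p a b j1 j2 j3 j4 where vd: "v = (p, a, b, j1, j2, j3, j4)" by (cases v)
    obtain \<phi> where \<phi>: "crossing_chart L \<phi>" "\<phi> 0 = cpt p"
      "\<phi> 1 \<in> ipoly (es ! j1)" "\<phi> \<i> \<in> ipoly (es ! j2)" "\<phi> (-1) \<in> ipoly (es ! j3)" "\<phi> (-\<i>) \<in> ipoly (es ! j4)"
      "v \<in> set cs \<longrightarrow> classical_chart L \<phi>"
      and j: "j1 < length es" "j2 < length es" "j3 < length es" "j4 < length es"
      by (rule vertex_chart[OF v(1) vd])
    have val: "f (\<phi> 1) = lab j1" "f (\<phi> \<i>) = lab j2" "f (\<phi> (-1)) = lab j3" "f (\<phi> (-\<i>)) = lab j4"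
      using crossing_chart_points(2)[OF \<phi>(1), of _ 1] units_simps \<phi>(3-6) f j by simp_all
    have x\<phi>: "\<phi> 0 = x" using \<phi>(2) v(2) vd by simp
    have inV: "w = v" if "w \<in> set (cs @ ss)" "cpt (fst w) = x" for w
    proof -
      have "fst w = fst v" using that(2) v(2) by (simp add: cpt_inj)
      then show ?thesis using dist that(1) v(1) unfolding V_def distinct_map by (meson inj_onD)
    qed
    show ?thesis
    proof (rule rules_atI)
      fix \<psi> :: "complex \<Rightarrow> complex" assume \<psi>: "\<psi> 0 = x"
      have eq: "\<psi> 0 = \<phi> 0" using \<psi> x\<phi> by simp
      show "f (\<psi> 1) = f (\<psi> (-1))" if "virtual_chart L \<psi>"
        using that vertices_L(4) by (simp add: virtual_chart_def)
      show "crossing_rule up dn (\<lambda>u. f (\<psi> u))" if c: "classical_chart L \<psi>"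
      proof -
        have "x \<in> classical L" using c \<psi> by (simp add: classical_chart_iff)
        then obtain w where w: "w \<in> set cs" "x = cpt (fst w)" by (rule classicalE)
        then have vc: "v \<in> set cs" using inV[of w] by simp
        have "crossing_colored up dn lab v" using col vc by blast
        then have e: "lab j4 = up (lab j2) (lab j1)" "lab j3 = dn (lab j1) (lab j2)" by (simp_all add: vd)
        have "crossing_rule up dn (\<lambda>u. f (\<phi> u))"
          by (rule bikei.crossing_rule_of_colored[OF b])
            (use val e col j in simp_all)
        then show ?thesis by (rule crossing_rule_chart_independent[OF mp[OF \<phi>(7) vc] c eq lc])
      qed
      show "f (\<psi> u) = f (\<psi> 1)" if c: "crossing_chart L \<psi>" "x \<in> saddle L" "u \<in> units" for u
      proof -
        obtain w where w: "w \<in> set ss" "x = cpt (fst w)" by (rule saddleE[OF c(2)])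
        then have vs: "v \<in> set ss" using inV[of w] by simp
        have "saddle_colored lab v" using col vs by blast
        then have "\<forall>u \<in> units. f (\<phi> u) = f (\<phi> 1)" using val by (auto simp: vd units_def)
        from saddle_rule_chart_independent[OF \<phi>(1) c(1) eq lc this] show ?thesis using c(3) by blast
      qed
    qed
  qed
  show thesis
  proof (rule that[of "restrict f (graph L - vertices L)"])
    show "restrict f (graph L - vertices L) \<in> point_labelings X up dn L"
      by (rule point_labelingsI[OF fX lc rules])
    have "restrict f (graph L - vertices L) p = lab j"
      if "j < length es" "p \<in> ipoly (es ! j)" "p \<notin> vertices L" for j p
      using f[OF that] ipoly_in_graph[OF that(1)] that by auto
    then show "\<forall>j < length es. \<forall>p \<in> ipoly (es ! j) - vertices L. restrict f (graph L - vertices L) p = lab j"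
      by blast
  qed
qed

end

lemma boundary_edges_set:
  "(b, j) \<in> set (boundary_edges es) \<longleftrightarrow> j < length es \<and> b \<in> set (es ! j) \<and> \<not> in_open_disk b"
proof
  assume "(b, j) \<in> set (boundary_edges es)"
  then show "j < length es \<and> b \<in> set (es ! j) \<and> \<not> in_open_disk b"
    unfolding boundary_edges_def by (auto simp: in_set_enumerate_eq)
next
  assume j: "j < length es \<and> b \<in> set (es ! j) \<and> \<not> in_open_disk b"
  then have "(j, es ! j) \<in> set (List.enumerate 0 es)" by (simp add: in_set_enumerate_eq)
  then show "(b, j) \<in> set (boundary_edges es)"
    using j unfolding boundary_edges_def set_concat set_map by (intro UN_I[of "map (\<lambda>b. (b, j)) (filter (\<lambda>b. \<not> in_open_disk b) (es ! j))"] image_eqI[of _ _ "(j, es ! j)"]) auto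
qed

lemma ends_of_segs:
  assumes "segs e \<noteq> []" "b \<in> set e"
  obtains s where "s \<in> set (segs e)" "b = fst s \<or> b = snd s"
  using assms
proof (induction e arbitrary: thesis)
  case (Cons p e)
  then have "e \<noteq> []" by auto
  then obtain q e' where e: "e = q # e'" by (auto simp: neq_Nil_conv)
  show ?case
  proof (cases "b = p \<or> b = q")
    case True
    then show ?thesis using Cons.prems(1)[of "(p, q)"] e by auto
  next
    case False
    then have "b \<in> set e" "segs e \<noteq> []" using Cons.prems(3) e by (cases e'; auto)+
    then obtain s where "s \<in> set (segs e)" "b = fst s \<or> b = snd s" using Cons.IH by blast
    then show ?thesis using Cons.prems(1)[of s] e by auto
  qed
qed simp

lemma segs_mem: "s \<in> set (segs e) \<Longrightarrow> fst s \<in> set e \<and> snd s \<in> set e"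
  unfolding segs_def using set_zip_leftD[of "fst s" "snd s" e "tl e"] set_zip_rightD[of "fst s" "snd s" e "tl e"]
    list.set_sel(2)[of e "snd s"] by (cases "e = []") simp_all

context presentation
begin

text \<open>A segment between two points of a convex set, one of which is interior, is interior except
  possibly for its other end point.\<close>

lemma seg_outside:
  assumes e: "e \<in> set es" and s: "s \<in> set (segs e)" and x: "x \<in> iseg s" "x \<notin> open_disk"
  shows "\<exists>b. b \<in> set e \<and> \<not> in_open_disk b \<and> x = cpt b"
proof -
  have ok: "in_disk (fst s)" "in_disk (snd s)" "in_open_disk (fst s) \<or> in_open_disk (snd s)"
    using eok[OF e] s unfolding edge_ok_def list_all_iff by blast+
  have intr: "interior disk = open_disk" by (simp add: disk_def open_disk_def interior_cbox)
  have cv: "convex disk" by (simp add: disk_def convex_box)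
  have "x = cpt (fst s) \<or> x = cpt (snd s)"
  proof (rule ccontr)
    assume n: "\<not> (x = cpt (fst s) \<or> x = cpt (snd s))"
    then have "x \<in> open_segment (cpt (fst s)) (cpt (snd s))" using x(1) by (simp add: open_segment_def)
    moreover have "open_segment (cpt (fst s)) (cpt (snd s)) \<subseteq> interior disk"
      using ok(3)
    proof
      assume "in_open_disk (fst s)"
      then show ?thesis
        using in_interior_closure_convex_segment[OF cv, of "cpt (fst s)" "cpt (snd s)"] ok(2) intr
          cpt_in_open_disk cpt_in_disk closure_closed[OF closed_disk] by simp
    next
      assume "in_open_disk (snd s)"
      then show ?thesis
        using in_interior_closure_convex_segment[OF cv, of "cpt (snd s)" "cpt (fst s)"] ok(1) intr
          cpt_in_open_disk cpt_in_disk closure_closed[OF closed_disk] by (simp add: open_segment_commute)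
    qed
    ultimately show False using x(2) intr by blast
  qed
  then show ?thesis using segs_mem[OF s] x(2) cpt_in_open_disk by metis
qed

lemma boundary_point:
  assumes "x \<in> graph L" "x \<notin> open_disk"
  obtains b j where "(b, j) \<in> set (boundary_edges es)" "x = cpt b"
proof -
  obtain j where j: "j < length es" "x \<in> ipoly (es ! j)" by (rule edge_of_point[OF assms(1)])
  then obtain s where "s \<in> set (segs (es ! j))" "x \<in> iseg s" unfolding ipoly_segs by blast
  then obtain b where "b \<in> set (es ! j)" "\<not> in_open_disk b" "x = cpt b"
    using seg_outside[of "es ! j" s x] j(1) assms(2) by auto
  then show thesis using that[of b j] j(1) boundary_edges_set by blast
qed

lemma boundary_edgeD:
  assumes "(b, j) \<in> set (boundary_edges es)"
  shows "j < length es" "cpt b \<in> ipoly (es ! j)" "cpt b \<notin> vertices L" "cpt b \<in> graph L" "cpt b \<notin> open_disk"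
proof -
  have b: "j < length es" "b \<in> set (es ! j)" "\<not> in_open_disk b" using assms boundary_edges_set by auto
  show "j < length es" by (rule b)
  have "segs (es ! j) \<noteq> []" using eok[OF nth_mem[OF b(1)]] unfolding edge_ok_def by (rule conjunct1)
  then obtain s where "s \<in> set (segs (es ! j))" "b = fst s \<or> b = snd s" by (rule ends_of_segs[OF _ b(2)])
  then show *: "cpt b \<in> ipoly (es ! j)" unfolding ipoly_segs by auto
  show o: "cpt b \<notin> open_disk" using b(3) cpt_in_open_disk by simp
  then show "cpt b \<notin> vertices L" using local_diagram_L unfolding local_diagram_def by blast
  show "cpt b \<in> graph L" using * ipoly_in_graph[OF b(1)] by blast
qed

lemma graph_outside: "graph L - open_disk = cpt ` fst ` set (boundary_edges es)"
proof (intro subset_antisym subsetI)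
  fix x assume x: "x \<in> graph L - open_disk"
  obtain b j where "(b, j) \<in> set (boundary_edges es)" "x = cpt b"
    by (rule boundary_point[of x]) (use x in auto)
  then show "x \<in> cpt ` fst ` set (boundary_edges es)"
    unfolding image_image by (intro image_eqI[of _ _ "(b, j)"]) simp_all
next
  fix x assume "x \<in> cpt ` fst ` set (boundary_edges es)"
  then obtain b j where "(b, j) \<in> set (boundary_edges es)" "x = cpt b" by auto
  then show "x \<in> graph L - open_disk" using boundary_edgeD(4,5)[of b j] by simp
qed

end

lemma extends_labelings_of_coloring:
  assumes P: "presentation ls ess cs ss" and Q: "presentation ls' ess' cs' ss'"
    and b: "bikei X up dn"
    and bd: "fst ` set (boundary_edges (concat ess)) = fst ` set (boundary_edges (concat ess'))"
    and cont: "continues X up dn (incidences (ls, ess, cs, ss)) (incidences (ls', ess', cs', ss')) W"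
    and det: "determined X up dn (incidences (ls', ess', cs', ss'))"
  shows "extends_labelings X up dn (picture ls cs ss) (picture ls' cs' ss')"
proof -
  interpret P: presentation ls ess cs ss by (rule P)
  interpret Q: presentation ls' ess' cs' ss' by (rule Q)
  note [simp] = P.es_def[symmetric] Q.es_def[symmetric]
  have inc: "fst (snd (incidences (ls, ess, cs, ss))) = boundary_edges P.es"
    "fst (snd (incidences (ls', ess', cs', ss'))) = boundary_edges Q.es"
    "fst (incidences (ls', ess', cs', ss')) = [0..<length Q.es]"
    by (simp_all add: incidences_def)
  show ?thesis unfolding extends_labelings_def P.L_def[symmetric] Q.L_def[symmetric]
  proof
    fix g assume g: "g \<in> point_labelings X up dn P.L"
    obtain lab where lab: "colors X up dn (incidences (ls, ess, cs, ss)) lab"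
      "\<forall>j < length P.es. \<forall>p \<in> ipoly (P.es ! j) - vertices P.L. g p = lab j"
      by (rule P.edge_coloring_of_point_labeling[OF g])
    define lab' where "lab' = (!) (W lab)"
    have lab': "colors X up dn (incidences (ls', ess', cs', ss')) lab'"
      and ag: "list_all (\<lambda>(b, j). list_all (\<lambda>(b', k). b = b' \<longrightarrow> lab' k = lab j) (boundary_edges Q.es)) (boundary_edges P.es)"
      using mp[OF spec[OF cont[unfolded continues_def inc]] lab(1)] unfolding lab'_def by simp_all
    obtain h where h: "h \<in> point_labelings X up dn Q.L"
      and hv: "\<forall>j < length Q.es. \<forall>p \<in> ipoly (Q.es ! j) - vertices Q.L. h p = lab' j"
      by (rule Q.point_labeling_of_edge_coloring[OF b lab'])
    have hg: "h p = g p" if p: "p \<in> graph P.L - open_disk" for p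
    proof -
      obtain c j where cj: "(c, j) \<in> set (boundary_edges P.es)" "p = cpt c"
        using P.boundary_point[of p] p by blast
      then have "c \<in> fst ` set (boundary_edges Q.es)" using bd by (force simp: image_iff)
      then obtain k where k: "(c, k) \<in> set (boundary_edges Q.es)" by auto
      have "lab' k = lab j" using ag cj(1) k unfolding list_all_iff by blast
      moreover have "h p = lab' k" using hv Q.boundary_edgeD[OF k] cj(2) by simp
      moreover have "g p = lab j" using lab(2) P.boundary_edgeD[OF cj(1)] cj(2) by simp
      ultimately show ?thesis by simp
    qed
    show "\<exists>!g'. g' \<in> point_labelings X up dn Q.L \<and> (\<forall>p \<in> graph P.L - open_disk. g' p = g p)"
    proof (rule ex1I[of _ h])
      show "h \<in> point_labelings X up dn Q.L \<and> (\<forall>p \<in> graph P.L - open_disk. h p = g p)" using h hg by blast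
      fix g' assume g': "g' \<in> point_labelings X up dn Q.L \<and> (\<forall>p \<in> graph P.L - open_disk. g' p = g p)"
      obtain lab'' where l: "colors X up dn (incidences (ls', ess', cs', ss')) lab''"
        "\<forall>j < length Q.es. \<forall>p \<in> ipoly (Q.es ! j) - vertices Q.L. g' p = lab'' j"
        by (rule Q.edge_coloring_of_point_labeling[OF conjunct1[OF g']])
      have "lab'' k = lab' k" if k: "(c, k) \<in> set (boundary_edges Q.es)" for c k
      proof -
        have "c \<in> fst ` set (boundary_edges P.es)" using bd k by (force simp: image_iff)
        then obtain j where j: "(c, j) \<in> set (boundary_edges P.es)" by auto
        have "cpt c \<in> graph P.L - open_disk" using P.boundary_edgeD[OF j] by simp
        then have "g' (cpt c) = h (cpt c)" using g' hg by simp
        then show ?thesis using l(2) hv Q.boundary_edgeD[OF k] by simp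
      qed
      then have bl: "list_all (\<lambda>(b, j). lab'' j = lab' j) (boundary_edges Q.es)" by (auto simp: list_all_iff)
      have "list_all (\<lambda>j. lab'' j = lab' j) [0..<length Q.es]"
        by (rule mp[OF mp[OF mp[OF spec[OF spec[OF det[unfolded determined_def inc]]] l(1)] lab'] bl])
      then have eq: "lab'' j = lab' j" if "j < length Q.es" for j
        using that by (simp add: list_all_iff)
      show "g' = h"
      proof (rule point_labelings_eqI[OF conjunct1[OF g'] h])
        fix p assume p: "p \<in> graph Q.L - vertices Q.L"
        obtain j where j: "j < length Q.es" "p \<in> ipoly (Q.es ! j)" using Q.edge_of_point p by blast
        then show "g' p = h p" using l(2) hv j p eq[OF j(1)] by simp
      qed
    qed
  qed
qed

lemma labeling_preserving_pictures:
  assumes valid: "valid_data P" "valid_data Q"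
    and bd: "fst ` set (fst (snd (incidences P))) = fst ` set (fst (snd (incidences Q)))"
    and cont: "\<And>up dn. bikei X up dn \<Longrightarrow> continues X up dn (incidences P) (incidences Q) (W up dn)"
      "\<And>up dn. bikei X up dn \<Longrightarrow> continues X up dn (incidences Q) (incidences P) (W' up dn)"
    and det: "\<And>up dn. bikei X up dn \<Longrightarrow> determined X up dn (incidences P)"
      "\<And>up dn. bikei X up dn \<Longrightarrow> determined X up dn (incidences Q)"
  shows "labeling_preserving X (picture_of P) (picture_of Q)"
proof -
  obtain ls ess cs ss where P: "P = (ls, ess, cs, ss)" by (cases P)
  obtain ls' ess' cs' ss' where Q: "Q = (ls', ess', cs', ss')" by (cases Q)
  interpret P: presentation ls ess cs ss
    using valid(1) by unfold_locales (simp add: valid_data_def P)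
  interpret Q: presentation ls' ess' cs' ss'
    using valid(2) by unfold_locales (simp add: valid_data_def Q)
  have bd': "fst ` set (boundary_edges (concat ess)) = fst ` set (boundary_edges (concat ess'))"
    using bd unfolding P Q incidences_def by simp
  have "labeling_preserving X (picture ls cs ss) (picture ls' cs' ss')"
  proof (rule labeling_preservingI)
    show "local_diagram (picture ls cs ss)" using P.local_diagram_L by (simp add: P.L_def)
    show "local_diagram (picture ls' cs' ss')" using Q.local_diagram_L by (simp add: Q.L_def)
    show "graph (picture ls cs ss) - open_disk = graph (picture ls' cs' ss') - open_disk"
      using P.graph_outside Q.graph_outside bd' by (simp add: P.L_def Q.L_def P.es_def Q.es_def)
    fix up dn assume b: "bikei X up dn"
    show "extends_labelings X up dn (picture ls cs ss) (picture ls' cs' ss')"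
      by (rule extends_labelings_of_coloring[OF P.presentation_axioms Q.presentation_axioms b bd'
            cont(1)[OF b, unfolded P Q] det(2)[OF b, unfolded Q]])
    show "extends_labelings X up dn (picture ls' cs' ss') (picture ls cs ss)"
      by (rule extends_labelings_of_coloring[OF Q.presentation_axioms P.presentation_axioms b bd'[symmetric]
            cont(2)[OF b, unfolded P Q] det(1)[OF b, unfolded P]])
  qed
  then show ?thesis by (simp add: P Q picture_of_def)
qed

section \<open>Bikei identities behind the moves\<close>

context bikei
begin

lemma up_closed: "x \<in> X \<Longrightarrow> y \<in> X \<Longrightarrow> up x y \<in> X"
  using beta_bij[of y] by (auto simp: bij_betw_def)

lemma dn_closed: "x \<in> X \<Longrightarrow> y \<in> X \<Longrightarrow> dn x y \<in> X"
  using alpha_bij[of y] by (auto simp: bij_betw_def)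

text \<open>This and the next lemma express the second Reidemeister move: two strands that cross twice
  recover their labels.\<close>

lemma uncross_up: "x \<in> X \<Longrightarrow> y \<in> X \<Longrightarrow> up (up x y) (dn y x) = x"
  using up_dn[of "up x y" y] dn_up[of x y] up_invol by (simp add: up_closed)

lemma uncross_dn: "x \<in> X \<Longrightarrow> y \<in> X \<Longrightarrow> dn (dn y x) (up x y) = y"
  using dn_up[of x "dn y x"] up_dn[of x y] dn_invol by (simp add: dn_closed)

lemmas crossing_simps = up_closed dn_closed up_invol dn_invol up_dn dn_up uncross_up uncross_dn

text \<open>The outer label of a curl is obtained from the inner one by the same squaring map as the
  inner one from the outer one.\<close>

lemma curl:
  assumes x: "x \<in> X" shows "up (up x x) (up x x) = x"
proof -
  have "dn x (up x x) = up x x" using dn_up[OF x x] diagonal[OF x] by simp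
  then have "up (up x x) (up x x) = up (up x x) x" using up_dn[OF up_closed[OF x x] x] by simp
  then show ?thesis using up_invol[OF x x] by simp
qed

lemma curl_dn: "x \<in> X \<Longrightarrow> dn (up x x) (up x x) = x"
  using curl[of x] diagonal[of "up x x"] by (simp add: up_closed)

text \<open>The three strands leave the triangle with the same labels on both sides of the third
  Reidemeister move. Here \<open>z\<close> is the top strand, \<open>x\<close> the middle one and \<open>y\<close> the bottom one; the
  equations come from the exchange laws when one entry is replaced by its image under a crossing.\<close>

lemma reidemeister3:
  assumes "x \<in> X" "y \<in> X" "z \<in> X"
  shows "up (up y (up x z)) (dn z x) = up (up y z) x"
    "up (dn x (up y z)) (dn z y) = dn (up x z) y"
    "dn (dn z x) (up y (up x z)) = dn (dn z y) (dn x (up y z))"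
proof -
  show 1: "up (up y (up x z)) (dn z x) = up (up y z) x"
    using exchange1[of y z "up x z"] assms by (simp add: crossing_simps)
  show "up (dn x (up y z)) (dn z y) = dn (up x z) y"
    using exchange2[of x z "up y z"] assms by (simp add: crossing_simps)
  have "dn (dn z y) (dn x (up y z)) = dn (dn z x) (up (up y z) x)"
    using exchange3[of z "up y z" x] assms by (simp add: crossing_simps)
  also have "\<dots> = dn (dn z x) (up y (up x z))"
    unfolding 1[symmetric] using assms by (simp add: crossing_simps)
  finally show "dn (dn z x) (up y (up x z)) = dn (dn z y) (dn x (up y z))" by (rule sym)
qed

text \<open>A half twist with equal labels at one end has equal labels at the other end as well.\<close>

lemma twist_equal:
  assumes "x \<in> X" "y \<in> X" "dn x y = up y x" shows "y = x"
  using uncross_up[of y x] uncross_dn[of y x] assms diagonal[of "up y x"] by (simp add: up_closed)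

text \<open>Two parallel strands start with the same label \<open>c\<close> and pass over an edge. Acting twice by the
  same element is trivial, so the edge has the same label before and after, and the strands stay equal.\<close>

lemma parallel_over:
  assumes "m \<in> X" "p \<in> X" "q \<in> X" and "x1 = up m q" "x0 = up x1 p" "c = dn p x1" "c = dn q m"
  shows "x0 = m" "p = dn c m" "q = dn c m" "x1 = up m (dn c m)"
proof -
  note m = assms(1)
  have c: "c \<in> X" unfolding assms(7) by (rule dn_closed[OF assms(3,1)])
  show q: "q = dn c m" unfolding assms(7) by (rule dn_invol[OF assms(3,1), symmetric])
  have x1: "x1 = up m c" unfolding assms(4) q by (rule up_dn[OF m c])
  have "dn (dn p x1) x1 = p" by (rule dn_invol[OF assms(2)]) (simp add: x1 up_closed m c)
  then have "p = dn c x1" by (simp only: assms(6)[symmetric])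
  then show p: "p = dn c m" using dn_up[OF m c] unfolding x1 by simp
  show "x1 = up m (dn c m)" unfolding assms(4) q ..
  then show "x0 = m" unfolding assms(5) p using up_invol[OF m dn_closed[OF c m]] by simp
qed

text \<open>The same for two parallel strands that arrive with equal labels and pass under an edge.\<close>

lemma parallel_under:
  assumes "a \<in> X" "e \<in> X" "f \<in> X" and "d = up e a" "b = dn a e" "d = up f b" "m = dn b f"
  shows "a = m" "e = up d m" "f = up d m" "b = dn m (up d m)"
proof -
  note a = assms(1) and e = assms(2) and f = assms(3)
  have b: "b \<in> X" unfolding assms(5) by (rule dn_closed[OF a e])
  have "up d b = e" unfolding assms(4,5) by (rule uncross_up[OF e a])
  moreover have "up d b = f" unfolding assms(6) by (rule up_invol[OF f b])
  ultimately have fe: "f = e" by simp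
  show am: "a = m" unfolding assms(7) fe unfolding assms(5) by (rule dn_invol[OF a e, symmetric])
  have "up d a = e" unfolding assms(4) by (rule up_invol[OF e a])
  then show em: "e = up d m" using am by simp
  then show "f = up d m" using fe by simp
  show "b = dn m (up d m)" unfolding assms(5) am em[symmetric] ..
qed

end

section \<open>The eight moves\<close>

definition gamma1_left :: presentation_data where
  "gamma1_left =
    ([[(-16, -8), (-8, -8), (8, 8), (8, -8), (-8, 8), (-16, 8)]],
     [[[(-16, -8), (-8, -8), (0, 0)], [(0, 0), (8, 8), (8, -8), (0, 0)], [(0, 0), (-8, 8), (-16, 8)]]],
     [((0, 0), (4, 4), (4, -4), 1, 1, 0, 2)],
     [])"

definition gamma1_right :: presentation_data where
  "gamma1_right =
    ([[(-16, -8), (-8, -8), (-8, 8), (-16, 8)]],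
     [[[(-16, -8), (-8, -8), (-8, 8), (-16, 8)]]],
     [],
     [])"

lemma gamma1_left_incidences: "incidences gamma1_left =
    ([0, 1, 2], [((-16, -8), 0), ((-16, 8), 2)],
     [(1, 1, 0, 2)], [])"
  by code_simp

lemma gamma1_right_incidences: "incidences gamma1_right =
    ([0], [((-16, -8), 0), ((-16, 8), 0)],
     [], [])"
  by code_simp

lemma gamma1_labeling_preserving:
  "labeling_preserving X
     (tangle [[(-4,-2), (-2,-2), (2,2), (2,-2), (-2,2), (-4,2)]] [((0,0), (1,1))] [])
     (tangle [[(-4,-2), (-2,-2), (-2,2), (-4,2)]] [] [])"
proof -
  have "labeling_preserving X (picture_of gamma1_left) (picture_of gamma1_right)"
  proof (rule labeling_preserving_pictures)
    note inc = gamma1_left_incidences gamma1_right_incidences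
    show "valid_data gamma1_left" "valid_data gamma1_right" by code_simp+
    show "fst ` set (fst (snd (incidences gamma1_left))) = fst ` set (fst (snd (incidences gamma1_right)))"
      unfolding inc by auto
    fix up dn :: "'a \<Rightarrow> 'a \<Rightarrow> 'a" assume "bikei X up dn"
    then interpret bikei X up dn .
    show "continues X up dn (incidences gamma1_left) (incidences gamma1_right)
        (\<lambda>lab. [lab 0])"
      unfolding inc by (auto simp: continues_def diagonal)
    show "continues X up dn (incidences gamma1_right) (incidences gamma1_left)
        (\<lambda>lab. [lab 0, up (lab 0) (lab 0), lab 0])"
      unfolding inc by (auto simp: continues_def crossing_simps curl curl_dn)
    show "determined X up dn (incidences gamma1_left)"
      unfolding inc by (auto simp: determined_def) (metis curl)+
    show "determined X up dn (incidences gamma1_right)"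
      unfolding inc by (auto simp: continues_def determined_def crossing_simps)
  qed
  then show ?thesis
    by (simp add: picture_of_def picture_def quarter_def gamma1_left_def gamma1_right_def)
qed

definition gamma2_left :: presentation_data where
  "gamma2_left =
    ([[(-16, -8), (-12, -8), (0, 4), (12, -8), (16, -8)], [(-16, 8), (-12, 8), (0, -4), (12, 8), (16, 8)]],
     [[[(-16, -8), (-12, -8), (-4, 0)], [(-4, 0), (0, 4), (4, 0)], [(4, 0), (12, -8), (16, -8)]], [[(-16, 8), (-12, 8), (-4, 0)], [(-4, 0), (0, -4), (4, 0)], [(4, 0), (12, 8), (16, 8)]]],
     [((-4, 0), (2, 2), (2, -2), 1, 4, 0, 3), ((4, 0), (2, -2), (2, 2), 2, 5, 1, 4)],
     [])"

definition gamma2_right :: presentation_data where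
  "gamma2_right =
    ([[(-16, -8), (16, -8)], [(-16, 8), (16, 8)]],
     [[[(-16, -8), (0, -8), (16, -8)]], [[(-16, 8), (0, 8), (16, 8)]]],
     [],
     [])"

lemma gamma2_left_incidences: "incidences gamma2_left =
    ([0, 1, 2, 3, 4, 5], [((-16, -8), 0), ((16, -8), 2), ((-16, 8), 3), ((16, 8), 5)],
     [(1, 4, 0, 3), (2, 5, 1, 4)], [])"
  by code_simp

lemma gamma2_right_incidences: "incidences gamma2_right =
    ([0, 1], [((-16, -8), 0), ((16, -8), 0), ((-16, 8), 1), ((16, 8), 1)],
     [], [])"
  by code_simp

lemma gamma2_labeling_preserving:
  "labeling_preserving X
     (tangle [[(-4,-2), (-3,-2), (0,1), (3,-2), (4,-2)],
      [(-4,2), (-3,2), (0,-1), (3,2), (4,2)]]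
      [((-1,0), (1/2,1/2)), ((1,0), (1/2,-1/2))] [])
     (tangle [[(-4,-2), (4,-2)], [(-4,2), (4,2)]] [] [])"
proof -
  have "labeling_preserving X (picture_of gamma2_left) (picture_of gamma2_right)"
  proof (rule labeling_preserving_pictures)
    note inc = gamma2_left_incidences gamma2_right_incidences
    show "valid_data gamma2_left" "valid_data gamma2_right" by code_simp+
    show "fst ` set (fst (snd (incidences gamma2_left))) = fst ` set (fst (snd (incidences gamma2_right)))"
      unfolding inc by auto
    fix up dn :: "'a \<Rightarrow> 'a \<Rightarrow> 'a" assume "bikei X up dn"
    then interpret bikei X up dn .
    show "continues X up dn (incidences gamma2_left) (incidences gamma2_right)
        (\<lambda>lab. [lab 2, lab 5])"
      unfolding inc by (auto simp: continues_def determined_def crossing_simps)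
    show "continues X up dn (incidences gamma2_right) (incidences gamma2_left)
        (\<lambda>lab. [lab 0, dn (lab 0) (lab 1), lab 0, lab 1, up (lab 1) (lab 0), lab 1])"
      unfolding inc by (auto simp: continues_def determined_def crossing_simps)
    show "determined X up dn (incidences gamma2_left)"
      unfolding inc by (auto simp: continues_def determined_def crossing_simps)
    show "determined X up dn (incidences gamma2_right)"
      unfolding inc by (auto simp: continues_def determined_def crossing_simps)
  qed
  then show ?thesis
    by (simp add: picture_of_def picture_def quarter_def gamma2_left_def gamma2_right_def)
qed

definition gamma3_left :: presentation_data where
  "gamma3_left =
    ([[(-16, -12), (-12, -12), (12, 12), (16, 12)], [(-16, 12), (-12, 12), (12, -12), (16, -12)], [(-16, 0), (-12, 4), (12, 4), (16, 0)]],
     [[[(-16, -12), (-12, -12), (0, 0)], [(0, 0), (4, 4)], [(4, 4), (12, 12), (16, 12)]], [[(-16, 12), (-12, 12), (-4, 4)], [(-4, 4), (0, 0)], [(0, 0), (12, -12), (16, -12)]], [[(-16, 0), (-12, 4), (-4, 4)], [(-4, 4), (4, 4)], [(4, 4), (12, 4), (16, 0)]]],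
     [((0, 0), (2, 2), (2, -2), 1, 5, 0, 4), ((-4, 4), (2, 0), (2, -2), 7, 4, 6, 3), ((4, 4), (2, 0), (2, 2), 8, 2, 7, 1)],
     [])"

definition gamma3_right :: presentation_data where
  "gamma3_right =
    ([[(-16, -12), (-12, -12), (12, 12), (16, 12)], [(-16, 12), (-12, 12), (12, -12), (16, -12)], [(-16, 0), (-12, -4), (12, -4), (16, 0)]],
     [[[(-16, -12), (-12, -12), (-4, -4)], [(-4, -4), (0, 0)], [(0, 0), (12, 12), (16, 12)]], [[(-16, 12), (-12, 12), (0, 0)], [(0, 0), (4, -4)], [(4, -4), (12, -12), (16, -12)]], [[(-16, 0), (-12, -4), (-4, -4)], [(-4, -4), (4, -4)], [(4, -4), (12, -4), (16, 0)]]],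
     [((0, 0), (2, 2), (2, -2), 2, 4, 1, 3), ((-4, -4), (2, 0), (2, 2), 7, 1, 6, 0), ((4, -4), (2, 0), (2, -2), 8, 5, 7, 4)],
     [])"

lemma gamma3_left_incidences: "incidences gamma3_left =
    ([0, 1, 2, 3, 4, 5, 6, 7, 8], [((-16, -12), 0), ((16, 12), 2), ((-16, 12), 3), ((16, -12), 5), ((-16, 0), 6), ((16, 0), 8)],
     [(1, 5, 0, 4), (7, 4, 6, 3), (8, 2, 7, 1)], [])"
  by code_simp

lemma gamma3_right_incidences: "incidences gamma3_right =
    ([0, 1, 2, 3, 4, 5, 6, 7, 8], [((-16, -12), 0), ((16, 12), 2), ((-16, 12), 3), ((16, -12), 5), ((-16, 0), 6), ((16, 0), 8)],
     [(2, 4, 1, 3), (7, 1, 6, 0), (8, 5, 7, 4)], [])"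
  by code_simp

lemma gamma3_labeling_preserving:
  "labeling_preserving X
     (tangle [[(-4,-3), (-3,-3), (3,3), (4,3)], [(-4,3), (-3,3), (3,-3), (4,-3)],
      [(-4,0), (-3,1), (3,1), (4,0)]]
      [((0,0), (1/2,1/2)), ((-1,1), (1/2,0)), ((1,1), (1/2,0))] [])
     (tangle [[(-4,-3), (-3,-3), (3,3), (4,3)], [(-4,3), (-3,3), (3,-3), (4,-3)],
      [(-4,0), (-3,-1), (3,-1), (4,0)]]
      [((0,0), (1/2,1/2)), ((-1,-1), (1/2,0)), ((1,-1), (1/2,0))] [])"
proof -
  have "labeling_preserving X (picture_of gamma3_left) (picture_of gamma3_right)"
  proof (rule labeling_preserving_pictures)
    note inc = gamma3_left_incidences gamma3_right_incidences
    show "valid_data gamma3_left" "valid_data gamma3_right" by code_simp+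
    show "fst ` set (fst (snd (incidences gamma3_left))) = fst ` set (fst (snd (incidences gamma3_right)))"
      unfolding inc by auto
    fix up dn :: "'a \<Rightarrow> 'a \<Rightarrow> 'a" assume "bikei X up dn"
    then interpret bikei X up dn .
    show "continues X up dn (incidences gamma3_left) (incidences gamma3_right)
        (\<lambda>lab. [lab 0, dn (lab 2) (up (lab 5) (lab 8)), lab 2, lab 3, up (lab 5) (lab 8), lab 5, lab 6, dn (lab 8) (lab 5), lab 8])"
      unfolding inc by (auto simp: continues_def crossing_simps reidemeister3)
    show "continues X up dn (incidences gamma3_right) (incidences gamma3_left)
        (\<lambda>lab. [lab 0, up (lab 2) (lab 8), lab 2, lab 3, up (lab 5) (up (lab 2) (lab 8)), lab 5, lab 6, dn (lab 8) (lab 2), lab 8])"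
      unfolding inc by (auto simp: continues_def crossing_simps reidemeister3)
    show "determined X up dn (incidences gamma3_left)"
      unfolding inc by (auto simp: continues_def determined_def crossing_simps)
    show "determined X up dn (incidences gamma3_right)"
      unfolding inc by (auto simp: continues_def determined_def crossing_simps)
  qed
  then show ?thesis
    by (simp add: picture_of_def picture_def quarter_def gamma3_left_def gamma3_right_def)
qed

definition gamma4_left :: presentation_data where
  "gamma4_left =
    ([[(-16, -12), (-12, -12), (12, 12), (16, 12)], [(-16, 12), (-12, 12), (12, -12), (16, -12)], [(-16, 0), (-12, 4), (12, 4), (16, 0)]],
     [[[(-16, -12), (-12, -12), (0, 0)], [(0, 0), (4, 4)], [(4, 4), (12, 12), (16, 12)]], [[(-16, 12), (-12, 12), (-4, 4)], [(-4, 4), (0, 0)], [(0, 0), (12, -12), (16, -12)]], [[(-16, 0), (-12, 4), (-4, 4)], [(-4, 4), (4, 4)], [(4, 4), (12, 4), (16, 0)]]],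
     [((-4, 4), (2, 0), (2, -2), 7, 4, 6, 3), ((4, 4), (2, 0), (2, 2), 8, 2, 7, 1)],
     [((0, 0), (2, 2), (-2, 2), 1, 4, 0, 5)])"

definition gamma4_right :: presentation_data where
  "gamma4_right =
    ([[(-16, -12), (-12, -12), (12, 12), (16, 12)], [(-16, 12), (-12, 12), (12, -12), (16, -12)], [(-16, 0), (-12, -4), (12, -4), (16, 0)]],
     [[[(-16, -12), (-12, -12), (-4, -4)], [(-4, -4), (0, 0)], [(0, 0), (12, 12), (16, 12)]], [[(-16, 12), (-12, 12), (0, 0)], [(0, 0), (4, -4)], [(4, -4), (12, -12), (16, -12)]], [[(-16, 0), (-12, -4), (-4, -4)], [(-4, -4), (4, -4)], [(4, -4), (12, -4), (16, 0)]]],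
     [((-4, -4), (2, 0), (2, 2), 7, 1, 6, 0), ((4, -4), (2, 0), (2, -2), 8, 5, 7, 4)],
     [((0, 0), (2, 2), (-2, 2), 2, 3, 1, 4)])"

lemma gamma4_left_incidences: "incidences gamma4_left =
    ([0, 1, 2, 3, 4, 5, 6, 7, 8], [((-16, -12), 0), ((16, 12), 2), ((-16, 12), 3), ((16, -12), 5), ((-16, 0), 6), ((16, 0), 8)],
     [(7, 4, 6, 3), (8, 2, 7, 1)], [(1, 4, 0, 5)])"
  by code_simp

lemma gamma4_right_incidences: "incidences gamma4_right =
    ([0, 1, 2, 3, 4, 5, 6, 7, 8], [((-16, -12), 0), ((16, 12), 2), ((-16, 12), 3), ((16, -12), 5), ((-16, 0), 6), ((16, 0), 8)],
     [(7, 1, 6, 0), (8, 5, 7, 4)], [(2, 3, 1, 4)])"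
  by code_simp

lemma gamma4_labeling_preserving:
  "labeling_preserving X
     (tangle [[(-4,-3), (-3,-3), (3,3), (4,3)], [(-4,3), (-3,3), (3,-3), (4,-3)],
      [(-4,0), (-3,1), (3,1), (4,0)]]
      [((-1,1), (1/2,0)), ((1,1), (1/2,0))] [((0,0), (1/2,1/2), (-1/2,1/2))])
     (tangle [[(-4,-3), (-3,-3), (3,3), (4,3)], [(-4,3), (-3,3), (3,-3), (4,-3)],
      [(-4,0), (-3,-1), (3,-1), (4,0)]]
      [((-1,-1), (1/2,0)), ((1,-1), (1/2,0))] [((0,0), (1/2,1/2), (-1/2,1/2))])"
proof -
  have "labeling_preserving X (picture_of gamma4_left) (picture_of gamma4_right)"
  proof (rule labeling_preserving_pictures)
    note inc = gamma4_left_incidences gamma4_right_incidences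
    show "valid_data gamma4_left" "valid_data gamma4_right" by code_simp+
    show "fst ` set (fst (snd (incidences gamma4_left))) = fst ` set (fst (snd (incidences gamma4_right)))"
      unfolding inc by auto
    fix up dn :: "'a \<Rightarrow> 'a \<Rightarrow> 'a" assume "bikei X up dn"
    then interpret bikei X up dn .
    show "continues X up dn (incidences gamma4_left) (incidences gamma4_right)
        (\<lambda>lab. [lab 0, up (lab 5) (lab 8), lab 2, lab 3, up (lab 5) (lab 8), lab 5, lab 6, dn (lab 8) (lab 5), lab 8])"
      unfolding inc by (auto simp: continues_def determined_def crossing_simps)
    show "continues X up dn (incidences gamma4_right) (incidences gamma4_left)
        (\<lambda>lab. [lab 0, up (lab 2) (lab 8), lab 2, lab 3, up (lab 2) (lab 8), lab 5, lab 6, dn (lab 8) (lab 2), lab 8])"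
      unfolding inc by (auto simp: continues_def determined_def crossing_simps)
    show "determined X up dn (incidences gamma4_left)"
      unfolding inc by (auto simp: continues_def determined_def crossing_simps)
    show "determined X up dn (incidences gamma4_right)"
      unfolding inc by (auto simp: continues_def determined_def crossing_simps)
  qed
  then show ?thesis
    by (simp add: picture_of_def picture_def quarter_def gamma4_left_def gamma4_right_def)
qed

definition gamma5_left :: presentation_data where
  "gamma5_left =
    ([[(-16, 8), (-8, 0), (0, -8), (16, 8)], [(-16, -8), (-8, 0), (0, 8), (16, -8)]],
     [[[(-16, 8), (-8, 0)], [(-8, 0), (0, -8), (8, 0)], [(8, 0), (16, 8)]], [[(-16, -8), (-8, 0)], [(-8, 0), (0, 8), (8, 0)], [(8, 0), (16, -8)]]],
     [((8, 0), (2, 2), (2, -2), 2, 5, 1, 4)],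
     [((-8, 0), (2, 2), (-2, 2), 4, 0, 3, 1)])"

definition gamma5_right :: presentation_data where
  "gamma5_right =
    ([[(-16, 8), (0, -8), (8, 0), (16, 8)], [(-16, -8), (0, 8), (8, 0), (16, -8)]],
     [[[(-16, 8), (-8, 0)], [(-8, 0), (0, -8), (8, 0)], [(8, 0), (16, 8)]], [[(-16, -8), (-8, 0)], [(-8, 0), (0, 8), (8, 0)], [(8, 0), (16, -8)]]],
     [((-8, 0), (2, 2), (2, -2), 4, 1, 3, 0)],
     [((8, 0), (2, 2), (-2, 2), 2, 4, 1, 5)])"

lemma gamma5_left_incidences: "incidences gamma5_left =
    ([0, 1, 2, 3, 4, 5], [((-16, 8), 0), ((16, 8), 2), ((-16, -8), 3), ((16, -8), 5)],
     [(2, 5, 1, 4)], [(4, 0, 3, 1)])"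
  by code_simp

lemma gamma5_right_incidences: "incidences gamma5_right =
    ([0, 1, 2, 3, 4, 5], [((-16, 8), 0), ((16, 8), 2), ((-16, -8), 3), ((16, -8), 5)],
     [(4, 1, 3, 0)], [(2, 4, 1, 5)])"
  by code_simp

lemma gamma5_labeling_preserving:
  "labeling_preserving X
     (tangle [[(-4,2), (-2,0), (0,-2), (4,2)], [(-4,-2), (-2,0), (0,2), (4,-2)]]
      [((2,0), (1/2,1/2))] [((-2,0), (1/2,1/2), (-1/2,1/2))])
     (tangle [[(-4,2), (0,-2), (2,0), (4,2)], [(-4,-2), (0,2), (2,0), (4,-2)]]
      [((-2,0), (1/2,1/2))] [((2,0), (1/2,1/2), (-1/2,1/2))])"
proof -
  have "labeling_preserving X (picture_of gamma5_left) (picture_of gamma5_right)"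
  proof (rule labeling_preserving_pictures)
    note inc = gamma5_left_incidences gamma5_right_incidences
    show "valid_data gamma5_left" "valid_data gamma5_right" by code_simp+
    show "fst ` set (fst (snd (incidences gamma5_left))) = fst ` set (fst (snd (incidences gamma5_right)))"
      unfolding inc by auto
    fix up dn :: "'a \<Rightarrow> 'a \<Rightarrow> 'a" assume "bikei X up dn"
    then interpret bikei X up dn .
    show "continues X up dn (incidences gamma5_left) (incidences gamma5_right)
        (\<lambda>lab. [lab 0, lab 2, lab 2, lab 3, lab 2, lab 5])"
      unfolding inc by (auto simp: continues_def crossing_simps) (metis twist_equal)+
    show "continues X up dn (incidences gamma5_right) (incidences gamma5_left)
        (\<lambda>lab. [lab 0, lab 0, lab 2, lab 3, lab 0, lab 5])"
      unfolding inc by (auto simp: continues_def crossing_simps curl diagonal)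
    show "determined X up dn (incidences gamma5_left)"
      unfolding inc by (auto simp: continues_def determined_def crossing_simps)
    show "determined X up dn (incidences gamma5_right)"
      unfolding inc by (auto simp: continues_def determined_def crossing_simps)
  qed
  then show ?thesis
    by (simp add: picture_of_def picture_def quarter_def gamma5_left_def gamma5_right_def)
qed

definition gamma6_left :: presentation_data where
  "gamma6_left =
    ([[(-16, -8), (-8, -8), (8, 8), (8, -8), (-8, 8), (-16, 8)]],
     [[[(-16, -8), (-8, -8), (0, 0)], [(0, 0), (8, 8), (8, -8), (0, 0)], [(0, 0), (-8, 8), (-16, 8)]]],
     [],
     [((0, 0), (2, 2), (-2, 2), 1, 2, 0, 1)])"

definition gamma6_right :: presentation_data where
  "gamma6_right =
    ([[(-16, -8), (-8, -8), (-8, 8), (-16, 8)]],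
     [[[(-16, -8), (-8, -8), (-8, 8), (-16, 8)]]],
     [],
     [])"

lemma gamma6_left_incidences: "incidences gamma6_left =
    ([0, 1, 2], [((-16, -8), 0), ((-16, 8), 2)],
     [], [(1, 2, 0, 1)])"
  by code_simp

lemma gamma6_right_incidences: "incidences gamma6_right =
    ([0], [((-16, -8), 0), ((-16, 8), 0)],
     [], [])"
  by code_simp

lemma gamma6_labeling_preserving:
  "labeling_preserving X
     (tangle [[(-4,-2), (-2,-2), (2,2), (2,-2), (-2,2), (-4,2)]] []
      [((0,0), (1/2,1/2), (-1/2,1/2))])
     (tangle [[(-4,-2), (-2,-2), (-2,2), (-4,2)]] [] [])"
proof -
  have "labeling_preserving X (picture_of gamma6_left) (picture_of gamma6_right)"
  proof (rule labeling_preserving_pictures)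
    note inc = gamma6_left_incidences gamma6_right_incidences
    show "valid_data gamma6_left" "valid_data gamma6_right" by code_simp+
    show "fst ` set (fst (snd (incidences gamma6_left))) = fst ` set (fst (snd (incidences gamma6_right)))"
      unfolding inc by auto
    fix up dn :: "'a \<Rightarrow> 'a \<Rightarrow> 'a" assume "bikei X up dn"
    then interpret bikei X up dn .
    show "continues X up dn (incidences gamma6_left) (incidences gamma6_right)
        (\<lambda>lab. [lab 0])"
      unfolding inc by (auto simp: continues_def determined_def crossing_simps)
    show "continues X up dn (incidences gamma6_right) (incidences gamma6_left)
        (\<lambda>lab. [lab 0, lab 0, lab 0])"
      unfolding inc by (auto simp: continues_def determined_def crossing_simps)
    show "determined X up dn (incidences gamma6_left)"
      unfolding inc by (auto simp: continues_def determined_def crossing_simps)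
    show "determined X up dn (incidences gamma6_right)"
      unfolding inc by (auto simp: continues_def determined_def crossing_simps)
  qed
  then show ?thesis
    by (simp add: picture_of_def picture_def quarter_def gamma6_left_def gamma6_right_def)
qed

definition gamma7_left :: presentation_data where
  "gamma7_left =
    ([[(-8, 16), (-8, -16)], [(8, -16), (8, 16)], [(-16, 0), (16, 0)]],
     [[[(-8, 16), (-8, 0)], [(-8, 0), (-8, -16)]], [[(8, -16), (8, 0)], [(8, 0), (8, 16)]], [[(-16, 0), (-8, 0)], [(-8, 0), (8, 0)], [(8, 0), (16, 0)]]],
     [],
     [((-8, 0), (0, 4), (-4, 0), 0, 4, 1, 5), ((8, 0), (4, 0), (0, 4), 6, 3, 5, 2)])"

definition gamma7_right :: presentation_data where
  "gamma7_right =
    ([[(-16, 0), (8, -16)], [(16, 0), (-8, 16)], [(-8, -16), (8, 16)]],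
     [[[(-16, 0), (-4, -8)], [(-4, -8), (8, -16)]], [[(16, 0), (4, 8)], [(4, 8), (-8, 16)]], [[(-8, -16), (-4, -8)], [(-4, -8), (4, 8)], [(4, 8), (8, 16)]]],
     [],
     [((-4, -8), (-1, -2), (3, -2), 4, 1, 5, 0), ((4, 8), (3, -2), (1, 2), 2, 6, 3, 5)])"

lemma gamma7_left_incidences: "incidences gamma7_left =
    ([0, 1, 2, 3, 4, 5, 6], [((-8, 16), 0), ((-8, -16), 1), ((8, -16), 2), ((8, 16), 3), ((-16, 0), 4), ((16, 0), 6)],
     [], [(0, 4, 1, 5), (6, 3, 5, 2)])"
  by code_simp

lemma gamma7_right_incidences: "incidences gamma7_right =
    ([0, 1, 2, 3, 4, 5, 6], [((-16, 0), 0), ((8, -16), 1), ((16, 0), 2), ((-8, 16), 3), ((-8, -16), 4), ((8, 16), 6)],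
     [], [(4, 1, 5, 0), (2, 6, 3, 5)])"
  by code_simp

lemma gamma7_labeling_preserving:
  "labeling_preserving X
     (tangle [[(-2,4), (-2,-4)], [(2,-4), (2,4)], [(-4,0), (4,0)]] []
      [((-2,0), (0,1), (-1,0)), ((2,0), (1,0), (0,1))])
     (tangle [[(-4,0), (2,-4)], [(4,0), (-2,4)], [(-2,-4), (2,4)]] []
      [((-1,-2), (-1/4,-1/2), (3/4,-1/2)), ((1,2), (3/4,-1/2), (1/4,1/2))])"
proof -
  have "labeling_preserving X (picture_of gamma7_left) (picture_of gamma7_right)"
  proof (rule labeling_preserving_pictures)
    note inc = gamma7_left_incidences gamma7_right_incidences
    show "valid_data gamma7_left" "valid_data gamma7_right" by code_simp+
    show "fst ` set (fst (snd (incidences gamma7_left))) = fst ` set (fst (snd (incidences gamma7_right)))"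
      unfolding inc by auto
    fix up dn :: "'a \<Rightarrow> 'a \<Rightarrow> 'a" assume "bikei X up dn"
    then interpret bikei X up dn .
    show "continues X up dn (incidences gamma7_left) (incidences gamma7_right)
        (\<lambda>lab. replicate 7 (lab 0))"
      unfolding inc by (auto simp: continues_def determined_def crossing_simps)
    show "continues X up dn (incidences gamma7_right) (incidences gamma7_left)
        (\<lambda>lab. replicate 7 (lab 0))"
      unfolding inc by (auto simp: continues_def determined_def crossing_simps)
    show "determined X up dn (incidences gamma7_left)"
      unfolding inc by (auto simp: continues_def determined_def crossing_simps)
    show "determined X up dn (incidences gamma7_right)"
      unfolding inc by (auto simp: continues_def determined_def crossing_simps)
  qed
  then show ?thesis
    by (simp add: picture_of_def picture_def quarter_def gamma7_left_def gamma7_right_def)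
qed

definition gamma8_left :: presentation_data where
  "gamma8_left =
    ([[(-12, 16), (-12, 12), (12, -12), (12, -16)], [(12, 16), (12, 12), (-12, -12), (-12, -16)], [(-16, -4), (-12, 0), (-10, 2), (-10, 8), (12, 8), (16, 4)], [(-16, 4), (-12, 0), (-10, -2), (-8, -2), (-8, 4), (8, 4), (8, -4), (16, -4)]],
     [[[(-12, 16), (-12, 12), (-8, 8)], [(-8, 8), (-4, 4)], [(-4, 4), (0, 0)], [(0, 0), (12, -12), (12, -16)]], [[(12, 16), (12, 12), (8, 8)], [(8, 8), (4, 4)], [(4, 4), (0, 0)], [(0, 0), (-12, -12), (-12, -16)]], [[(-16, -4), (-12, 0)], [(-12, 0), (-10, 2), (-10, 8), (-8, 8)], [(-8, 8), (8, 8)], [(8, 8), (12, 8), (16, 4)]], [[(-16, 4), (-12, 0)], [(-12, 0), (-10, -2), (-8, -2), (-8, 4), (-4, 4)], [(-4, 4), (4, 4)], [(4, 4), (8, 4), (8, -4), (16, -4)]]],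
     [((-8, 8), (1, 0), (1, -1), 10, 1, 9, 0), ((-4, 4), (1, 0), (1, -1), 14, 2, 13, 1), ((4, 4), (1, 1), (1, 0), 5, 15, 6, 14), ((8, 8), (1, 1), (1, 0), 4, 11, 5, 10)],
     [((0, 0), (1, 1), (-1, 1), 6, 2, 7, 3), ((-12, 0), (1, 1), (1, -1), 9, 13, 8, 12)])"

definition gamma8_right :: presentation_data where
  "gamma8_right =
    ([[(-12, 16), (-12, 12), (12, -12), (12, -16)], [(12, 16), (12, 12), (-12, -12), (-12, -16)], [(-16, -4), (-12, 0), (-10, 2), (-8, 2), (-8, -4), (8, -4), (8, 4), (16, 4)], [(-16, 4), (-12, 0), (-10, -2), (-10, -8), (12, -8), (16, -4)]],
     [[[(-12, 16), (-12, 12), (0, 0)], [(0, 0), (4, -4)], [(4, -4), (8, -8)], [(8, -8), (12, -12), (12, -16)]], [[(12, 16), (12, 12), (0, 0)], [(0, 0), (-4, -4)], [(-4, -4), (-8, -8)], [(-8, -8), (-12, -12), (-12, -16)]], [[(-16, -4), (-12, 0)], [(-12, 0), (-10, 2), (-8, 2), (-8, -4), (-4, -4)], [(-4, -4), (4, -4)], [(4, -4), (8, -4), (8, 4), (16, 4)]], [[(-16, 4), (-12, 0)], [(-12, 0), (-10, -2), (-10, -8), (-8, -8)], [(-8, -8), (8, -8)], [(8, -8), (12, -8), (16, -4)]]],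
     [((-8, -8), (1, 0), (1, 1), 14, 6, 13, 7), ((-4, -4), (1, 0), (1, 1), 10, 5, 9, 6), ((4, -4), (1, -1), (1, 0), 2, 11, 1, 10), ((8, -8), (1, -1), (1, 0), 3, 15, 2, 14)],
     [((0, 0), (1, 1), (-1, 1), 4, 0, 5, 1), ((-12, 0), (1, 1), (1, -1), 9, 13, 8, 12)])"

lemma gamma8_left_incidences: "incidences gamma8_left =
    ([0, 1, 2, 3, 4, 5, 6, 7, 8, 9, 10, 11, 12, 13, 14, 15], [((-12, 16), 0), ((12, -16), 3), ((12, 16), 4), ((-12, -16), 7), ((-16, -4), 8), ((16, 4), 11), ((-16, 4), 12), ((16, -4), 15)],
     [(10, 1, 9, 0), (14, 2, 13, 1), (5, 15, 6, 14), (4, 11, 5, 10)], [(6, 2, 7, 3), (9, 13, 8, 12)])"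
  by code_simp

lemma gamma8_right_incidences: "incidences gamma8_right =
    ([0, 1, 2, 3, 4, 5, 6, 7, 8, 9, 10, 11, 12, 13, 14, 15], [((-12, 16), 0), ((12, -16), 3), ((12, 16), 4), ((-12, -16), 7), ((-16, -4), 8), ((16, 4), 11), ((-16, 4), 12), ((16, -4), 15)],
     [(14, 6, 13, 7), (10, 5, 9, 6), (2, 11, 1, 10), (3, 15, 2, 14)], [(4, 0, 5, 1), (9, 13, 8, 12)])"
  by code_simp

text \<open>Everything is determined by the label \<open>m\<close> of the saddle \<open>v\<^sub>1\<close> and the label \<open>c\<close> of \<open>v\<^sub>2\<close>: the
  parallel strands do not change the edges of \<open>v\<^sub>1\<close> that they pass. The picture on the other side of the move
  is the same with the pair of upper edges replaced by the lower ones, so all end points get the same labels.\<close>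

lemma (in bikei) gamma8_left_colors:
  assumes "colors X up dn (incidences gamma8_left) lab"
  defines "m \<equiv> lab 3" and "c \<equiv> lab 8"
  shows "m \<in> X" "c \<in> X" "lab 0 = m" "lab 1 = up m (dn c m)" "lab 2 = m" "lab 3 = m"
    "lab 4 = m" "lab 5 = dn m (up (dn c m) m)" "lab 6 = m" "lab 7 = m"
    "lab 8 = c" "lab 9 = c" "lab 10 = dn c m" "lab 11 = up (dn c m) m"
    "lab 12 = c" "lab 13 = c" "lab 14 = dn c m" "lab 15 = up (dn c m) m"
proof -
  have X: "lab j \<in> X" if "j \<in> {2, 3, 4, 5, 8, 10, 11, 14, 15}" for j
    using colors_mem[OF assms(1), of j] that unfolding gamma8_left_incidences by auto
  have e: "lab 10 = up (lab 11) (lab 4)" "lab 5 = dn (lab 4) (lab 11)" "lab 14 = up (lab 15) (lab 5)"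
    "m = dn (lab 5) (lab 15)" "lab 0 = up (lab 1) (lab 10)" "c = dn (lab 10) (lab 1)"
    "lab 1 = up m (lab 14)" "c = dn (lab 14) m"
    and same: "lab 2 = m" "lab 6 = m" "lab 7 = m" "lab 9 = c" "lab 12 = c" "lab 13 = c"
    using assms(1) unfolding gamma8_left_incidences m_def c_def by auto
  have mc: "m \<in> X" "c \<in> X" unfolding m_def c_def by (simp_all add: X)
  note over = parallel_over[OF mc(1) X X e(7) e(5) e(6) e(8), simplified]
  have d: "lab 10 = up (lab 15) (lab 5)" using e(3) over by simp
  note under = parallel_under[OF X X X e(1) e(2) d e(4), simplified]
  show "m \<in> X" "c \<in> X" "lab 0 = m" "lab 1 = up m (dn c m)" "lab 2 = m" "lab 3 = m"
    "lab 4 = m" "lab 5 = dn m (up (dn c m) m)" "lab 6 = m" "lab 7 = m"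
    "lab 8 = c" "lab 9 = c" "lab 10 = dn c m" "lab 11 = up (dn c m) m"
    "lab 12 = c" "lab 13 = c" "lab 14 = dn c m" "lab 15 = up (dn c m) m"
    using mc same over under by (simp_all add: m_def[symmetric] c_def[symmetric])
qed

lemma (in bikei) gamma8_right_colors:
  assumes "colors X up dn (incidences gamma8_right) lab"
  defines "m \<equiv> lab 4" and "c \<equiv> lab 8"
  shows "m \<in> X" "c \<in> X" "lab 0 = m" "lab 1 = m" "lab 2 = dn m (up (dn c m) m)" "lab 3 = m"
    "lab 4 = m" "lab 5 = m" "lab 6 = up m (dn c m)" "lab 7 = m"
    "lab 8 = c" "lab 9 = c" "lab 10 = dn c m" "lab 11 = up (dn c m) m"
    "lab 12 = c" "lab 13 = c" "lab 14 = dn c m" "lab 15 = up (dn c m) m"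
proof -
  have X: "lab j \<in> X" if "j \<in> {2, 3, 4, 5, 8, 10, 11, 14, 15}" for j
    using colors_mem[OF assms(1), of j] that unfolding gamma8_right_incidences by auto
  have e: "lab 14 = up (lab 15) (lab 3)" "lab 2 = dn (lab 3) (lab 15)" "lab 10 = up (lab 11) (lab 2)"
    "m = dn (lab 2) (lab 11)" "lab 7 = up (lab 6) (lab 14)" "c = dn (lab 14) (lab 6)"
    "lab 6 = up m (lab 10)" "c = dn (lab 10) m"
    and same: "lab 0 = m" "lab 1 = m" "lab 5 = m" "lab 9 = c" "lab 12 = c" "lab 13 = c"
    using assms(1) unfolding gamma8_right_incidences m_def c_def by auto
  have mc: "m \<in> X" "c \<in> X" unfolding m_def c_def by (simp_all add: X)
  note over = parallel_over[OF mc(1) X X e(7) e(5) e(6) e(8), simplified]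
  have d: "lab 14 = up (lab 11) (lab 2)" using e(3) over by simp
  note under = parallel_under[OF X X X e(1) e(2) d e(4), simplified]
  show "m \<in> X" "c \<in> X" "lab 0 = m" "lab 1 = m" "lab 2 = dn m (up (dn c m) m)" "lab 3 = m"
    "lab 4 = m" "lab 5 = m" "lab 6 = up m (dn c m)" "lab 7 = m"
    "lab 8 = c" "lab 9 = c" "lab 10 = dn c m" "lab 11 = up (dn c m) m"
    "lab 12 = c" "lab 13 = c" "lab 14 = dn c m" "lab 15 = up (dn c m) m"
    using mc same over under by (simp_all add: m_def[symmetric] c_def[symmetric])
qed

lemma gamma8_labeling_preserving:
  "labeling_preserving X
     (tangle [[(-3,4), (-3,3), (3,-3), (3,-4)], [(3,4), (3,3), (-3,-3), (-3,-4)],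
      [(-4,-1), (-3,0), (-5/2,1/2), (-5/2,2), (3,2), (4,1)],
      [(-4,1), (-3,0), (-5/2,-1/2), (-2,-1/2), (-2,1), (2,1), (2,-1), (4,-1)]]
      [((-2,2), (1/4,0)), ((-1,1), (1/4,0)), ((1,1), (1/4,1/4)), ((2,2), (1/4,1/4))]
      [((0,0), (1/4,1/4), (-1/4,1/4)), ((-3,0), (1/4,1/4), (1/4,-1/4))])
     (tangle [[(-3,4), (-3,3), (3,-3), (3,-4)], [(3,4), (3,3), (-3,-3), (-3,-4)],
      [(-4,-1), (-3,0), (-5/2,1/2), (-2,1/2), (-2,-1), (2,-1), (2,1), (4,1)],
      [(-4,1), (-3,0), (-5/2,-1/2), (-5/2,-2), (3,-2), (4,-1)]]
      [((-2,-2), (1/4,0)), ((-1,-1), (1/4,0)), ((1,-1), (1/4,-1/4)), ((2,-2), (1/4,-1/4))]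
      [((0,0), (1/4,1/4), (-1/4,1/4)), ((-3,0), (1/4,1/4), (1/4,-1/4))])"
proof -
  have "labeling_preserving X (picture_of gamma8_left) (picture_of gamma8_right)"
  proof (rule labeling_preserving_pictures)
    note inc = gamma8_left_incidences gamma8_right_incidences
    show "valid_data gamma8_left" "valid_data gamma8_right" by code_simp+
    show "fst ` set (fst (snd (incidences gamma8_left))) = fst ` set (fst (snd (incidences gamma8_right)))"
      unfolding inc by auto
    fix up dn :: "'a \<Rightarrow> 'a \<Rightarrow> 'a" assume "bikei X up dn"
    then interpret bikei X up dn .
    show "continues X up dn (incidences gamma8_left) (incidences gamma8_right)
        (\<lambda>lab. [lab 3, lab 3, dn (lab 3) (up (dn (lab 8) (lab 3)) (lab 3)), lab 3, lab 3, lab 3, up (lab 3) (dn (lab 8) (lab 3)), lab 3, lab 8, lab 8, dn (lab 8) (lab 3), up (dn (lab 8) (lab 3)) (lab 3), lab 8, lab 8, dn (lab 8) (lab 3), up (dn (lab 8) (lab 3)) (lab 3)])"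
      unfolding continues_def
    proof (intro allI impI, goal_cases)
      case (1 lab)
      from gamma8_left_colors[OF 1] show ?case unfolding inc by (simp add: crossing_simps)
    qed
    show "continues X up dn (incidences gamma8_right) (incidences gamma8_left)
        (\<lambda>lab. [lab 3, up (lab 3) (dn (lab 8) (lab 3)), lab 3, lab 3, lab 3, dn (lab 3) (up (dn (lab 8) (lab 3)) (lab 3)), lab 3, lab 3, lab 8, lab 8, dn (lab 8) (lab 3), up (dn (lab 8) (lab 3)) (lab 3), lab 8, lab 8, dn (lab 8) (lab 3), up (dn (lab 8) (lab 3)) (lab 3)])"
      unfolding continues_def
    proof (intro allI impI, goal_cases)
      case (1 lab)
      from gamma8_right_colors[OF 1] show ?case unfolding inc by (simp add: crossing_simps)
    qed
    show "determined X up dn (incidences gamma8_left)"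
      unfolding determined_def
    proof (intro allI impI)
      fix lab lab' assume c: "colors X up dn (incidences gamma8_left) lab" and c': "colors X up dn (incidences gamma8_left) lab'"
        and b: "list_all (\<lambda>(b, j). lab j = lab' j) (fst (snd (incidences gamma8_left)))"
      have "lab 3 = lab' 3" "lab 4 = lab' 4" "lab 8 = lab' 8" using b unfolding inc by simp_all
      then show "list_all (\<lambda>j. lab j = lab' j) (fst (incidences gamma8_left))"
        using gamma8_left_colors[OF c] gamma8_left_colors[OF c'] unfolding inc by simp
    qed
    show "determined X up dn (incidences gamma8_right)"
      unfolding determined_def
    proof (intro allI impI)
      fix lab lab' assume c: "colors X up dn (incidences gamma8_right) lab" and c': "colors X up dn (incidences gamma8_right) lab'"
        and b: "list_all (\<lambda>(b, j). lab j = lab' j) (fst (snd (incidences gamma8_right)))"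
      have "lab 3 = lab' 3" "lab 4 = lab' 4" "lab 8 = lab' 8" using b unfolding inc by simp_all
      then show "list_all (\<lambda>j. lab j = lab' j) (fst (incidences gamma8_right))"
        using gamma8_right_colors[OF c] gamma8_right_colors[OF c'] unfolding inc by simp
    qed
  qed
  then show ?thesis
    by (simp add: picture_of_def picture_def quarter_def gamma8_left_def gamma8_right_def)
qed

lemma yoshikawa_labeling_preserving: "yoshikawa L R \<Longrightarrow> labeling_preserving X L R"
proof (induction rule: yoshikawa.induct)
  case Gamma1 show ?case by (rule gamma1_labeling_preserving)
next
  case Gamma2 show ?case by (rule gamma2_labeling_preserving)
next
  case Gamma3 show ?case by (rule gamma3_labeling_preserving)
next
  case Gamma4 show ?case by (rule gamma4_labeling_preserving)
next
  case Gamma5 show ?case by (rule gamma5_labeling_preserving)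
next
  case Gamma6 show ?case by (rule gamma6_labeling_preserving)
next
  case Gamma7 show ?case by (rule gamma7_labeling_preserving)
next
  case Gamma8 show ?case by (rule gamma8_labeling_preserving)
next
  case (inverse_move L R) then show ?case by (simp add: labeling_preserving_sym)
next
  case (reflect L R) then show ?case by (simp add: labeling_preserving_cnj)
next
  case (switch L R) then show ?case by (simp add: labeling_preserving_switch)
next
  case (exchange L R) then show ?case by (simp add: labeling_preserving_exchange)
qed

lemma card_point_labelings_yoshikawa_move:
  assumes "bikei X up dn" and "yoshikawa_move D D'"
  shows "card (point_labelings X up dn D) = card (point_labelings X up dn D')"
  using card_point_labelings_labeling_preserving[OF yoshikawa_labeling_preserving assms(1)] assms(2)
  by (simp add: yoshikawa_move_def)

section \<open>Detour moves\<close>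

lemma vmv_closed: "vmv_diagram D \<Longrightarrow> closed (graph D)" "vmv_diagram D \<Longrightarrow> finite (vertices D)"
  unfolding vmv_diagram_def using compact_imp_closed by auto

text \<open>By the intermediate value theorem. An injective path through the centre takes values on both sides.\<close>

lemma path_covers_diameter:
  fixes \<phi> :: "complex \<Rightarrow> complex" and \<gamma> :: "real \<Rightarrow> complex"
  assumes \<phi>: "continuous_on (cball 0 1) \<phi>" "inj_on \<phi> (cball 0 1)"
    and \<gamma>: "continuous_on {a..b} \<gamma>" "inj_on \<gamma> {a..b}" and t: "a < t" "t < b" "\<gamma> t = \<phi> 0"
    and sub: "\<gamma> ` {a..b} \<subseteq> \<phi> ` {z \<in> cball 0 1. Im z = 0}"
  obtains \<eta> where "0 < \<eta>" "\<eta> \<le> 1" "\<And>z. norm z < \<eta> \<Longrightarrow> Im z = 0 \<Longrightarrow> \<phi> z \<in> \<gamma> ` {a..b}"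
proof -
  \<comment> \<open>The coordinate of the path on the diameter.\<close>
  define \<rho> where "\<rho> s = Re (inv_into (cball 0 1) \<phi> (\<gamma> s))" for s
  have \<rho>: "\<gamma> s = \<phi> (complex_of_real (\<rho> s))" "\<bar>\<rho> s\<bar> \<le> 1" if s: "s \<in> {a..b}" for s
  proof -
    obtain z where z: "z \<in> cball 0 1" "Im z = 0" "\<gamma> s = \<phi> z" using sub s by blast
    then have "inv_into (cball 0 1) \<phi> (\<gamma> s) = z" using inv_into_f_f[OF \<phi>(2)] by simp
    then have "complex_of_real (\<rho> s) = z" using z(2) by (simp add: \<rho>_def complex_eq_iff)
    then show "\<gamma> s = \<phi> (complex_of_real (\<rho> s))" "\<bar>\<rho> s\<bar> \<le> 1"
      using z by (simp_all flip: norm_of_real[where ?'a = complex])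
  qed
  have cont: "continuous_on {a..b} \<rho>" unfolding \<rho>_def
    by (intro continuous_intros continuous_on_compose2[OF inv_into_embedding[OF \<phi>] \<gamma>(1)]) (use sub in blast)
  have inj: "inj_on \<rho> {a..b}"
    using \<rho>(1) inj_onD[OF \<gamma>(2)] by (intro inj_onI) metis
  have "complex_of_real (\<rho> t) = 0"
    by (rule inj_onD[OF \<phi>(2)]) (use \<rho>[of t] t in \<open>auto simp: norm_of_real\<close>)
  then have \<rho>t: "\<rho> t = 0" by simp
  have mono: "\<rho> a < 0 \<and> 0 < \<rho> b \<or> \<rho> b < 0 \<and> 0 < \<rho> a"
    using continuous_inj_imp_mono[OF t(1,2) cont inj] \<rho>t by simp
  define \<eta> where "\<eta> = min (min \<bar>\<rho> a\<bar> \<bar>\<rho> b\<bar>) 1"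
  show thesis
  proof (rule that[of \<eta>])
    show "0 < \<eta>" using mono by (auto simp: \<eta>_def)
    show "\<eta> \<le> 1" by (simp add: \<eta>_def)
    fix z :: complex assume z: "norm z < \<eta>" "Im z = 0"
    define x where "x = Re z"
    have zx: "z = complex_of_real x" using z(2) by (simp add: x_def complex_eq_iff)
    then have x: "\<bar>x\<bar> < \<bar>\<rho> a\<bar>" "\<bar>x\<bar> < \<bar>\<rho> b\<bar>" using z(1) by (simp_all add: \<eta>_def)
    have "\<exists>s \<in> {a..b}. \<rho> s = x"
      using mono
    proof
      assume "\<rho> a < 0 \<and> 0 < \<rho> b"
      then have "\<rho> a \<le> x" "x \<le> \<rho> b" using x by linarith+
      then obtain s where "a \<le> s" "s \<le> b" "\<rho> s = x" using IVT'[of \<rho> a x b] t cont by auto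
      then show ?thesis by auto
    next
      assume "\<rho> b < 0 \<and> 0 < \<rho> a"
      then have "\<rho> b \<le> x" "x \<le> \<rho> a" using x by linarith+
      then obtain s where "a \<le> s" "s \<le> b" "\<rho> s = x" using IVT2'[of \<rho> b x a] t cont by auto
      then show ?thesis by auto
    qed
    then show "\<phi> z \<in> \<gamma> ` {a..b}" using \<rho>(1) zx by (metis image_eqI)
  qed
qed

lemma path_stays_in_open:
  fixes \<gamma> :: "real \<Rightarrow> complex"
  assumes "continuous_on {0..1} \<gamma>" "open U" "\<gamma> t \<in> U" "t \<in> {0..1}"
  obtains e where "0 < e" "\<forall>s \<in> {0..1}. \<bar>s - t\<bar> < e \<longrightarrow> \<gamma> s \<in> U"
proof -
  obtain A where A: "open A" "t \<in> A" "\<forall>s \<in> {0..1}. s \<in> A \<longrightarrow> \<gamma> s \<in> U"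
    using assms(1)[unfolded continuous_on_topological, rule_format, OF assms(4,2,3)] by blast
  then obtain e where e: "0 < e" "ball t e \<subseteq> A" using open_contains_ball by blast
  have *: "\<gamma> s \<in> U" if "s \<in> {0..1}" "\<bar>s - t\<bar> < e" for s
  proof -
    have "s \<in> ball t e" using that(2) by (simp add: dist_real_def abs_minus_commute)
    then show ?thesis using A(3) e(2) that(1) by blast
  qed
  show thesis by (rule that[OF e(1)]) (use * in blast)
qed

lemma real_axis_ray:
  assumes "Im z = 0" "z \<noteq> 0"
  obtains u where "u \<in> {1, -1}" "z = norm z *\<^sub>R u"
proof (cases "0 < Re z")
  case True
  then show thesis using that[of 1] assms by (auto simp: complex_eq_iff cmod_def)
next
  case False
  then show thesis using that[of "-1"] assms by (auto simp: complex_eq_iff cmod_def)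
qed

text \<open>At a virtual crossing the strand goes straight, so the labels just before and just after agree by
  the rule for virtual crossings. Hence the limit of the labels along the strand exists at every parameter and is locally
  constant on the interval.\<close>

lemma strand_label:
  assumes D: "vmv_diagram D" and str: "virtual_strand D \<gamma>" and g: "g \<in> point_labelings X up dn D"
  obtains c where "\<forall>p \<in> path_image \<gamma> - vertices D. g p = c"
proof -
  have path: "continuous_on {0..1} \<gamma>" "path_image \<gamma> \<subseteq> graph D - (classical D \<union> saddle D)"
    and ends: "\<gamma> 0 \<notin> virtual D" "\<gamma> 1 \<notin> virtual D"
    using str by (auto simp: virtual_strand_def path_def pathstart_def pathfinish_def)
  have in_graph: "\<gamma> s \<in> graph D" if "s \<in> {0..1}" for s using path(2) that unfolding path_image_def by blast
  have ex: "\<exists>c e. 0 < e \<and> (\<forall>s \<in> {0..1}. \<bar>s - t\<bar> < e \<longrightarrow> s \<noteq> t \<or> \<gamma> t \<notin> vertices D \<longrightarrow>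
      \<gamma> s \<notin> vertices D \<and> g (\<gamma> s) = c)" if t: "t \<in> {0..1}" for t
  proof (cases "\<gamma> t \<in> vertices D")
    case False
    then obtain U where U: "open U" "\<gamma> t \<in> U" "\<And>q. q \<in> graph D - vertices D \<Longrightarrow> q \<in> U \<Longrightarrow> g q = g (\<gamma> t)"
      using locally_const_onE[OF point_labelingsD(3)[OF g]] in_graph[OF t] by blast
    have op: "open (U - vertices D)" using U(1) vmv_closed(2)[OF D] finite_imp_closed by (intro open_Diff) auto
    have tU: "\<gamma> t \<in> U - vertices D" using U(2) False by blast
    obtain e where e: "0 < e" "\<forall>s \<in> {0..1}. \<bar>s - t\<bar> < e \<longrightarrow> \<gamma> s \<in> U - vertices D"
      by (rule path_stays_in_open[OF path(1) op tU t])
    then have "\<forall>s \<in> {0..1}. \<bar>s - t\<bar> < e \<longrightarrow> \<gamma> s \<notin> vertices D \<and> g (\<gamma> s) = g (\<gamma> t)"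
      using U(3) in_graph by blast
    then show ?thesis using e(1) by blast
  next
    case True
    then have vt: "\<gamma> t \<in> virtual D" using path(2) t unfolding vertices_def path_image_def by blast
    then have "t \<in> {0<..<1}" using ends t by (cases "t = 0 \<or> t = 1") auto
    then obtain \<phi> e where \<phi>: "virtual_chart D \<phi>" "\<phi> 0 = \<gamma> t" and e: "e > 0" "inj_on \<gamma> {t-e..t+e}"
      "\<gamma> ` {t-e..t+e} \<subseteq> \<phi> ` {z \<in> cball 0 1. Im z = 0}"
      using str vt unfolding virtual_strand_def by blast
    have cc: "crossing_chart D \<phi>" using \<phi>(1) by (simp add: virtual_chart_def)
    have "\<gamma> s \<notin> vertices D \<and> g (\<gamma> s) = g (\<phi> 1)" if s: "s \<in> {0..1}" "\<bar>s - t\<bar> < e" "s \<noteq> t" for s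
    proof -
      have st: "s \<in> {t-e..t+e}" "t \<in> {t-e..t+e}" using s e(1) by auto
      have "\<gamma> s \<in> \<phi> ` {z \<in> cball 0 1. Im z = 0}" using e(3) st(1) by blast
      then obtain z where z: "norm z \<le> 1" "Im z = 0" "\<gamma> s = \<phi> z" by auto
      have "z \<noteq> 0" using inj_onD[OF e(2) _ st] z(3) \<phi>(2) s(3) by auto
      then obtain u where u: "u \<in> {1, -1}" "z = norm z *\<^sub>R u" using real_axis_ray[OF z(2)] by blast
      have uu: "u \<in> units" using u(1) by (auto simp: units_def)
      have n: "0 < norm z" using \<open>z \<noteq> 0\<close> by simp
      have "g (\<phi> (norm z *\<^sub>R u)) = g (\<phi> u)"
        by (rule crossing_chart_ray[OF cc point_labelingsD(3)[OF g] uu n z(1)])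
      moreover have "g (\<phi> 1) = g (\<phi> (-1))"
        using rules_atD(1)[where \<phi> = \<phi>, OF point_labelingsD(4)[OF g True] \<phi>(2,1)] .
      moreover have "\<phi> z \<notin> vertices D" using crossing_chartD(4)[OF cc, of z] z(1) \<open>z \<noteq> 0\<close> by simp
      ultimately show ?thesis using z(3) u by auto
    qed
    then show ?thesis using e(1) True by blast
  qed
  \<comment> \<open>The limit of the labels at parameter \<open>t\<close>, which is also defined at virtual crossings.\<close>
  define h where "h t = (SOME c. \<exists>e. 0 < e \<and> (\<forall>s \<in> {0..1}. \<bar>s - t\<bar> < e \<longrightarrow> s \<noteq> t \<or> \<gamma> t \<notin> vertices D \<longrightarrow>
      \<gamma> s \<notin> vertices D \<and> g (\<gamma> s) = c))" for t
  have h: "\<exists>e. 0 < e \<and> (\<forall>s \<in> {0..1}. \<bar>s - t\<bar> < e \<longrightarrow> s \<noteq> t \<or> \<gamma> t \<notin> vertices D \<longrightarrow>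
      \<gamma> s \<notin> vertices D \<and> g (\<gamma> s) = h t)" if "t \<in> {0..1}" for t
    unfolding h_def by (rule someI_ex[OF ex[OF that]])
  have hval: "g (\<gamma> t) = h t" if t: "t \<in> {0..1}" "\<gamma> t \<notin> vertices D" for t
    using h[OF t(1)] t by auto
  have hloc: "\<forall>\<^sub>F s in at t within {0..1}. h t = h s" if t: "t \<in> {0..1}" for t
  proof -
    obtain e where e: "0 < e" "\<forall>s \<in> {0..1}. \<bar>s - t\<bar> < e \<longrightarrow> s \<noteq> t \<or> \<gamma> t \<notin> vertices D \<longrightarrow>
      \<gamma> s \<notin> vertices D \<and> g (\<gamma> s) = h t" using h[OF t] by blast
    have "h t = h s" if s: "s \<in> {0..1}" "s \<noteq> t" "dist s t < e" for s
    proof -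
      have "\<bar>s - t\<bar> < e" using s(3) by (simp only: dist_real_def)
      then have "\<gamma> s \<notin> vertices D \<and> g (\<gamma> s) = h t" using e(2) s(1,2) by blast
      then show ?thesis using hval[OF s(1)] by simp
    qed
    then show ?thesis unfolding eventually_at using e(1) by blast
  qed
  have hconst: "h t = h 0" if t: "t \<in> {0..1}" for t
    by (rule connected_local_const[of "{0..1::real}"]) (use t hloc in auto)
  show thesis
  proof (rule that[of "h 0"], rule ballI)
    fix p assume p: "p \<in> path_image \<gamma> - vertices D"
    then obtain t where "t \<in> {0..1}" "p = \<gamma> t" by (auto simp: path_image_def)
    then show "g p = h 0" using hval[of t] hconst[of t] p by simp
  qed
qed

text \<open>At an interior point which is not a crossing, the strand covers a neighbourhood in the graph, so the rest of the
  diagram stays away.\<close>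

lemma strand_end:
  assumes D: "vmv_diagram D" and str: "virtual_strand D \<gamma>"
    and p: "p \<in> closure (graph D - path_image \<gamma>)" "p \<in> path_image \<gamma>" "p \<notin> vertices D"
  shows "p = pathstart \<gamma> \<or> p = pathfinish \<gamma>"
proof (rule ccontr)
  assume n: "\<not> (p = pathstart \<gamma> \<or> p = pathfinish \<gamma>)"
  have path: "continuous_on {0..1} \<gamma>" "path_image \<gamma> \<subseteq> graph D"
    and sinj: "\<And>s t. s \<in> {0..1} \<Longrightarrow> t \<in> {0..1} \<Longrightarrow> \<gamma> s = \<gamma> t \<Longrightarrow> s = t \<or> \<gamma> s \<in> virtual D"
    using str by (auto simp: virtual_strand_def path_def)
  obtain t where t: "t \<in> {0..1}" "p = \<gamma> t" using p(2) by (auto simp: path_image_def)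
  have "t \<noteq> 0" "t \<noteq> 1" using n t(2) by (auto simp: pathstart_def pathfinish_def)
  then have t01: "0 < t" "t < 1" using t(1) by auto
  have pg: "p \<in> graph D - vertices D" using p path(2) by blast
  then obtain \<psi> where \<psi>: "edge_chart D \<psi>" "\<psi> 0 = p" using D unfolding vmv_diagram_def by blast
  then have c: "continuous_on (cball 0 1) \<psi>" "inj_on \<psi> (cball 0 1)"
    and gr: "graph D \<inter> \<psi> ` cball 0 1 = \<psi> ` {z \<in> cball 0 1. Im z = 0}" by (auto simp: edge_chart_def)
  let ?U = "\<psi> ` ball 0 1 - vertices D"
  have op: "open ?U" using open_embedding_ball[OF c] vmv_closed(2)[OF D] finite_imp_closed by (intro open_Diff) auto
  have "p \<in> \<psi> ` ball 0 1" unfolding \<psi>(2)[symmetric] by (rule imageI) simp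
  then have tU: "\<gamma> t \<in> ?U" using t(2) p(3) by simp
  obtain e where e: "0 < e" "\<forall>s \<in> {0..1}. \<bar>s - t\<bar> < e \<longrightarrow> \<gamma> s \<in> ?U"
    by (rule path_stays_in_open[OF path(1) op tU t(1)])
  define \<delta> where "\<delta> = min (e/2) (min t (1 - t))"
  have \<delta>: "0 < \<delta>" "{t - \<delta>..t + \<delta>} \<subseteq> {0..1}" using e t01 by (auto simp: \<delta>_def)
  have U: "\<gamma> s \<in> ?U" if s: "s \<in> {t - \<delta>..t + \<delta>}" for s
  proof -
    have "\<bar>s - t\<bar> \<le> \<delta>" using s by auto
    also have "\<delta> < e" using e(1) by (simp add: \<delta>_def min_def)
    finally show ?thesis using e(2) s \<delta>(2) by blast
  qed
  have inj: "inj_on \<gamma> {t - \<delta>..t + \<delta>}"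
  proof (rule inj_onI)
    fix x y assume xy: "x \<in> {t - \<delta>..t + \<delta>}" "y \<in> {t - \<delta>..t + \<delta>}" "\<gamma> x = \<gamma> y"
    have "\<gamma> x \<notin> virtual D" using U[OF xy(1)] by (auto simp: vertices_def)
    then show "x = y" using sinj[of x y] xy \<delta>(2) by blast
  qed
  have sub: "\<gamma> ` {t - \<delta>..t + \<delta>} \<subseteq> \<psi> ` {z \<in> cball 0 1. Im z = 0}"
  proof (rule image_subsetI)
    fix s assume s: "s \<in> {t - \<delta>..t + \<delta>}"
    have "\<gamma> s \<in> graph D" using path(2) s \<delta>(2) unfolding path_image_def by blast
    moreover have "\<gamma> s \<in> \<psi> ` cball 0 1" using U[OF s] by auto
    ultimately show "\<gamma> s \<in> \<psi> ` {z \<in> cball 0 1. Im z = 0}" using gr by blast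
  qed
  obtain \<eta> where \<eta>: "0 < \<eta>" "\<eta> \<le> 1" "\<And>z. norm z < \<eta> \<Longrightarrow> Im z = 0 \<Longrightarrow> \<psi> z \<in> \<gamma> ` {t - \<delta>..t + \<delta>}"
    using path_covers_diameter[OF c continuous_on_subset[OF path(1) \<delta>(2)] inj _ _ _ sub, of t] \<delta>(1) t(2) \<psi>(2) by auto
  have op: "open (\<psi> ` ball 0 \<eta>)" by (rule open_embedding_ball[OF c \<eta>(2)])
  have "p \<in> \<psi> ` ball 0 \<eta>" unfolding \<psi>(2)[symmetric] by (rule imageI) (use \<eta> in simp)
  then obtain q where q: "q \<in> graph D - path_image \<gamma>" "q \<in> \<psi> ` ball 0 \<eta>"
    using p(1) op unfolding closure_iff_nhds_not_empty by (meson disjoint_iff subset_refl)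
  then obtain z where z: "q = \<psi> z" "norm z < \<eta>" by auto
  then have "q \<in> graph D \<inter> \<psi> ` cball 0 1" using q(1) \<eta>(2) by auto
  then obtain z' where z': "q = \<psi> z'" "z' \<in> cball 0 1" "Im z' = 0" using gr by auto
  have "z = z'" by (rule inj_onD[OF c(2)]) (use z z' \<eta>(2) in auto)
  then have "q \<in> \<gamma> ` {t - \<delta>..t + \<delta>}" using \<eta>(3)[of z] z z' by simp
  then show False using q(1) \<delta>(2) unfolding path_image_def by blast
qed

text \<open>At a virtual crossing with the strand, the rest of the diagram is contained in the other axis of the
  chart, and the labels on its two halves agree because that axis also goes straight through.\<close>

lemma rest_label:
  assumes D: "vmv_diagram D" and str: "virtual_strand D \<gamma>" and g: "g \<in> point_labelings X up dn D"
    and p: "p \<in> closure (graph D - path_image \<gamma>)" "p \<notin> vertices D \<or> p \<in> path_image \<gamma>"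
  shows "\<exists>c \<in> X. \<exists>U. open U \<and> p \<in> U \<and> (p \<notin> vertices D \<longrightarrow> g p = c) \<and>
     (\<forall>q \<in> closure (graph D - path_image \<gamma>) - vertices D. q \<in> U \<longrightarrow> g q = c)"
proof -
  let ?K = "closure (graph D - path_image \<gamma>)"
  have K: "?K \<subseteq> graph D" using vmv_closed(1)[OF D] by (intro closure_minimal) auto
  show ?thesis
  proof (cases "p \<in> vertices D")
    case False
    then obtain U where U: "open U" "p \<in> U" "\<And>q. q \<in> graph D - vertices D \<Longrightarrow> q \<in> U \<Longrightarrow> g q = g p"
      using locally_const_onE[OF point_labelingsD(3)[OF g], of p] p(1) K by blast
    have "g p \<in> X" using point_labelingsD(1)[OF g, of p] p(1) K False by blast
    moreover have "\<forall>q \<in> ?K - vertices D. q \<in> U \<longrightarrow> g q = g p" using U(3) K by blast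
    ultimately show ?thesis using U by blast
  next
    case True
    then have "p \<in> path_image \<gamma>" using p(2) by blast
    then obtain t where t: "t \<in> {0..1}" "p = \<gamma> t" by (auto simp: path_image_def)
    have path: "continuous_on {0..1} \<gamma>" "path_image \<gamma> \<subseteq> graph D - (classical D \<union> saddle D)"
      and ends: "\<gamma> 0 \<notin> virtual D" "\<gamma> 1 \<notin> virtual D"
      using str by (auto simp: virtual_strand_def path_def pathstart_def pathfinish_def)
    have vt: "\<gamma> t \<in> virtual D" using True path(2) t unfolding vertices_def path_image_def by blast
    then have t01: "t \<in> {0<..<1}" using ends t by (cases "t = 0 \<or> t = 1") auto
    then obtain \<phi> e0 where \<phi>: "virtual_chart D \<phi>" "\<phi> 0 = \<gamma> t" and e0: "e0 > 0" "inj_on \<gamma> {t-e0..t+e0}"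
      "\<gamma> ` {t-e0..t+e0} \<subseteq> \<phi> ` {z \<in> cball 0 1. Im z = 0}"
      using str vt unfolding virtual_strand_def by blast
    define e where "e = min e0 (min t (1 - t))"
    have e: "0 < e" "{t-e..t+e} \<subseteq> {0..1}" "{t-e..t+e} \<subseteq> {t-e0..t+e0}"
      using e0(1) t01 by (auto simp: e_def)
    have cc: "crossing_chart D \<phi>" using \<phi>(1) by (simp add: virtual_chart_def)
    note c = crossing_chartD[OF cc]
    have sub: "\<gamma> ` {t-e..t+e} \<subseteq> \<phi> ` {z \<in> cball 0 1. Im z = 0}" using e(3) e0(3) by blast
    obtain \<eta> where \<eta>: "0 < \<eta>" "\<eta> \<le> 1" "\<And>z. norm z < \<eta> \<Longrightarrow> Im z = 0 \<Longrightarrow> \<phi> z \<in> \<gamma> ` {t - e..t + e}"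
      using path_covers_diameter[OF c(1,2) continuous_on_subset[OF path(1) e(2)] inj_on_subset[OF e0(2) e(3)] _ _ _ sub, of t]
        e(1) \<phi>(2) by auto
    let ?U = "\<phi> ` ball 0 \<eta>" and ?I = "\<phi> ` {z \<in> cball 0 1. Re z = 0}"
    have op: "open ?U" by (rule open_embedding_ball[OF c(1,2) \<eta>(2)])
    have rest: "(graph D - path_image \<gamma>) \<inter> ?U \<subseteq> ?I"
    proof
      fix q assume q: "q \<in> (graph D - path_image \<gamma>) \<inter> ?U"
      then obtain z where z: "q = \<phi> z" "norm z < \<eta>" by auto
      have z1: "z \<in> cball 0 1" using z(2) \<eta>(2) by simp
      have "z \<in> axes" using c(3)[OF z1] q z(1) by simp
      moreover have "Im z \<noteq> 0"
      proof
        assume "Im z = 0"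
        then have "q \<in> \<gamma> ` {t - e..t + e}" using \<eta>(3) z by blast
        then show False using q e(2) unfolding path_image_def by blast
      qed
      ultimately show "q \<in> ?I" using z(1) z1 by (auto simp: axes_def)
    qed
    have "closed ?I"
    proof -
      have "compact {z \<in> cball (0::complex) 1. Re z = 0}"
      proof -
        have "{z \<in> cball (0::complex) 1. Re z = 0} = cball 0 1 \<inter> {z. Re z = 0}" by blast
        then show ?thesis by (simp add: compact_Int_closed closed_halfspace_Re_eq)
      qed
      then show ?thesis
        by (intro compact_imp_closed compact_continuous_image continuous_on_subset[OF c(1)]) auto
    qed
    have KU: "q \<in> ?I" if q: "q \<in> ?K" "q \<in> ?U" for q
    proof -
      have "q \<in> closure ((graph D - path_image \<gamma>) \<inter> ?U)"
        using open_Int_closure_subset[OF op, of "graph D - path_image \<gamma>"] q by (auto simp: Int_commute)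
      then show ?thesis using closure_minimal[OF rest \<open>closed ?I\<close>] by blast
    qed
    have gi: "g (\<phi> \<i>) = g (\<phi> (-\<i>))"
      using rules_atD(1)[where \<phi> = "\<lambda>z. \<phi> (\<i> * z)", OF point_labelingsD(4)[OF g True] _ virtual_chart_rotate[OF \<phi>(1)]]
        \<phi>(2) t(2) by simp
    have "g q = g (\<phi> \<i>)" if q: "q \<in> ?K - vertices D" "q \<in> ?U" for q
    proof -
      obtain z where z: "q = \<phi> z" "norm z \<le> 1" "Re z = 0" using KU[of q] q by auto
      have "z \<noteq> 0" using c(4)[of z] z q(1) by auto
      have "Im (- \<i> * z) = 0" "- \<i> * z \<noteq> 0" using z(3) \<open>z \<noteq> 0\<close> by auto
      then obtain u where u: "u \<in> {1, -1}" "- \<i> * z = norm (- \<i> * z) *\<^sub>R u" by (rule real_axis_ray)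
      have "z = \<i> * (- \<i> * z)" by simp
      also have "\<dots> = norm z *\<^sub>R (\<i> * u)" by (subst u(2)) (simp add: norm_mult)
      finally have zu: "z = norm z *\<^sub>R (\<i> * u)" .
      have uu: "\<i> * u \<in> units" using u(1) by (auto simp: units_def)
      have "g (\<phi> (norm z *\<^sub>R (\<i> * u))) = g (\<phi> (\<i> * u))"
        by (rule crossing_chart_ray[OF cc point_labelingsD(3)[OF g] uu]) (use \<open>z \<noteq> 0\<close> z(2) in auto)
      then have "g q = g (\<phi> (\<i> * u))" using z(1) zu by metis
      then show ?thesis using u(1) gi by auto
    qed
    moreover have "g (\<phi> \<i>) \<in> X"
      using point_labelingsD(1)[OF g, of "\<phi> \<i>"] crossing_chart_points(2)[OF cc units_simps(2), of 1] by simp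
    moreover have "p \<in> ?U" unfolding t(2) \<phi>(2)[symmetric] by (rule imageI) (use \<eta> in simp)
    ultimately show ?thesis using op True by blast
  qed
qed

text \<open>The two diagrams of a detour move. The assumptions are symmetric, so that each statement also holds with
  the roles of the diagrams exchanged.\<close>

locale detour =
  fixes D D' :: diagram and \<gamma> \<gamma>' :: "real \<Rightarrow> complex"
  assumes D: "vmv_diagram D" and D': "vmv_diagram D'"
    and str: "virtual_strand D \<gamma>" and str': "virtual_strand D' \<gamma>'"
    and ends: "\<gamma>' 0 = \<gamma> 0" "\<gamma>' 1 = \<gamma> 1"
    and rest: "closure (graph D - path_image \<gamma>) = closure (graph D' - path_image \<gamma>')"
    and virt: "virtual D - path_image \<gamma> = virtual D' - path_image \<gamma>'"
    and same: "classical D = classical D'" "saddle D = saddle D'" "over D = over D'"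
begin

lemma detour_sym: "detour D' D \<gamma>' \<gamma>"
  using D D' str str' ends rest virt same by unfold_locales simp_all

definition "K = closure (graph D - path_image \<gamma>)"

lemma K': "K = closure (graph D' - path_image \<gamma>')"
  by (simp add: K_def rest)

lemma graph_D: "graph D = K \<union> path_image \<gamma>" and graph_D': "graph D' = K \<union> path_image \<gamma>'"
proof -
  have "K \<subseteq> graph D" unfolding K_def using vmv_closed(1)[OF D] by (intro closure_minimal) auto
  moreover have "K \<subseteq> graph D'" unfolding K' using vmv_closed(1)[OF D'] by (intro closure_minimal) auto
  moreover have "graph D - path_image \<gamma> \<subseteq> K" unfolding K_def by (rule closure_subset)
  moreover have "graph D' - path_image \<gamma>' \<subseteq> K" unfolding K' by (rule closure_subset)
  moreover have "path_image \<gamma> \<subseteq> graph D" "path_image \<gamma>' \<subseteq> graph D'"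
    using str str' unfolding virtual_strand_def by blast+
  ultimately show "graph D = K \<union> path_image \<gamma>" "graph D' = K \<union> path_image \<gamma>'" by blast+
qed

lemma strand_avoids: "p \<in> path_image \<gamma> \<Longrightarrow> p \<notin> classical D \<and> p \<notin> saddle D"
  "p \<in> path_image \<gamma>' \<Longrightarrow> p \<notin> classical D' \<and> p \<notin> saddle D'"
  using str str' unfolding virtual_strand_def by blast+

lemma closed_strands: "closed (path_image \<gamma>)" "closed (path_image \<gamma>')"
  using str str' unfolding virtual_strand_def by (auto intro: closed_path_image)

lemma ends_mem: "\<gamma> 0 \<in> path_image \<gamma>" "\<gamma> 1 \<in> path_image \<gamma>" "\<gamma> 0 \<in> path_image \<gamma>'" "\<gamma> 1 \<in> path_image \<gamma>'"
  using ends unfolding path_image_def by (auto simp: image_iff intro: bexI[of _ 0] bexI[of _ 1])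

lemma ends_no_vertices: "\<gamma> 0 \<notin> vertices D" "\<gamma> 1 \<notin> vertices D" "\<gamma> 0 \<notin> vertices D'" "\<gamma> 1 \<notin> vertices D'"
proof -
  have "\<gamma> 0 \<notin> virtual D" "\<gamma> 1 \<notin> virtual D" "\<gamma> 0 \<notin> virtual D'" "\<gamma> 1 \<notin> virtual D'"
    using str str' ends unfolding virtual_strand_def pathstart_def pathfinish_def by simp_all
  then show "\<gamma> 0 \<notin> vertices D" "\<gamma> 1 \<notin> vertices D" "\<gamma> 0 \<notin> vertices D'" "\<gamma> 1 \<notin> vertices D'"
    using strand_avoids(1)[OF ends_mem(1)] strand_avoids(1)[OF ends_mem(2)]
      strand_avoids(2)[OF ends_mem(3)] strand_avoids(2)[OF ends_mem(4)] unfolding vertices_def by blast+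
qed

lemma outside_agree:
  assumes "p \<notin> path_image \<gamma>" "p \<notin> path_image \<gamma>'"
  shows "p \<in> graph D \<longleftrightarrow> p \<in> graph D'" "p \<in> virtual D \<longleftrightarrow> p \<in> virtual D'" "p \<in> vertices D \<longleftrightarrow> p \<in> vertices D'"
proof -
  show "p \<in> graph D \<longleftrightarrow> p \<in> graph D'" using assms graph_D graph_D' by blast
  show v: "p \<in> virtual D \<longleftrightarrow> p \<in> virtual D'" using assms virt by blast
  show "p \<in> vertices D \<longleftrightarrow> p \<in> vertices D'" using v same by (simp add: vertices_def)
qed

text \<open>A crossing of the old diagram which is lost or lies on the new strand is a virtual crossing with the
  old strand; so \<open>rest_label\<close> applies to all points of the rest where new labels are to be found.\<close>

lemma old_vertex_on_strand:
  assumes "p \<in> vertices D" "p \<notin> vertices D' \<or> p \<in> path_image \<gamma>'" shows "p \<in> path_image \<gamma>"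
proof -
  have "p \<notin> classical D" "p \<notin> saddle D" using assms(2) strand_avoids(2)[of p] same by (auto simp: vertices_def)
  then have v: "p \<in> virtual D" using assms(1) by (auto simp: vertices_def)
  show ?thesis
  proof (rule ccontr)
    assume "p \<notin> path_image \<gamma>"
    then have "p \<in> virtual D' - path_image \<gamma>'" using v virt by blast
    then show False using assms(2) by (auto simp: vertices_def)
  qed
qed

lemma rest_end:
  assumes "p \<in> K" "p \<in> path_image \<gamma>'" "p \<notin> vertices D'"
  shows "p = \<gamma> 0 \<or> p = \<gamma> 1"
  using strand_end[OF D' str' _ assms(2,3)] assms(1) ends unfolding K' pathstart_def pathfinish_def by simp

text \<open>The second condition ties the labels of the two strands together: both contain the starting point
  \<open>\<gamma> 0\<close>, which is not a vertex of either diagram.\<close>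

definition related :: "(complex \<Rightarrow> 'a) \<Rightarrow> (complex \<Rightarrow> 'a) \<Rightarrow> bool" where
  "related g g' \<longleftrightarrow> (\<forall>p \<in> K - vertices D - vertices D'. g' p = g p) \<and> g' (\<gamma> 0) = g (\<gamma> 0)"

lemma related_unique:
  assumes g1: "g1 \<in> point_labelings X up dn D'" and g2: "g2 \<in> point_labelings X up dn D'"
    and r1: "related g g1" and r2: "related g g2"
  shows "g1 = g2"
proof (rule point_labelings_eqI[OF g1 g2])
  fix p assume p: "p \<in> graph D' - vertices D'"
  show "g1 p = g2 p"
  proof (cases "p \<in> path_image \<gamma>'")
    case True
    obtain c1 where "\<forall>p \<in> path_image \<gamma>' - vertices D'. g1 p = c1" by (rule strand_label[OF D' str' g1])
    moreover obtain c2 where "\<forall>p \<in> path_image \<gamma>' - vertices D'. g2 p = c2" by (rule strand_label[OF D' str' g2])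
    moreover have "g1 (\<gamma> 0) = g2 (\<gamma> 0)" using r1 r2 by (simp add: related_def)
    ultimately show ?thesis using True p ends_mem(3) ends_no_vertices(3) by simp
  next
    case False
    obtain U1 where U1: "open U1" "p \<in> U1" "\<And>q. q \<in> graph D' - vertices D' \<Longrightarrow> q \<in> U1 \<Longrightarrow> g1 q = g1 p"
      using locally_const_onE[OF point_labelingsD(3)[OF g1] p] by blast
    obtain U2 where U2: "open U2" "p \<in> U2" "\<And>q. q \<in> graph D' - vertices D' \<Longrightarrow> q \<in> U2 \<Longrightarrow> g2 q = g2 p"
      using locally_const_onE[OF point_labelingsD(3)[OF g2] p] by blast
    obtain \<psi> where \<psi>: "edge_chart D' \<psi>" "\<psi> 0 = p" using D' p unfolding vmv_diagram_def by blast
    then have c: "continuous_on (cball 0 1) \<psi>" "inj_on \<psi> (cball 0 1)"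
      and gr: "graph D' \<inter> \<psi> ` cball 0 1 = \<psi> ` {z \<in> cball 0 1. Im z = 0}" by (auto simp: edge_chart_def)
    \<comment> \<open>The graph has no isolated points, so there is a common point of both diagrams close to \<open>p\<close>.\<close>
    let ?W = "U1 \<inter> U2 - path_image \<gamma>' - (vertices D - {p}) - vertices D'"
    have "open ?W" using U1(1) U2(1) closed_strands(2) vmv_closed(2)[OF D] vmv_closed(2)[OF D']
      by (intro open_Diff open_Int) (auto intro: finite_imp_closed)
    moreover have "\<psi> 0 \<in> ?W" using U1(2) U2(2) False p \<psi>(2) by simp
    ultimately obtain r where r: "0 < r" "r \<le> 1" "\<And>z. norm z \<le> r \<Longrightarrow> \<psi> z \<in> ?W"
      using chart_small[OF c(1)] by metis
    define q where "q = \<psi> (complex_of_real r)"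
    have qW: "q \<in> ?W" unfolding q_def by (rule r(3)) (use r in simp)
    have "q \<in> \<psi> ` {z \<in> cball 0 1. Im z = 0}" unfolding q_def by (rule imageI) (use r in simp)
    then have "q \<in> graph D' \<inter> \<psi> ` cball 0 1" by (simp only: gr)
    then have qg: "q \<in> graph D'" by simp
    have "q \<noteq> p"
    proof
      assume "q = p"
      then have "\<psi> (complex_of_real r) = \<psi> 0" using \<psi>(2) by (simp only: q_def)
      then have "complex_of_real r = 0" by (rule inj_onD[OF c(2)]) (use r(1,2) in simp_all)
      then show False using r(1) by simp
    qed
    then have q: "q \<in> K - vertices D - vertices D'" "q \<in> graph D' - vertices D'" "q \<in> U1" "q \<in> U2"
      using qW qg graph_D' by blast+
    have "g1 p = g1 q" using U1(3)[OF q(2,3)] by simp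
    also have "\<dots> = g2 q" using r1 r2 q(1) by (simp add: related_def)
    also have "\<dots> = g2 p" using U2(3)[OF q(2,4)] .
    finally show ?thesis .
  qed
qed

text \<open>The new strand gets the label of the old one, and the rest keeps its labels, extended over the lost
  crossings by continuity. The delicate point is a virtual crossing \<open>v\<close> on the new strand, where the second
  axis of the chart has to carry equal labels on both sides. If \<open>v\<close> is not in the closure of the
  rest, the strand covers both axes near \<open>v\<close>. If the second axis avoids the strand near \<open>v\<close>, it
  belongs to the rest. Otherwise points of the strand on the second axis accumulate at \<open>v\<close>; then
  the strand passes \<open>v\<close> straight, along the second axis, a second time.\<close>

lemma related_exists:
  assumes g: "g \<in> point_labelings X up dn D"
  shows "\<exists>g'. g' \<in> point_labelings X up dn D' \<and> related g g'"
proof -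
  obtain c where c: "\<forall>p \<in> path_image \<gamma> - vertices D. g p = c" by (rule strand_label[OF D str g])
  have gc: "g (\<gamma> 0) = c" "g (\<gamma> 1) = c" using c ends_mem ends_no_vertices by simp_all
  have cX: "c \<in> X" using point_labelingsD(1)[OF g, of "\<gamma> 0"] gc ends_mem ends_no_vertices graph_D by simp
  have restl: "\<exists>v \<in> X. \<exists>U. open U \<and> p \<in> U \<and> (p \<notin> vertices D \<longrightarrow> g p = v) \<and> (\<forall>q \<in> K - vertices D. q \<in> U \<longrightarrow> g q = v)"
    if p: "p \<in> K" "p \<notin> vertices D' \<or> p \<in> path_image \<gamma>'" for p
  proof -
    have "p \<notin> vertices D \<or> p \<in> path_image \<gamma>" using old_vertex_on_strand[of p] p(2) by blast
    from rest_label[OF D str g p(1)[unfolded K_def] this] show ?thesis unfolding K_def .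
  qed
  \<comment> \<open>The labels of the rest, extended to the crossings that are lost.\<close>
  define h where "h p = (SOME v. v \<in> X \<and> (\<exists>U. open U \<and> p \<in> U \<and> (p \<notin> vertices D \<longrightarrow> g p = v) \<and>
      (\<forall>q \<in> K - vertices D. q \<in> U \<longrightarrow> g q = v)))" for p
  have h: "h p \<in> X \<and> (\<exists>U. open U \<and> p \<in> U \<and> (p \<notin> vertices D \<longrightarrow> g p = h p) \<and> (\<forall>q \<in> K - vertices D. q \<in> U \<longrightarrow> g q = h p))"
    if p: "p \<in> K" "p \<notin> vertices D'" for p
    unfolding h_def by (rule someI_ex) (use restl[OF p(1)] p(2) in blast)
  have hg: "h p = g p" if "p \<in> K" "p \<notin> vertices D'" "p \<notin> vertices D" for p
    using h[OF that(1,2)] that(3) by auto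
  have hloc: "\<exists>U. open U \<and> p \<in> U \<and> (\<forall>q \<in> K - vertices D'. q \<in> U \<longrightarrow> h q = h p)"
    if p: "p \<in> K" "p \<notin> vertices D'" for p
  proof -
    obtain U where U: "open U" "p \<in> U" "\<forall>q \<in> K - vertices D. q \<in> U \<longrightarrow> g q = h p" using h[OF p] by blast
    let ?W = "U - (vertices D - {p})"
    have "open ?W" using U(1) vmv_closed(2)[OF D] by (intro open_Diff) (auto intro: finite_imp_closed)
    moreover have "h q = h p" if q: "q \<in> K - vertices D'" "q \<in> ?W" for q
    proof (cases "q = p")
      case False
      then have "q \<in> K - vertices D" "q \<in> U" using q by blast+
      then have "g q = h p" using U(3) by blast
      then show ?thesis using hg[of q] q \<open>q \<in> K - vertices D\<close> by simp
    qed simp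
    ultimately show ?thesis using U(2) by (intro exI[of _ ?W]) blast
  qed
  have hc: "h p = c" if p: "p \<in> K" "p \<notin> vertices D'" "p \<in> path_image \<gamma>'" for p
  proof -
    have "p = \<gamma> 0 \<or> p = \<gamma> 1" by (rule rest_end[OF p(1,3,2)])
    then show ?thesis using hg[OF p(1,2)] gc ends_no_vertices by auto
  qed
  define f where "f p = (if p \<in> path_image \<gamma>' then c else h p)" for p
  have fX: "f p \<in> X" if "p \<in> graph D'" "p \<notin> vertices D'" for p
  proof (cases "p \<in> path_image \<gamma>'")
    case False
    then have "p \<in> K" using that(1) graph_D' by blast
    then show ?thesis using h[of p] that(2) False by (simp add: f_def)
  qed (simp add: f_def cX)
  have closedK: "closed K" by (simp add: K_def)
  have lc: "locally_const_on (graph D' - vertices D') f"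
  proof (rule locally_const_onI)
    fix p assume p: "p \<in> graph D' - vertices D'"
    consider "p \<in> path_image \<gamma>'" "p \<notin> K" | "p \<in> path_image \<gamma>'" "p \<in> K" | "p \<notin> path_image \<gamma>'" "p \<in> K"
      using p graph_D' by blast
    then show "\<exists>U. open U \<and> p \<in> U \<and> (\<forall>q \<in> (graph D' - vertices D') \<inter> U. f q = f p)"
    proof cases
      case 1
      have "f q = f p" if "q \<in> (graph D' - vertices D') \<inter> - K" for q
        using that graph_D' 1 by (auto simp: f_def)
      then show ?thesis using 1 closedK by (intro exI[of _ "- K"]) auto
    next
      case 2
      obtain U where U: "open U" "p \<in> U" "\<forall>q \<in> K - vertices D'. q \<in> U \<longrightarrow> h q = h p"
        using hloc[OF 2(2)] p by blast
      have hp: "h p = c" using hc[OF 2(2) _ 2(1)] p by simp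
      have "f q = f p" if q: "q \<in> (graph D' - vertices D') \<inter> U" for q
      proof (cases "q \<in> path_image \<gamma>'")
        case False
        then have "q \<in> K - vertices D'" using q graph_D' by blast
        then have "h q = c" using U(3) q hp by auto
        then show ?thesis using False 2(1) by (simp add: f_def)
      qed (use 2(1) in \<open>simp add: f_def\<close>)
      then show ?thesis using U by blast
    next
      case 3
      obtain U where U: "open U" "p \<in> U" "\<forall>q \<in> K - vertices D'. q \<in> U \<longrightarrow> h q = h p"
        using hloc[OF 3(2)] p by blast
      have "f q = f p" if q: "q \<in> (graph D' - vertices D') \<inter> (U - path_image \<gamma>')" for q
      proof -
        have "q \<in> K - vertices D'" "q \<in> U" "q \<notin> path_image \<gamma>'" using q graph_D' by blast+
        then show ?thesis using U(3) 3(1) by (auto simp: f_def)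
      qed
      then show ?thesis using U(1,2) 3(1) closed_strands(2) by (intro exI[of _ "U - path_image \<gamma>'"]) auto
    qed
  qed
  have path': "continuous_on {0..1} \<gamma>'" using str' by (simp add: virtual_strand_def path_def)
  \<comment> \<open>On the axis along which the new strand passes a crossing, the label is that of the strand.\<close>
  have along: "f (\<phi> u) = c" if \<phi>: "virtual_chart D' \<phi>" "\<phi> 0 = \<gamma>' t" and t: "0 < t" "t < 1" and e: "0 < e"
    "inj_on \<gamma>' {t-e..t+e}" "\<gamma>' ` {t-e..t+e} \<subseteq> \<phi> ` {z \<in> cball 0 1. Im z = 0}" and u: "u \<in> {1, -1}" for \<phi> t e u
  proof -
    define e' where "e' = min e (min t (1 - t))"
    have e': "0 < e'" "{t-e'..t+e'} \<subseteq> {0..1}" "{t-e'..t+e'} \<subseteq> {t-e..t+e}"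
      using e(1) t by (auto simp: e'_def)
    have cc: "crossing_chart D' \<phi>" using \<phi>(1) by (simp add: virtual_chart_def)
    note ch = crossing_chartD[OF cc]
    have sub: "\<gamma>' ` {t-e'..t+e'} \<subseteq> \<phi> ` {z \<in> cball 0 1. Im z = 0}" using e'(3) e(3) by blast
    have tt: "t - e' < t" "t < t + e'" using e'(1) by auto
    obtain \<eta> where \<eta>: "0 < \<eta>" "\<eta> \<le> 1" "\<And>z. norm z < \<eta> \<Longrightarrow> Im z = 0 \<Longrightarrow> \<phi> z \<in> \<gamma>' ` {t - e'..t + e'}"
      using path_covers_diameter[OF ch(1,2) continuous_on_subset[OF path' e'(2)] inj_on_subset[OF e(2) e'(3)]
          tt \<phi>(2)[symmetric] sub] by blast
    have uu: "u \<in> units" using u by (auto simp: units_def)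
    have "norm ((\<eta>/2) *\<^sub>R u) < \<eta>" "Im ((\<eta>/2) *\<^sub>R u) = 0" using \<eta>(1) u by auto
    then have "\<phi> ((\<eta>/2) *\<^sub>R u) \<in> \<gamma>' ` {t - e'..t + e'}" by (rule \<eta>(3))
    then have "\<phi> ((\<eta>/2) *\<^sub>R u) \<in> path_image \<gamma>'" using e'(2) unfolding path_image_def by blast
    then have "f (\<phi> ((\<eta>/2) *\<^sub>R u)) = c" by (simp add: f_def)
    moreover have "f (\<phi> ((\<eta>/2) *\<^sub>R u)) = f (\<phi> u)"
      by (rule crossing_chart_ray[OF cc lc uu]) (use \<eta> in auto)
    ultimately show ?thesis by simp
  qed
  have inner: "\<exists>\<phi> e. virtual_chart D' \<phi> \<and> \<phi> 0 = \<gamma>' t \<and> 0 < t \<and> t < 1 \<and> 0 < e \<and> inj_on \<gamma>' {t-e..t+e} \<and>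
      \<gamma>' ` {t-e..t+e} \<subseteq> \<phi> ` {z \<in> cball 0 1. Im z = 0}" if t: "t \<in> {0..1}" "\<gamma>' t \<in> virtual D'" for t
  proof -
    have "t \<noteq> 0" "t \<noteq> 1" using t(2) ends ends_no_vertices by (auto simp: vertices_def)
    then have "t \<in> {0<..<1}" using t(1) by auto
    then show ?thesis using str' t(2) unfolding virtual_strand_def by fastforce
  qed
  have cross: "f (\<phi> \<i>) = f (\<phi> (-\<i>))" if \<phi>: "virtual_chart D' \<phi>" "\<phi> 0 \<in> path_image \<gamma>'" for \<phi>
  proof -
    have cc: "crossing_chart D' \<phi>" and v: "\<phi> 0 \<in> virtual D'" using \<phi>(1) by (auto simp: virtual_chart_def)
    note ch = crossing_chartD[OF cc]
    have near: "f (\<phi> u) = x" if "u \<in> units" "0 < s" "s \<le> 1" "f (\<phi> (s *\<^sub>R u)) = x" for u s x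
      using crossing_chart_ray[OF cc lc that(1-3)] that(4) by simp
    show ?thesis
    proof (cases "\<phi> 0 \<in> K")
      case False
      have op: "open (- K)" using closedK by (rule open_Compl)
      obtain r where r: "0 < r" "r \<le> 1" "\<And>z. norm z \<le> r \<Longrightarrow> \<phi> z \<in> - K"
        using chart_small[OF ch(1) op] False by auto
      have "f (\<phi> u) = c" if u: "u \<in> units" for u
      proof (rule near[OF u r(1,2)])
        have "\<phi> (r *\<^sub>R u) \<in> graph D'" using crossing_chart_points(1)[OF cc u r(1,2)] by blast
        moreover have "\<phi> (r *\<^sub>R u) \<notin> K" using r(3)[of "r *\<^sub>R u"] units_norm[OF u] r(1) by simp
        ultimately show "f (\<phi> (r *\<^sub>R u)) = c" using graph_D' by (auto simp: f_def)
      qed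
      then show ?thesis using units_simps by simp
    next
      case True
      obtain x U where U: "open U" "\<phi> 0 \<in> U" "\<forall>q \<in> K - vertices D. q \<in> U \<longrightarrow> g q = x"
        using restl[OF True] \<phi>(2) by blast
      show ?thesis
      proof (cases "\<exists>\<delta>>0. \<forall>y. 0 < \<bar>y\<bar> \<and> \<bar>y\<bar> < \<delta> \<longrightarrow> \<phi> (y *\<^sub>R \<i>) \<notin> path_image \<gamma>'")
        case True
        then obtain \<delta> where \<delta>: "0 < \<delta>" "\<And>y. 0 < \<bar>y\<bar> \<Longrightarrow> \<bar>y\<bar> < \<delta> \<Longrightarrow> \<phi> (y *\<^sub>R \<i>) \<notin> path_image \<gamma>'" by blast
        have op: "open (U - (vertices D - {\<phi> 0}))"
          using U(1) vmv_closed(2)[OF D] by (intro open_Diff) (auto intro: finite_imp_closed)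
        obtain r where r: "0 < r" "r \<le> 1" "\<And>z. norm z \<le> r \<Longrightarrow> \<phi> z \<in> U - (vertices D - {\<phi> 0})"
          using chart_small[OF ch(1) op] U(2) by auto
        define s where "s = min r (\<delta>/2)"
        have s: "0 < s" "s \<le> r" "s < \<delta>" "s \<le> 1" using r \<delta>(1) by (auto simp: s_def)
        have "f (\<phi> u) = x" if u: "u \<in> {\<i>, -\<i>}" for u
        proof -
          have uu: "u \<in> units" using u by (auto simp: units_def)
          let ?q = "\<phi> (s *\<^sub>R u)"
          have q: "?q \<in> graph D' - vertices D'" by (rule crossing_chart_points(1)[OF cc uu s(1,4)])
          have "?q \<notin> path_image \<gamma>'" using u \<delta>(2)[of s] \<delta>(2)[of "-s"] s by auto
          then have qK: "?q \<in> K" using q graph_D' by blast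
          have "?q \<noteq> \<phi> 0" using q v by (auto simp: vertices_def)
          moreover have "?q \<in> U - (vertices D - {\<phi> 0})" by (rule r(3)) (use units_norm[OF uu] s in simp)
          ultimately have "?q \<in> K - vertices D" "?q \<in> U" using qK by blast+
          then have "g ?q = x" using U(3) by blast
          then have "f ?q = x" using hg[of ?q] qK q \<open>?q \<in> K - vertices D\<close> \<open>?q \<notin> path_image \<gamma>'\<close> by (simp add: f_def)
          then show ?thesis by (rule near[OF uu s(1,4)])
        qed
        then show ?thesis by simp
      next
        case False
        \<comment> \<open>Parameters of points of the strand on the imaginary axis accumulate at a second passage.\<close>
        have "\<exists>y s. 0 < \<bar>y\<bar> \<and> \<bar>y\<bar> < inverse (real (Suc n)) \<and> s \<in> {0..1} \<and> \<gamma>' s = \<phi> (y *\<^sub>R \<i>)" for n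
        proof -
          have "0 < inverse (real (Suc n))" by simp
          then obtain y where "0 < \<bar>y\<bar>" "\<bar>y\<bar> < inverse (real (Suc n))" "\<phi> (y *\<^sub>R \<i>) \<in> path_image \<gamma>'"
            using False by blast
          then show ?thesis unfolding path_image_def by (metis imageE)
        qed
        then obtain y s where ys: "\<And>n. 0 < \<bar>y n\<bar>" "\<And>n. \<bar>y n\<bar> < inverse (real (Suc n))"
          "\<And>n. s n \<in> {0..1}" "\<And>n. \<gamma>' (s n) = \<phi> (y n *\<^sub>R \<i>)" by metis
        obtain t \<tau> where t: "t \<in> {0..1}" "strict_mono \<tau>" "(s \<circ> \<tau>) \<longlonglongrightarrow> t"
          using compact_Icc[of "0::real" 1] ys(3) unfolding compact_def by metis
        have "(\<lambda>n. \<bar>y n\<bar>) \<longlonglongrightarrow> 0"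
          by (rule tendsto_sandwich[OF _ _ tendsto_const LIMSEQ_inverse_real_of_nat])
            (use ys(2) in \<open>auto intro!: always_eventually less_imp_le\<close>)
        then have y0: "(\<lambda>n. y (\<tau> n)) \<longlonglongrightarrow> 0"
          using LIMSEQ_subseq_LIMSEQ[OF _ t(2), of "\<lambda>n. \<bar>y n\<bar>" 0] by (simp add: comp_def tendsto_rabs_zero_iff)
        have y1: "y n *\<^sub>R \<i> \<in> cball 0 1" for n
        proof -
          have "inverse (real (Suc n)) \<le> 1" by (simp add: inverse_le_1_iff)
          then show ?thesis using ys(2)[of n] by simp
        qed
        have "(\<lambda>n. y (\<tau> n) *\<^sub>R \<i>) \<longlonglongrightarrow> 0 *\<^sub>R \<i>" by (intro tendsto_intros y0)
        then have lim\<phi>: "(\<lambda>n. \<phi> (y (\<tau> n) *\<^sub>R \<i>)) \<longlonglongrightarrow> \<phi> (0 *\<^sub>R \<i>)"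
          by (rule continuous_on_tendsto_compose[OF ch(1)]) (use y1 in \<open>auto intro: always_eventually\<close>)
        have lim\<gamma>: "(\<lambda>n. \<gamma>' ((s \<circ> \<tau>) n)) \<longlonglongrightarrow> \<gamma>' t"
          by (rule continuous_on_tendsto_compose[OF path' t(3) t(1)]) (use ys(3) in auto)
        have "(\<lambda>n. \<gamma>' ((s \<circ> \<tau>) n)) \<longlonglongrightarrow> \<phi> 0" using lim\<phi> by (simp add: ys(4) comp_def)
        then have t0: "\<gamma>' t = \<phi> 0" by (rule LIMSEQ_unique[OF lim\<gamma>])
        then obtain \<psi> e where \<psi>: "virtual_chart D' \<psi>" "\<psi> 0 = \<gamma>' t" and t01: "0 < t" "t < 1" and e: "0 < e"
          "inj_on \<gamma>' {t-e..t+e}" "\<gamma>' ` {t-e..t+e} \<subseteq> \<psi> ` {z \<in> cball 0 1. Im z = 0}"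
          using inner[OF t(1)] v by auto
        have cc': "crossing_chart D' \<psi>" using \<psi>(1) by (simp add: virtual_chart_def)
        note ch' = crossing_chartD[OF cc']
        have eq: "\<psi> 0 = \<phi> 0" using \<psi>(2) t0 by simp
        obtain \<sigma> r where r: "0 < r" "r \<le> 1" and \<sigma>: "\<forall>u \<in> units. \<sigma> u \<in> units \<and> \<sigma> (-u) = - \<sigma> u \<and>
          (\<forall>s. 0 < s \<longrightarrow> s \<le> r \<longrightarrow> (\<exists>t. 0 < t \<and> t \<le> 1 \<and> \<psi> (s *\<^sub>R u) = \<phi> (t *\<^sub>R \<sigma> u)))"
          using crossing_charts_germ[OF cc cc' eq] by metis
        have "\<forall>\<^sub>F n in sequentially. (s \<circ> \<tau>) n \<in> {t-e<..<t+e}"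
          by (rule topological_tendstoD[OF t(3)]) (use e(1) in auto)
        moreover have "\<forall>\<^sub>F n in sequentially. \<gamma>' ((s \<circ> \<tau>) n) \<in> \<psi> ` ball 0 r"
        proof (rule topological_tendstoD[OF lim\<gamma>])
          show "open (\<psi> ` ball 0 r)" by (rule open_embedding_ball[OF ch'(1,2) r(2)])
          show "\<gamma>' t \<in> \<psi> ` ball 0 r" unfolding \<psi>(2)[symmetric] by (rule imageI) (use r in simp)
        qed
        ultimately have "\<forall>\<^sub>F n in sequentially. (s \<circ> \<tau>) n \<in> {t-e<..<t+e} \<and> \<gamma>' ((s \<circ> \<tau>) n) \<in> \<psi> ` ball 0 r"
          by (rule eventually_conj)
        then obtain n where n: "(s \<circ> \<tau>) n \<in> {t-e<..<t+e}" "\<gamma>' ((s \<circ> \<tau>) n) \<in> \<psi> ` ball 0 r"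
          using eventually_happens'[OF sequentially_bot] by blast
        define m where "m = \<tau> n"
        have sm: "s m \<in> {t-e..t+e}" "\<gamma>' (s m) \<in> \<psi> ` ball 0 r" using n by (auto simp: m_def)
        obtain z where z: "z \<in> cball 0 1" "Im z = 0" "\<gamma>' (s m) = \<psi> z" using e(3) sm(1) by blast
        obtain z' where z': "norm z' < r" "\<gamma>' (s m) = \<psi> z'" using sm(2) by auto
        have "z = z'" by (rule inj_onD[OF ch'(2)]) (use z z' r in auto)
        then have zr: "norm z < r" using z' by simp
        have ne: "y m *\<^sub>R \<i> \<noteq> 0" using ys(1)[of m] by auto
        have "z \<noteq> 0"
        proof
          assume "z = 0"
          then have "\<phi> (y m *\<^sub>R \<i>) = \<phi> 0" using ys(4)[of m] z(3) eq by simp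
          then have "y m *\<^sub>R \<i> = 0" by (rule inj_onD[OF ch(2)]) (use y1 in auto)
          then show False using ne by simp
        qed
        then obtain u where u: "u \<in> {1, -1}" "z = norm z *\<^sub>R u" using real_axis_ray[OF z(2)] by blast
        have uu: "u \<in> units" "-u \<in> units" using u(1) by (auto simp: units_def)
        have zpos: "0 < norm z" "norm z \<le> r" using \<open>z \<noteq> 0\<close> zr by auto
        obtain t' where t': "0 < t'" "t' \<le> 1" "\<psi> (norm z *\<^sub>R u) = \<phi> (t' *\<^sub>R \<sigma> u)"
          using \<sigma> uu(1) zpos by blast
        have \<sigma>u: "\<sigma> u \<in> units" "\<sigma> (-u) = - \<sigma> u" using \<sigma> uu(1) by blast+
        have "\<phi> (y m *\<^sub>R \<i>) = \<phi> (t' *\<^sub>R \<sigma> u)" using ys(4)[of m] z(3) u(2) t'(3) by simp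
        then have "y m *\<^sub>R \<i> = t' *\<^sub>R \<sigma> u"
          by (rule inj_onD[OF ch(2) _ y1]) (use t' units_norm[OF \<sigma>u(1)] in auto)
        then have \<sigma>i: "\<sigma> u \<in> {\<i>, -\<i>}" using \<sigma>u(1) t'(1) by (auto simp: units_def complex_eq_iff)
        have val: "f (\<phi> (\<sigma> w)) = c" if w: "w \<in> {1, -1}" for w
        proof -
          have ww: "w \<in> units" using w by (auto simp: units_def)
          obtain t'' where t'': "0 < t''" "t'' \<le> 1" "\<psi> (r *\<^sub>R w) = \<phi> (t'' *\<^sub>R \<sigma> w)"
            using \<sigma> ww r(1) by (meson order_refl)
          have "\<sigma> w \<in> units" using \<sigma> ww by blast
          moreover have "f (\<psi> (r *\<^sub>R w)) = c"
            using crossing_chart_ray[OF cc' lc ww r] along[OF \<psi> t01 e w] by simp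
          ultimately show ?thesis using near[of "\<sigma> w" t'' c] t'' by simp
        qed
        have "-u \<in> {1, -1}" using u(1) by auto
        then have "f (\<phi> (\<sigma> u)) = c" "f (\<phi> (- \<sigma> u)) = c" using val[of u] val[of "-u"] u(1) \<sigma>u(2) by simp_all
        then show ?thesis using \<sigma>i by auto
      qed
    qed
  qed
  have rules: "rules_at up dn D' f v" if v: "v \<in> vertices D'" for v
  proof (cases "v \<in> path_image \<gamma>'")
    case True
    have nv: "v \<notin> classical D'" "v \<notin> saddle D'" using strand_avoids(2)[OF True] by auto
    then have vv: "v \<in> virtual D'" using v by (auto simp: vertices_def)
    show ?thesis
    proof (rule rules_atI)
      fix \<psi> :: "complex \<Rightarrow> complex" assume \<psi>: "\<psi> 0 = v"
      show "crossing_rule up dn (\<lambda>u. f (\<psi> u))" if "classical_chart D' \<psi>"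
        using that nv(1) \<psi> by (simp add: classical_chart_iff)
      show "f (\<psi> u) = f (\<psi> 1)" if "v \<in> saddle D'" for u using that nv(2) by simp
      show "f (\<psi> 1) = f (\<psi> (-1))" if vc: "virtual_chart D' \<psi>"
      proof -
        obtain t where t: "t \<in> {0..1}" "v = \<gamma>' t" using True by (auto simp: path_image_def)
        obtain \<phi> e where \<phi>: "virtual_chart D' \<phi>" "\<phi> 0 = \<gamma>' t" and t01: "0 < t" "t < 1" and e: "0 < e"
          "inj_on \<gamma>' {t-e..t+e}" "\<gamma>' ` {t-e..t+e} \<subseteq> \<phi> ` {z \<in> cball 0 1. Im z = 0}"
          using inner[OF t(1)] vv t(2) by blast
        have r: "f (\<phi> 1) = f (\<phi> (-1))" using along[OF \<phi> t01 e] by simp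
        have i: "f (\<phi> \<i>) = f (\<phi> (-\<i>))" by (rule cross[OF \<phi>(1)]) (use \<phi>(2) t(2) True in simp)
        have cc: "crossing_chart D' \<phi>" "crossing_chart D' \<psi>" using \<phi>(1) vc by (auto simp: virtual_chart_def)
        show ?thesis
          by (rule virtual_rule_chart_independent[OF cc _ lc r i]) (use \<psi> \<phi>(2) t(2) in simp)
      qed
    qed
  next
    case False
    have "v \<notin> path_image \<gamma>"
      using False v strand_avoids(1)[of v] same virt by (auto simp: vertices_def)
    let ?U = "- (path_image \<gamma> \<union> path_image \<gamma>')"
    have op: "open ?U" using closed_strands by (intro open_Compl closed_Un)
    have vU: "v \<in> ?U" using False \<open>v \<notin> path_image \<gamma>\<close> by blast
    have ag: "agree_on ?U D D'" unfolding agree_on_def using outside_agree same by simp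
    have vD: "v \<in> vertices D" using outside_agree(3)[of v] vU v by simp
    have eq: "f p = g p" if p: "p \<in> ?U" "p \<in> graph D' - vertices D'" for p
    proof -
      have "p \<in> K" using p graph_D' by blast
      moreover have "p \<notin> vertices D" using outside_agree(3)[of p] p by simp
      ultimately show ?thesis using hg[of p] p by (simp add: f_def)
    qed
    show ?thesis by (rule rules_at_local[OF point_labelingsD(4)[OF g vD] op vU ag lc eq])
  qed
  let ?f = "restrict f (graph D' - vertices D')"
  have "?f \<in> point_labelings X up dn D'" by (rule point_labelingsI[OF fX lc rules])
  moreover have "related g ?f"
    unfolding related_def
  proof (intro conjI ballI)
    fix p assume p: "p \<in> K - vertices D - vertices D'"
    then have "p \<in> graph D' - vertices D'" using graph_D' by blast
    then have "?f p = f p" by simp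
    also have "f p = h p" using hc[of p] p by (simp add: f_def)
    also have "\<dots> = g p" using hg[of p] p by simp
    finally show "?f p = g p" .
  next
    have "\<gamma> 0 \<in> graph D' - vertices D'" using ends_mem(3) ends_no_vertices(3) graph_D' by blast
    then show "?f (\<gamma> 0) = g (\<gamma> 0)" using gc(1) ends_mem(3) by (simp add: f_def)
  qed
  ultimately show ?thesis by blast
qed

end

lemma card_point_labelings_detour:
  fixes X :: "'a set"
  assumes "vmv_diagram D" "vmv_diagram D'" "detour_move D D'"
  shows "card (point_labelings X up dn D) = card (point_labelings X up dn D')"
proof -
  obtain \<gamma> \<gamma>' where "virtual_strand D \<gamma>" "virtual_strand D' \<gamma>'"
     "pathstart \<gamma>' = pathstart \<gamma>" "pathfinish \<gamma>' = pathfinish \<gamma>"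
     "closure (graph D - path_image \<gamma>) = closure (graph D' - path_image \<gamma>')"
     "virtual D - path_image \<gamma> = virtual D' - path_image \<gamma>'"
     "classical D = classical D'" "saddle D = saddle D'"
     "over D = over D'"
    using assms(3) unfolding detour_move_def by blast
  then interpret A: detour D D' \<gamma> \<gamma>'
    using assms(1,2) by unfold_locales (simp_all add: pathstart_def pathfinish_def)
  interpret B: detour D' D \<gamma>' \<gamma> by (rule A.detour_sym)
  have KK: "B.K = A.K" unfolding A.K' B.K_def ..
  have rel: "B.related g' g \<longleftrightarrow> A.related g g'" for g g' :: "complex \<Rightarrow> 'a"
    unfolding A.related_def B.related_def KK A.ends Diff_eq by (auto simp: eq_commute)
  show ?thesis
  proof (rule card_eq_by_relation[where R = A.related])
    show "\<exists>!g'. g' \<in> point_labelings X up dn D' \<and> A.related g g'" if "g \<in> point_labelings X up dn D" for g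
    proof (rule ex_ex1I)
      show "\<exists>g'. g' \<in> point_labelings X up dn D' \<and> A.related g g'" by (rule A.related_exists[OF that])
      fix g1 g2
      assume "g1 \<in> point_labelings X up dn D' \<and> A.related g g1" "g2 \<in> point_labelings X up dn D' \<and> A.related g g2"
      then show "g1 = g2" using A.related_unique[of g1 X up dn g2 g] by simp
    qed
    show "\<exists>!g. g \<in> point_labelings X up dn D \<and> A.related g g'" if "g' \<in> point_labelings X up dn D'" for g'
    proof (rule ex_ex1I)
      show "\<exists>g. g \<in> point_labelings X up dn D \<and> A.related g g'"
        using B.related_exists[OF that] by (simp only: rel)
      fix g1 g2
      assume "g1 \<in> point_labelings X up dn D \<and> A.related g1 g'" "g2 \<in> point_labelings X up dn D \<and> A.related g2 g'"
      then show "g1 = g2" using B.related_unique[of g1 X up dn g2 g'] by (simp only: rel)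
    qed
  qed
qed

section \<open>The invariance theorem\<close>

theorem corollary2:
  fixes X :: "'a set" and up dn :: "'a \<Rightarrow> 'a \<Rightarrow> 'a" and D D' :: diagram
  assumes "bikei X up dn" and "finite X"
    and "vmv_diagram D" and "vmv_diagram D'"
    and "same_virtual_knotted_surface D D'"
  shows "card (labelings X up dn D) = card (labelings X up dn D')"
proof -
  have move: "card (point_labelings X up dn E) = card (point_labelings X up dn E')"
    if "elementary_move E E'" for E E'
    using that card_point_labelings_planar_isotopic card_point_labelings_detour
      card_point_labelings_yoshikawa_move[OF assms(1)]
    unfolding elementary_move_def by (elim conjE disjE) simp_all
  have "equivclp elementary_move D D'"
    using assms(5) by (simp add: same_virtual_knotted_surface_def)
  then have "card (point_labelings X up dn D) = card (point_labelings X up dn D')"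
  proof (induction rule: equivclp_induct)
    case (step E E')
    then show ?case using move[of E E'] move[of E' E] by auto
  qed simp
  then show ?thesis
    by (simp add: card_labelings_eq_point_labelings assms(3,4))
qed

end
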